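(* Let $\Omega\subset\mathbb{R}$ be a bounded domain, let $$\mathcal{A}:=\left\{ Q\in W^{1,2}(\Omega,\mathbb{R}^{3\times3}) \;:\; Q^T=Q,\ \operatorname{Tr}Q=0,\ Q \text{ uniaxial}\right\},$$ $$\mathcal{B}:=\left\{ (s,n) \;:\; s\in W^{1,2}(\Omega),\ n\in W^{1,2}_{loc}(\Omega\setminus\{s=0\},\mathbb{S}^2),\ \int_\Omega s^2|\nabla n|^2\,dx<\infty\right\}.$$ Then minimising $I_L(Q)$ over $\mathcal{A}$ is equivalent to minimising $I_E(n,s)$ over $\mathcal{B}$, in the following sense: for every $Q\in\mathcal{A}$ there is $(s,n)\in\mathcal{B}$ with $Q=s\left(n\otimes n-\tfrac13 I\right)$ a.e. in $\Omega$; for every $(s,n)\in\mathcal{B}$ the matrix field $Q:=s\left(n\otimes n-\tfrac13 I\right)$ belongs to $\mathcal{A}$; and whenever $Q\in\mathcal A$ and $(s,n)\in\mathcal B$ are related in this way, $I_L(Q)=I_E(n,s)$. Consequently any minimiser $Q$ of $I_L$ over $\mathcal{A}$ yields a minimiser $(s,n)$ of $I_E$ over $\mathcal{B}$ and vice versa.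
   Context: $Q$ is called uniaxial if (a.e.) at least two of its three eigenvalues are equal, i.e. $Q=s(n\otimes n-\frac13 I)$ for some $s\in\mathbb{R}$, $n\in\mathbb{S}^2$. Fix $t\in\mathbb{R}$ and real constants $a<0$, $b$, $c>0$, and put $\overline a=\frac{3a}{2}$, $\overline b=\frac{9b}{2}$, $\overline c=\frac{9c}{4}$. Define $$I_L(Q)=\int_\Omega |\nabla Q|^2+4t\,Q\cdot\nabla\times Q+3t^2|Q|^2+\psi_B(Q)\,dx,\qquad \psi_B(Q)=\tfrac{\overline a}{2}\operatorname{Tr}(Q^2)+\tfrac{\overline b}{3}\operatorname{Tr}(Q^3)+\tfrac{\overline c}{4}(\operatorname{Tr}(Q^2))^2,$$ $$I_E(n,s)=\int_\Omega 2s^2\left(|\nabla n|^2+2t\,n\cdot\nabla\times n+t^2\right)+\tfrac23|\nabla s|^2+\sigma(s)\,dx,\qquad \sigma(s)=\tfrac a2s^2+\tfrac b3s^3+\tfrac c4s^4 .$$ Here $(\nabla\times Q)_{ij}=\sum_{a,b}\epsilon_{jab}\,\partial_aQ_{ib}$, the dot is the Frobenius inner product and $|\cdot|$ the Frobenius norm. Functions on $\Omega\subset\mathbb{R}$ are regarded as functions of one of the three Cartesian coordinates, derivatives in the other two coordinates being zero. Sobolev functions are identified with their precise (here continuous) representatives. Terms carrying the factor $s^2$ are taken to be $0$ on $\{s=0\}$, where $n$ and the expression $s(n\otimes n-\frac13I)$ need no definition other than that the latter equals $0$. *)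

theory Defs
  imports "HOL-Analysis.Analysis"
begin

section \<open>Sobolev spaces on open subsets of the real line\<close>

definition L2_on :: "real set \<Rightarrow> (real \<Rightarrow> 'a::euclidean_space) \<Rightarrow> bool" where
  "L2_on U f \<longleftrightarrow> f \<in> borel_measurable (lebesgue_on U) \<and>
     integrable (lebesgue_on U) (\<lambda>x. (norm (f x))\<^sup>2)"

definition test_function :: "real set \<Rightarrow> (real \<Rightarrow> real) \<Rightarrow> bool" where
  "test_function U \<phi> \<longleftrightarrow> (\<forall>m x. (deriv ^^ m) \<phi> field_differentiable (at x)) \<and>
     compact (closure {x. \<phi> x \<noteq> 0}) \<and> closure {x. \<phi> x \<noteq> 0} \<subseteq> U"

definition locally_integrable :: "real set \<Rightarrow> (real \<Rightarrow> 'a::euclidean_space) \<Rightarrow> bool" where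
  "locally_integrable U f \<longleftrightarrow> (\<forall>K. compact K \<and> K \<subseteq> U \<longrightarrow> integrable (lebesgue_on K) f)"

definition has_weak_deriv ::
    "real set \<Rightarrow> (real \<Rightarrow> 'a::euclidean_space) \<Rightarrow> (real \<Rightarrow> 'a) \<Rightarrow> bool" where
  "has_weak_deriv U f g \<longleftrightarrow> locally_integrable U f \<and> locally_integrable U g \<and>
     (\<forall>\<phi>. test_function U \<phi> \<longrightarrow>
        (\<integral>x. deriv \<phi> x *\<^sub>R f x \<partial>lebesgue_on U) = - (\<integral>x. \<phi> x *\<^sub>R g x \<partial>lebesgue_on U))"

text \<open>A weak derivative is unique only up to null sets; \<open>weak_deriv\<close> selects one version, and
  it occurs below only inside integrals. Its values outside \<open>U\<close> are meaningless.\<close>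

definition weak_deriv ::
    "real set \<Rightarrow> (real \<Rightarrow> 'a::euclidean_space) \<Rightarrow> real \<Rightarrow> 'a" where
  "weak_deriv U f = (SOME g. has_weak_deriv U f g)"

text \<open>In one dimension every Sobolev function has a unique continuous representative. The
  elements of the following spaces are these representatives; their values outside \<open>U\<close> are
  unconstrained.\<close>

definition W12 :: "real set \<Rightarrow> (real \<Rightarrow> 'a::euclidean_space) set" where
  "W12 U = {f. continuous_on U f \<and> L2_on U f \<and> (\<exists>g. has_weak_deriv U f g \<and> L2_on U g)}"

definition W12_loc :: "real set \<Rightarrow> (real \<Rightarrow> 'a::euclidean_space) set" where
  "W12_loc U = {f. continuous_on U f \<and>
     (\<exists>g. has_weak_deriv U f g \<and> (\<forall>K. compact K \<and> K \<subseteq> U \<longrightarrow> L2_on K f \<and> L2_on K g))}"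

section \<open>Uniaxial matrices\<close>

text \<open>\<open>\<mu>\<close> lists the three eigenvalues with multiplicity, i.e. the roots of the characteristic
  polynomial.\<close>

definition uniaxial :: "real^3^3 \<Rightarrow> bool" where
  "uniaxial Q \<longleftrightarrow> (\<exists>\<mu> :: 3 \<Rightarrow> real.
     (\<forall>x. det (mat x - Q) = (\<Prod>i\<in>UNIV. x - \<mu> i)) \<and> (\<exists>i j. i \<noteq> j \<and> \<mu> i = \<mu> j))"

definition tensor :: "real^3 \<Rightarrow> real^3 \<Rightarrow> real^3^3" where
  "tensor u v = (\<chi> i j. u $ i * v $ j)"

text \<open>Where \<open>s\<close> vanishes this is \<open>0\<close>, whatever the value of \<open>n\<close>.\<close>

definition Q_of :: "(real \<Rightarrow> real) \<Rightarrow> (real \<Rightarrow> real^3) \<Rightarrow> real \<Rightarrow> real^3^3" where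
  "Q_of s n x = s x *\<^sub>R (tensor (n x) (n x) - (1/3) *\<^sub>R mat 1)"

section \<open>Gradient and curl of functions of the single coordinate \<open>k\<close>\<close>

definition levi_civita :: "3 \<Rightarrow> 3 \<Rightarrow> 3 \<Rightarrow> real" where
  "levi_civita i j l =
     (if (i, j, l) \<in> {(1, 2, 3), (2, 3, 1), (3, 1, 2)} then 1
      else if (i, j, l) \<in> {(3, 2, 1), (2, 1, 3), (1, 3, 2)} then - 1
      else 0)"

text \<open>\<open>grad k f'\<close> is the three-dimensional gradient (at a point) of a function depending only on
  the \<open>k\<close>-th Cartesian coordinate and having derivative \<open>f'\<close> there: its \<open>a\<close>-th entry is
  \<open>\<partial>\<^sub>a f\<close>. The curls take such a gradient as argument, so \<open>G $ a $ b\<close> is \<open>\<partial>\<^sub>a n\<^sub>b\<close> and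
  \<open>G $ a $ i $ b\<close> is \<open>\<partial>\<^sub>a Q\<^sub>i\<^sub>b\<close>. The library norms and inner products on \<open>real^3^3\<close> and
  \<open>real^3^3^3\<close> are the Frobenius ones.\<close>

definition grad :: "3 \<Rightarrow> 'a::euclidean_space \<Rightarrow> 'a^3" where
  "grad k f' = (\<chi> a. if a = k then f' else 0)"

definition curl_vec :: "real^3^3 \<Rightarrow> real^3" where
  "curl_vec G = (\<chi> j. \<Sum>a\<in>UNIV. \<Sum>b\<in>UNIV. levi_civita j a b * G $ a $ b)"

definition curl_mat :: "real^3^3^3 \<Rightarrow> real^3^3" where
  "curl_mat G = (\<chi> i j. \<Sum>a\<in>UNIV. \<Sum>b\<in>UNIV. levi_civita j a b * G $ a $ i $ b)"

section \<open>Energies and admissible classes\<close>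

definition psi_B :: "real \<Rightarrow> real \<Rightarrow> real \<Rightarrow> real^3^3 \<Rightarrow> real" where
  "psi_B a b c Q =
     (let a' = 3 * a / 2; b' = 9 * b / 2; c' = 9 * c / 4
      in a' / 2 * trace (Q ** Q) + b' / 3 * trace (Q ** Q ** Q) + c' / 4 * (trace (Q ** Q))\<^sup>2)"

definition sigma :: "real \<Rightarrow> real \<Rightarrow> real \<Rightarrow> real \<Rightarrow> real" where
  "sigma a b c s = a / 2 * s ^ 2 + b / 3 * s ^ 3 + c / 4 * s ^ 4"

text \<open>On the admissible classes below (for bounded intervals) both integrands are integrable, so
  the Bochner integrals carry their usual meaning.\<close>

definition I_L :: "3 \<Rightarrow> real \<Rightarrow> real \<Rightarrow> real \<Rightarrow> real \<Rightarrow> real set \<Rightarrow> (real \<Rightarrow> real^3^3) \<Rightarrow> real" where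
  "I_L k t a b c \<Omega> Q =
     (\<integral>x. (let DQ = grad k (weak_deriv \<Omega> Q x)
          in (norm DQ)\<^sup>2 + 4 * t * (Q x \<bullet> curl_mat DQ) + 3 * t\<^sup>2 * (norm (Q x))\<^sup>2
             + psi_B a b c (Q x))
      \<partial>lebesgue_on \<Omega>)"

text \<open>The factor \<open>s\<^sup>2\<close> annihilates the meaningless values of \<open>n\<close> and its weak derivative on the zero
  set of \<open>s\<close>.\<close>

definition I_E ::
    "3 \<Rightarrow> real \<Rightarrow> real \<Rightarrow> real \<Rightarrow> real \<Rightarrow> real set \<Rightarrow> (real \<Rightarrow> real^3) \<Rightarrow> (real \<Rightarrow> real) \<Rightarrow> real" where
  "I_E k t a b c \<Omega> n s =
     (\<integral>x. (let Dn = grad k (weak_deriv (\<Omega> - {x. s x = 0}) n x);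
              Ds = grad k (weak_deriv \<Omega> s x)
          in 2 * (s x)\<^sup>2 * ((norm Dn)\<^sup>2 + 2 * t * (n x \<bullet> curl_vec Dn) + t\<^sup>2)
             + 2/3 * (norm Ds)\<^sup>2 + sigma a b c (s x))
      \<partial>lebesgue_on \<Omega>)"

definition class_A :: "real set \<Rightarrow> (real \<Rightarrow> real^3^3) set" where
  "class_A \<Omega> = {Q. Q \<in> W12 \<Omega> \<and>
     (AE x in lebesgue_on \<Omega>. transpose (Q x) = Q x \<and> trace (Q x) = 0 \<and> uniaxial (Q x))}"

definition class_B :: "real set \<Rightarrow> ((real \<Rightarrow> real) \<times> (real \<Rightarrow> real^3)) set" where
  "class_B \<Omega> = {(s, n). s \<in> W12 \<Omega> \<and>
     n \<in> W12_loc (\<Omega> - {x. s x = 0}) \<and> n ` (\<Omega> - {x. s x = 0}) \<subseteq> sphere 0 1 \<and>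
     integrable (lebesgue_on \<Omega>)
       (\<lambda>x. (s x)\<^sup>2 * (norm (weak_deriv (\<Omega> - {x. s x = 0}) n x))\<^sup>2)}"

definition related ::
    "real set \<Rightarrow> (real \<Rightarrow> real^3^3) \<Rightarrow> (real \<Rightarrow> real) \<Rightarrow> (real \<Rightarrow> real^3) \<Rightarrow> bool" where
  "related \<Omega> Q s n \<longleftrightarrow> (AE x in lebesgue_on \<Omega>. Q x = Q_of s n x)"

end

theory Submission
  imports Defs
begin

text \<open>On open subsets of the line, a continuous function has weak derivative \<open>g\<close> iff it is locally an
  indefinite integral of \<open>g\<close>, which gives product and chain rules. For \<open>Q \<in> \<A>\<close> the scalar
  \<open>s = 3 Tr Q\<^sup>3 / Tr Q\<^sup>2\<close> is continuous and vanishes exactly where \<open>Q\<close> does. On \<open>{s \<noteq> 0}\<close> the matrix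
  \<open>Q / s + I / 3\<close> is a continuous field of rank one projections, which lifts through the double cover
  \<open>n \<mapsto> n \<otimes> n\<close> to a unit vector field \<open>n\<close>. The pointwise identities
  \<open>|Q'|\<^sup>2 = 2 s\<^sup>2 |n'|\<^sup>2 + 2/3 s'\<^sup>2\<close>, by \<open>n \<bullet> n' = 0\<close>, and \<open>Q \<bullet> curl Q = s\<^sup>2 n \<bullet> curl n\<close> yield both
  the integrability claims and the equality of the energies. Across the zero set of \<open>s\<close>, where all
  derivatives vanish almost everywhere, integrability of the derivative on \<open>{s \<noteq> 0}\<close> suffices.\<close>

section \<open>Calculus of locally absolutely continuous functions\<close>

text \<open>The obstacle is the zero set of \<open>s\<close>. It can be a Cantor-like set of
  positive measure, its complement can have infinitely many components, and the director need not
  have a limit at its points (for \<open>s x = x\<close> it may rotate by the angle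
  \<open>ln x\<close>). So nothing can be glued at endpoints of intervals: the algebra is done on
  the open set where \<open>s\<close> is nonzero, and a square-integrable bound carries the result
  across the rest.

  The quotient for \<open>s\<close> comes from the invariants: if Q = s (n \<otimes> n - I/3) with a
  unit vector n, then Tr Q^2 = |Q|^2 = 2/3 s^2 and Tr Q^3 = 2/9 s^3. Unlike the square root of 3/2
  |Q|^2 it also has the right sign, which distinguishes the two kinds of uniaxial tensors.

  Derivatives are encoded through increments: \<open>f y - f x\<close> is the integral of
  \<open>g\<close> over every compact interval inside \<open>U\<close>. Uniqueness of
  \<open>g\<close> up to null sets then makes the choice behind \<open>weak_deriv\<close> harmless,
  product and chain rules become estimates of increments, and the values of \<open>f\<close> and
  \<open>g\<close> outside \<open>U\<close> never enter.\<close>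

definition has_ac_deriv ::
    "real set \<Rightarrow> (real \<Rightarrow> 'a::euclidean_space) \<Rightarrow> (real \<Rightarrow> 'a) \<Rightarrow> bool" where
  "has_ac_deriv U f g \<longleftrightarrow> (\<forall>x y. x \<le> y \<longrightarrow> {x..y} \<subseteq> U \<longrightarrow>
     g absolutely_integrable_on {x..y} \<and> f y - f x = integral {x..y} g)"

lemma has_ac_derivD:
  assumes "has_ac_deriv U f g" "x \<le> y" "{x..y} \<subseteq> U"
  shows "g absolutely_integrable_on {x..y}" "g integrable_on {x..y}"
    "f y - f x = integral {x..y} g"
  using assms by (auto simp: has_ac_deriv_def absolutely_integrable_on_def)

lemma has_ac_deriv_subset: "has_ac_deriv U f g \<Longrightarrow> V \<subseteq> U \<Longrightarrow> has_ac_deriv V f g"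
  unfolding has_ac_deriv_def by blast

lemma has_ac_deriv_cong:
  assumes "\<And>x. x \<in> U \<Longrightarrow> f x = f' x" "\<And>x. x \<in> U \<Longrightarrow> g x = g' x"
  shows "has_ac_deriv U f g \<longleftrightarrow> has_ac_deriv U f' g'"
proof -
  have "(g absolutely_integrable_on {x..y} \<and> f y - f x = integral {x..y} g) \<longleftrightarrow>
    (g' absolutely_integrable_on {x..y} \<and> f' y - f' x = integral {x..y} g')"
    if "x \<le> y" "{x..y} \<subseteq> U" for x y
  proof -
    have "g absolutely_integrable_on {x..y} \<longleftrightarrow> g' absolutely_integrable_on {x..y}"
      using that assms(2) by (intro set_integrable_cong) auto
    moreover have "integral {x..y} g = integral {x..y} g'"
      using that assms(2) by (intro integral_cong) auto
    ultimately show ?thesis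
      using that assms(1)[of x] assms(1)[of y] by (auto simp: subset_iff)
  qed
  then show ?thesis
    unfolding has_ac_deriv_def by blast
qed

lemma has_ac_deriv_const: "has_ac_deriv U (\<lambda>x. c) (\<lambda>x. 0)"
  by (simp add: has_ac_deriv_def)

lemma has_ac_deriv_diff:
  assumes "has_ac_deriv U f f'" "has_ac_deriv U g g'"
  shows "has_ac_deriv U (\<lambda>x. f x - g x) (\<lambda>x. f' x - g' x)"
  unfolding has_ac_deriv_def
proof (intro allI impI conjI)
  fix x y :: real
  assume xy: "x \<le> y" "{x..y} \<subseteq> U"
  note F = has_ac_derivD[OF assms(1) xy] and G = has_ac_derivD[OF assms(2) xy]
  show "(\<lambda>x. f' x - g' x) absolutely_integrable_on {x..y}"
    using F(1) G(1) by (rule set_integral_diff)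
  show "f y - g y - (f x - g x) = integral {x..y} (\<lambda>x. f' x - g' x)"
    using F(3) G(3) by (simp add: integral_diff[OF F(2) G(2)] algebra_simps)
qed

lemma has_ac_deriv_continuous_on:
  assumes "has_ac_deriv U f g" "open U"
  shows "continuous_on U f"
proof -
  have "isCont f z" if "z \<in> U" for z
  proof -
    obtain e where e: "e > 0" "cball z e \<subseteq> U"
      using \<open>open U\<close> \<open>z \<in> U\<close> open_contains_cball by blast
    have sub: "{z - e..z + e} \<subseteq> U"
      using e by (auto simp: cball_eq_atLeastAtMost)
    have le: "z - e \<le> z + e" using e by simp
    have int: "g integrable_on {z - e..z + e}"
      by (rule has_ac_derivD(2)[OF assms(1) le sub])
    have "continuous_on {z - e..z + e} (\<lambda>x. f (z - e) + integral {z - e..x} g)"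
      by (intro continuous_intros indefinite_integral_continuous_1[OF int])
    moreover have "f x = f (z - e) + integral {z - e..x} g" if "x \<in> {z - e..z + e}" for x
      using has_ac_derivD(3)[OF assms(1), of "z - e" x] that sub
      by (auto simp: algebra_simps subset_iff)
    ultimately have "continuous_on {z - e..z + e} f"
      using continuous_on_cong by (metis (no_types, lifting))
    then show ?thesis
      using e by (intro continuous_on_interior[of "{z - e..z + e}"]) auto
  qed
  then show ?thesis
    by (simp add: continuous_at_imp_continuous_on)
qed

section \<open>Increments from local estimates, product and chain rules\<close>

text \<open>Bisection: the defect \<open>f y - f x - integral {x..y} D\<close> and the bound
  \<open>integral {x..y} m\<close> are both additive over adjacent intervals, so the estimate
  survives concatenation and it suffices to have it on short intervals around each point.\<close>

lemma increment_integral_error_le: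
  fixes f :: "real \<Rightarrow> 'a::euclidean_space"
  assumes "a \<le> b" and D: "D integrable_on {a..b}" and m: "m integrable_on {a..b}"
    and local: "\<And>z. z \<in> {a..b} \<Longrightarrow>
      \<exists>d>0. \<forall>x y. a \<le> x \<and> x \<le> z \<and> z \<le> y \<and> y \<le> b \<and> y - x < d \<longrightarrow>
        norm (f y - f x - integral {x..y} D) \<le> integral {x..y} m"
  shows "norm (f b - f a - integral {a..b} D) \<le> integral {a..b} m"
proof -
  let ?P = "\<lambda>x y. a \<le> x \<and> y \<le> b \<longrightarrow> norm (f y - f x - integral {x..y} D) \<le> integral {x..y} m"
  have "?P a b"
  proof (rule Bolzano[where P = ?P, OF \<open>a \<le> b\<close>])
    fix x y z
    assume trans: "?P x y" "?P y z" "x \<le> y" "y \<le> z"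
    show "?P x z"
    proof
      assume xz: "a \<le> x \<and> z \<le> b"
      have D': "D integrable_on {x..z}" and m': "m integrable_on {x..z}"
        using xz by (auto intro: integrable_on_subinterval[OF D] integrable_on_subinterval[OF m])
      have D'': "integral {x..z} D = integral {x..y} D + integral {y..z} D"
        using trans by (simp add: Henstock_Kurzweil_Integration.integral_combine D')
      have m'': "integral {x..z} m = integral {x..y} m + integral {y..z} m"
        using trans by (simp add: Henstock_Kurzweil_Integration.integral_combine m')
      have "norm (f z - f x - integral {x..z} D) =
          norm ((f y - f x - integral {x..y} D) + (f z - f y - integral {y..z} D))"
        by (simp add: D'' algebra_simps)
      also have "\<dots> \<le> integral {x..y} m + integral {y..z} m"
        by (rule norm_triangle_mono) (use trans xz in auto)
      finally show "norm (f z - f x - integral {x..z} D) \<le> integral {x..z} m"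
        by (simp add: m'')
    qed
  next
    fix z assume "a \<le> z" "z \<le> b"
    then have "z \<in> {a..b}" by simp
    from local[OF this] show "\<exists>d>0. \<forall>x y. x \<le> z \<and> z \<le> y \<and> y - x < d \<longrightarrow> ?P x y"
      by blast
  qed
  then show ?thesis by simp
qed

text \<open>Local errors of size \<open>e\<close> times the integral of one fixed \<open>m\<close>
  add up to \<open>e\<close> times the total integral, and \<open>e\<close> is arbitrary. The weight
  \<open>m\<close> takes the place of the length \<open>y - x\<close>, because derivatives here are
  integrable but possibly unbounded.\<close>

lemma increment_eq_integral_if_locally_approx:
  fixes f :: "real \<Rightarrow> 'a::euclidean_space"
  assumes "a \<le> b" and D: "D integrable_on {a..b}" and m: "m integrable_on {a..b}"
    and local: "\<And>z e. z \<in> {a..b} \<Longrightarrow> e > 0 \<Longrightarrow>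
      \<exists>d>0. \<forall>x y. a \<le> x \<and> x \<le> z \<and> z \<le> y \<and> y \<le> b \<and> y - x < d \<longrightarrow>
        norm (f y - f x - integral {x..y} D) \<le> e * integral {x..y} m"
  shows "f b - f a = integral {a..b} D"
proof -
  have bound: "norm (f b - f a - integral {a..b} D) \<le> e * integral {a..b} m" if "e > 0" for e :: real
    using increment_integral_error_le[of a b D "\<lambda>x. e * m x" f] \<open>a \<le> b\<close> D
      integrable_on_mult_right[OF m] local[OF _ that]
    by simp
  have "norm (f b - f a - integral {a..b} D) \<le> 0"
  proof (rule field_le_epsilon)
    fix e :: real assume "e > 0"
    \<comment> \<open>The absolute value and the \<open>+ 1\<close> keep the divisor positive
      whatever the sign of the integral.\<close>
    define M where "M = \<bar>integral {a..b} m\<bar> + 1"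
    have "M > 0" by (simp add: M_def)
    have "norm (f b - f a - integral {a..b} D) \<le> e / M * integral {a..b} m"
      using \<open>e > 0\<close> \<open>M > 0\<close> by (intro bound) simp
    also have "\<dots> \<le> e / M * M"
      using \<open>e > 0\<close> \<open>M > 0\<close> by (intro mult_left_mono) (auto simp: M_def)
    finally show "norm (f b - f a - integral {a..b} D) \<le> 0 + e"
      using \<open>M > 0\<close> by simp
  qed
  then show ?thesis by simp
qed

lemma bilinear_imp_bounded_bilinear:
  fixes p :: "'a::euclidean_space \<Rightarrow> 'b::euclidean_space \<Rightarrow> 'c::euclidean_space"
  shows "bilinear p \<Longrightarrow> bounded_bilinear p"
  by (simp add: bilinear_conv_bounded_bilinear)

lemma absolutely_integrable_continuous_bilinear:
  fixes p :: "'a::euclidean_space \<Rightarrow> 'b::euclidean_space \<Rightarrow> 'c::euclidean_space"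
  assumes p: "bilinear p" and f: "continuous_on {x..y} f" and g: "g absolutely_integrable_on {x..y::real}"
  shows "(\<lambda>z. p (f z) (g z)) absolutely_integrable_on {x..y}"
  using f by (intro absolutely_integrable_bounded_measurable_product[OF p _ _ _ g]
      continuous_imp_measurable_on_sets_lebesgue compact_imp_bounded compact_continuous_image) auto

lemma has_ac_deriv_bilinear:
  fixes p :: "'a::euclidean_space \<Rightarrow> 'b::euclidean_space \<Rightarrow> 'c::euclidean_space"
  assumes p: "bilinear p" and f: "has_ac_deriv U f f'" and g: "has_ac_deriv U g g'" and "open U"
  shows "has_ac_deriv U (\<lambda>x. p (f x) (g x)) (\<lambda>x. p (f x) (g' x) + p (f' x) (g x))"
  unfolding has_ac_deriv_def
proof (intro allI impI)
  fix a b :: real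
  assume ab: "a \<le> b" "{a..b} \<subseteq> U"
  interpret p: bounded_bilinear p
    by (rule bilinear_imp_bounded_bilinear[OF p])
  note F = has_ac_derivD[OF f ab] and G = has_ac_derivD[OF g ab]
  have cf: "continuous_on {a..b} f" and cg: "continuous_on {a..b} g"
    using has_ac_deriv_continuous_on[OF f \<open>open U\<close>] has_ac_deriv_continuous_on[OF g \<open>open U\<close>] ab
    by (auto intro: continuous_on_subset)
  define D where "D = (\<lambda>x. p (f x) (g' x) + p (f' x) (g x))"
  have sw: "bilinear (\<lambda>x y. p y x)"
    using p by (simp add: bilinear_def)
  have I1: "(\<lambda>x. p (f x) (g' x)) absolutely_integrable_on {a..b}"
    by (rule absolutely_integrable_continuous_bilinear[OF p cf G(1)])
  have I2: "(\<lambda>x. p (f' x) (g x)) absolutely_integrable_on {a..b}"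
    by (rule absolutely_integrable_continuous_bilinear[OF sw cg F(1)])
  have DI: "D absolutely_integrable_on {a..b}"
    unfolding D_def using I1 I2 by (rule set_integral_add(1))
  obtain B where B: "B > 0" "\<And>x y. norm (p x y) \<le> norm x * norm y * B"
    using p.pos_bounded by blast
  define m where "m = (\<lambda>x. norm (g' x) + norm (f' x))"
  have mi: "m integrable_on {a..b}"
    unfolding m_def using F(1) G(1) by (auto simp: absolutely_integrable_on_def intro: integrable_add)
  have "p (f b) (g b) - p (f a) (g a) = integral {a..b} D"
  proof (rule increment_eq_integral_if_locally_approx[where m = m])
    fix z e :: real
    assume z: "z \<in> {a..b}" and "e > 0"
    \<comment> \<open>Comparison through \<open>z\<close> gives oscillations of at most
      \<open>2 * e'\<close>, and \<open>2 * e' * B = e\<close>.\<close>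
    define e' where "e' = e / (2 * B)"
    have "e' > 0" using \<open>e > 0\<close> B by (simp add: e'_def)
    obtain d1 where d1: "d1 > 0" "\<And>w. w \<in> {a..b} \<Longrightarrow> dist w z < d1 \<Longrightarrow> dist (f w) (f z) < e'"
      using cf z \<open>e' > 0\<close> unfolding continuous_on_iff by blast
    obtain d2 where d2: "d2 > 0" "\<And>w. w \<in> {a..b} \<Longrightarrow> dist w z < d2 \<Longrightarrow> dist (g w) (g z) < e'"
      using cg z \<open>e' > 0\<close> unfolding continuous_on_iff by blast
    show "\<exists>d>0. \<forall>x y. a \<le> x \<and> x \<le> z \<and> z \<le> y \<and> y \<le> b \<and> y - x < d \<longrightarrow>
        norm (p (f y) (g y) - p (f x) (g x) - integral {x..y} D) \<le> e * integral {x..y} m"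
    proof (intro exI[of _ "min d1 d2"] conjI allI impI)
      show "min d1 d2 > 0" using d1 d2 by simp
      fix x y
      assume xy: "a \<le> x \<and> x \<le> z \<and> z \<le> y \<and> y \<le> b \<and> y - x < min d1 d2"
      have sub: "{x..y} \<subseteq> {a..b}" using xy by auto
      have xyU: "x \<le> y" "{x..y} \<subseteq> U" using xy sub ab by auto
      note F' = has_ac_derivD[OF f xyU] and G' = has_ac_derivD[OF g xyU]
      have osc: "norm (f y - f w) \<le> 2 * e'" "norm (g x - g w) \<le> 2 * e'" if "w \<in> {x..y}" for w
      proof -
        have w: "w \<in> {a..b}" "y \<in> {a..b}" "x \<in> {a..b}" using that sub xy by auto
        have near: "dist w z < min d1 d2" "dist y z < min d1 d2" "dist x z < min d1 d2"
          using that xy by (auto simp: dist_real_def)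
        have "dist (f w) (f z) < e'" "dist (f y) (f z) < e'" "dist (g w) (g z) < e'" "dist (g x) (g z) < e'"
          using d1(2)[of w] d1(2)[of y] d2(2)[of w] d2(2)[of x] w near by auto
        then show "norm (f y - f w) \<le> 2 * e'" "norm (g x - g w) \<le> 2 * e'"
          unfolding dist_norm[symmetric]
          using dist_triangle2[of "f y" "f w" "f z"] dist_triangle2[of "g x" "g w" "g z"] by auto
      qed
      have i1: "(\<lambda>w. p (f y) (g' w)) integrable_on {x..y}" "integral {x..y} (\<lambda>w. p (f y) (g' w)) = p (f y) (g y - g x)"
        using integrable_linear[OF G'(2) p.bounded_linear_right[of "f y"]]
          integral_linear[OF G'(2) p.bounded_linear_right[of "f y"]] G'(3) by (auto simp: o_def)
      have i2: "(\<lambda>w. p (f' w) (g x)) integrable_on {x..y}" "integral {x..y} (\<lambda>w. p (f' w) (g x)) = p (f y - f x) (g x)"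
        using integrable_linear[OF F'(2) p.bounded_linear_left[of "g x"]]
          integral_linear[OF F'(2) p.bounded_linear_left[of "g x"]] F'(3) by (auto simp: o_def)
      have Di: "D integrable_on {x..y}" and mi': "m integrable_on {x..y}"
        using sub mi set_lebesgue_integral_eq_integral(1)[OF DI] by (auto intro: integrable_on_subinterval)
      have "p (f y) (g y) - p (f x) (g x) - integral {x..y} D =
          integral {x..y} (\<lambda>w. p (f y) (g' w) + p (f' w) (g x) - D w)"
        using i1 i2 Di by (simp add: integral_diff integral_add integrable_add p.diff_left p.diff_right)
      also have "norm \<dots> \<le> integral {x..y} (\<lambda>w. e * m w)"
      proof (rule integral_norm_bound_integral)
        show "(\<lambda>w. p (f y) (g' w) + p (f' w) (g x) - D w) integrable_on {x..y}"
          using i1 i2 Di by (intro integrable_diff integrable_add)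
        show "(\<lambda>w. e * m w) integrable_on {x..y}"
          using mi' by (rule integrable_on_mult_right)
        fix w assume w: "w \<in> {x..y}"
        have "p (f y) (g' w) + p (f' w) (g x) - D w = p (f y - f w) (g' w) + p (f' w) (g x - g w)"
          by (simp add: D_def p.diff_left p.diff_right)
        also have "norm \<dots> \<le> norm (f y - f w) * norm (g' w) * B + norm (f' w) * norm (g x - g w) * B"
          by (rule norm_triangle_mono) (rule B)+
        also have "\<dots> \<le> 2 * e' * norm (g' w) * B + norm (f' w) * (2 * e') * B"
          using osc[OF w] B(1) \<open>e' > 0\<close> by (intro add_mono mult_mono mult_nonneg_nonneg) auto
        also have "\<dots> = e * m w"
          using B(1) by (simp add: e'_def m_def field_simps)
        finally show "norm (p (f y) (g' w) + p (f' w) (g x) - D w) \<le> e * m w" .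
      qed
      finally show "norm (p (f y) (g y) - p (f x) (g x) - integral {x..y} D) \<le> e * integral {x..y} m"
        by simp
    qed
  qed (use ab mi set_lebesgue_integral_eq_integral(1)[OF DI] in auto)
  with DI show "(\<lambda>x. p (f x) (g' x) + p (f' x) (g x)) absolutely_integrable_on {a..b} \<and>
      p (f b) (g b) - p (f a) (g a) = integral {a..b} (\<lambda>x. p (f x) (g' x) + p (f' x) (g x))"
    by (simp add: D_def)
qed

text \<open>A chain rule in which the differentiability of the outer function is expressed by a
  continuous factorisation of its increments.\<close>

lemma has_ac_deriv_increments:
  fixes p :: "'a::euclidean_space \<Rightarrow> 'b::euclidean_space \<Rightarrow> 'c::euclidean_space"
  assumes p: "bilinear p" and h: "has_ac_deriv U h h'" and "open U"
    and A: "\<And>z. z \<in> U \<Longrightarrow> isCont (\<lambda>w. A (fst w) (snd w)) (z, z)"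
    and inc: "\<And>z. z \<in> U \<Longrightarrow>
      \<forall>\<^sub>F w in nhds (z, z). f (snd w) - f (fst w) = p (A (fst w) (snd w)) (h (snd w) - h (fst w))"
  shows "has_ac_deriv U f (\<lambda>x. p (A x x) (h' x))"
  unfolding has_ac_deriv_def
proof (intro allI impI)
  fix a b :: real
  assume ab: "a \<le> b" "{a..b} \<subseteq> U"
  interpret p: bounded_bilinear p
    by (rule bilinear_imp_bounded_bilinear[OF p])
  note H = has_ac_derivD[OF h ab]
  have cA: "continuous_on {a..b} (\<lambda>x. A x x)"
  proof (rule continuous_at_imp_continuous_on, rule)
    fix z assume "z \<in> {a..b}"
    then have "isCont ((\<lambda>w. A (fst w) (snd w)) \<circ> (\<lambda>x. (x, x))) z"
      using A ab by (intro continuous_at_compose) (auto intro!: continuous_intros)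
    then show "isCont (\<lambda>x. A x x) z" by (simp add: o_def)
  qed
  define D where "D = (\<lambda>x. p (A x x) (h' x))"
  have DI: "D absolutely_integrable_on {a..b}"
    unfolding D_def by (rule absolutely_integrable_continuous_bilinear[OF p cA H(1)])
  obtain B where B: "B > 0" "\<And>x y. norm (p x y) \<le> norm x * norm y * B"
    using p.pos_bounded by blast
  define m where "m = (\<lambda>x. norm (h' x))"
  have mi: "m integrable_on {a..b}"
    unfolding m_def using H(1) by (auto simp: absolutely_integrable_on_def)
  have "f b - f a = integral {a..b} D"
  proof (rule increment_eq_integral_if_locally_approx[where m = m])
    fix z e :: real
    assume z: "z \<in> {a..b}" and "e > 0"
    then have zU: "z \<in> U" using ab by auto
    define e' where "e' = e / (2 * B)"
    have "e' > 0" using \<open>e > 0\<close> B by (simp add: e'_def)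
    obtain d1 where d1: "d1 > 0" "\<And>w. dist w (z, z) < d1 \<Longrightarrow> dist (A (fst w) (snd w)) (A z z) < e'"
      using A[OF zU] \<open>e' > 0\<close> unfolding continuous_at_eps_delta dist_norm by fastforce
    obtain d2 where d2: "d2 > 0" "\<And>w. dist w (z, z) < d2 \<Longrightarrow>
        f (snd w) - f (fst w) = p (A (fst w) (snd w)) (h (snd w) - h (fst w))"
      using inc[OF zU] unfolding eventually_nhds_metric by blast
    show "\<exists>d>0. \<forall>x y. a \<le> x \<and> x \<le> z \<and> z \<le> y \<and> y \<le> b \<and> y - x < d \<longrightarrow>
        norm (f y - f x - integral {x..y} D) \<le> e * integral {x..y} m"
    \<comment> \<open>The radius is halved because the distance of \<open>(v, w)\<close> from
      \<open>(z, z)\<close> is bounded by the sum of two coordinate distances, each at most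
      \<open>y - x\<close>.\<close>
    proof (intro exI[of _ "min d1 d2 / 2"] conjI allI impI)
      show "min d1 d2 / 2 > 0" using d1 d2 by simp
      fix x y
      assume xy: "a \<le> x \<and> x \<le> z \<and> z \<le> y \<and> y \<le> b \<and> y - x < min d1 d2 / 2"
      have sub: "{x..y} \<subseteq> {a..b}" using xy by auto
      have xyU: "x \<le> y" "{x..y} \<subseteq> U" using xy sub ab by auto
      note H' = has_ac_derivD[OF h xyU]
      have near: "dist (v, w) (z, z) < min d1 d2" if "v \<in> {x..y}" "w \<in> {x..y}" for v w
      proof -
        have "dist (v, w) (z, z) \<le> \<bar>v - z\<bar> + \<bar>w - z\<bar>"
          by (simp add: dist_Pair_Pair dist_real_def sqrt_sum_squares_le_sum_abs)
        also have "\<dots> < min d1 d2" using that xy by auto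
        finally show ?thesis .
      qed
      have osc: "norm (A x y - A w w) \<le> 2 * e'" if "w \<in> {x..y}" for w
        using d1(2)[of "(x, y)"] d1(2)[of "(w, w)"] near[of x y] near[of w w] that xy
          dist_triangle2[of "A x y" "A w w" "A z z"]
        unfolding dist_norm[symmetric] by auto
      have i1: "(\<lambda>w. p (A x y) (h' w)) integrable_on {x..y}" "integral {x..y} (\<lambda>w. p (A x y) (h' w)) = p (A x y) (h y - h x)"
        using integrable_linear[OF H'(2) p.bounded_linear_right[of "A x y"]]
          integral_linear[OF H'(2) p.bounded_linear_right[of "A x y"]] H'(3) by (auto simp: o_def)
      have Di: "D integrable_on {x..y}" and mi': "m integrable_on {x..y}"
        using sub mi set_lebesgue_integral_eq_integral(1)[OF DI] by (auto intro: integrable_on_subinterval)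
      have "f y - f x = p (A x y) (h y - h x)"
        using d2(2)[of "(x, y)"] near[of x y] xy by auto
      then have "f y - f x - integral {x..y} D = integral {x..y} (\<lambda>w. p (A x y) (h' w) - D w)"
        using i1 Di by (simp add: integral_diff)
      also have "norm \<dots> \<le> integral {x..y} (\<lambda>w. e * m w)"
      proof (rule integral_norm_bound_integral)
        show "(\<lambda>w. p (A x y) (h' w) - D w) integrable_on {x..y}"
          using i1 Di by (intro integrable_diff)
        show "(\<lambda>w. e * m w) integrable_on {x..y}"
          using mi' by (rule integrable_on_mult_right)
        fix w assume w: "w \<in> {x..y}"
        have "p (A x y) (h' w) - D w = p (A x y - A w w) (h' w)"
          by (simp add: D_def p.diff_left)
        also have "norm \<dots> \<le> norm (A x y - A w w) * norm (h' w) * B"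
          by (rule B)
        also have "\<dots> \<le> 2 * e' * norm (h' w) * B"
          using osc[OF w] B(1) by (intro mult_right_mono) auto
        also have "\<dots> = e * m w"
          using B(1) by (simp add: e'_def m_def field_simps)
        finally show "norm (p (A x y) (h' w) - D w) \<le> e * m w" .
      qed
      finally show "norm (f y - f x - integral {x..y} D) \<le> e * integral {x..y} m"
        by simp
    qed
  qed (use ab mi set_lebesgue_integral_eq_integral(1)[OF DI] in auto)
  with DI show "(\<lambda>x. p (A x x) (h' x)) absolutely_integrable_on {a..b} \<and>
      f b - f a = integral {a..b} (\<lambda>x. p (A x x) (h' x))"
    by (simp add: D_def)
qed

text \<open>Integrability and the increment identity both pass to unions of adjacent intervals, so
  bisection applies again. This glues a derivative from two open sets that overlap.\<close>

lemma has_ac_deriv_locally: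
  assumes "\<And>z. z \<in> U \<Longrightarrow> \<exists>V. open V \<and> z \<in> V \<and> has_ac_deriv V f g"
  shows "has_ac_deriv U f g"
  unfolding has_ac_deriv_def
proof (intro allI impI)
  fix a b :: real
  assume ab: "a \<le> b" "{a..b} \<subseteq> U"
  let ?P = "\<lambda>x y. a \<le> x \<and> x \<le> y \<and> y \<le> b \<longrightarrow>
    g absolutely_integrable_on {x..y} \<and> f y - f x = integral {x..y} g"
  have "?P a b"
  proof (rule Bolzano[where P = ?P, OF \<open>a \<le> b\<close>])
    fix x y z
    assume trans: "?P x y" "?P y z" "x \<le> y" "y \<le> z"
    show "?P x z"
    proof
      assume xz: "a \<le> x \<and> x \<le> z \<and> z \<le> b"
      have *: "g absolutely_integrable_on {x..y}" "f y - f x = integral {x..y} g"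
        "g absolutely_integrable_on {y..z}" "f z - f y = integral {y..z} g"
        using trans xz by auto
      have G: "g absolutely_integrable_on {x..z}"
        using absolutely_integrable_on_combine[OF *(1,3)] trans by simp
      then have "integral {x..z} g = integral {x..y} g + integral {y..z} g"
        using trans by (simp add: Henstock_Kurzweil_Integration.integral_combine absolutely_integrable_on_def)
      with * G show "g absolutely_integrable_on {x..z} \<and> f z - f x = integral {x..z} g"
        by (simp add: algebra_simps)
    qed
  next
    fix z assume "a \<le> z" "z \<le> b"
    then have "z \<in> U" using ab by auto
    then obtain V where V: "open V" "z \<in> V" "has_ac_deriv V f g"
      using assms by blast
    then obtain d where d: "d > 0" "ball z d \<subseteq> V"
      using open_contains_ball by blast
    have "{x..y} \<subseteq> V" if "x \<le> z" "z \<le> y" "y - x < d" for x y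
    proof -
      have "{x..y} \<subseteq> ball z d" using that by (auto simp: dist_real_def)
      with d show ?thesis by blast
    qed
    then show "\<exists>d>0. \<forall>x y. x \<le> z \<and> z \<le> y \<and> y - x < d \<longrightarrow> ?P x y"
      using d(1) V(3) unfolding has_ac_deriv_def by blast
  qed
  then show "g absolutely_integrable_on {a..b} \<and> f b - f a = integral {a..b} g"
    using ab by simp
qed

section \<open>Uniqueness of the derivative and extension across zeros\<close>

lemma AE_lebesgue_onI_negligible:
  assumes "negligible {x \<in> U. \<not> P x}" "U \<in> sets lebesgue"
  shows "AE x in lebesgue_on U. P x"
proof -
  have "AE x in lebesgue. x \<notin> {x \<in> U. \<not> P x}"
    using assms(1) by (intro AE_not_in) (simp add: negligible_iff_null_sets)
  then show ?thesis
    using assms(2) by (auto simp: AE_restrict_space_iff elim: AE_mp)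
qed

lemma AE_lebesgue_on_subset:
  assumes "AE x in lebesgue_on T. P x" "S \<subseteq> T" "S \<in> sets lebesgue" "T \<in> sets lebesgue"
  shows "AE x in lebesgue_on S. P x"
  using assms by (auto simp: AE_restrict_space_iff elim: AE_mp)

text \<open>Every integral of \<open>d\<close> over an interval inside \<open>U\<close> is zero,
  while outside a null set \<open>d\<close> is the limit of its own averages, by Lebesgue
  differentiation.\<close>

lemma has_ac_deriv_0_AE:
  fixes d :: "real \<Rightarrow> 'a::euclidean_space"
  assumes "open U" "has_ac_deriv U (\<lambda>x. c) d"
  shows "AE x in lebesgue_on U. d x = 0"
proof (rule AE_lebesgue_onI_negligible)
  show "negligible {x \<in> U. d x \<noteq> 0}"
  proof (subst locally_negligible_alt, rule)
    fix z assume "z \<in> {x \<in> U. d x \<noteq> 0}"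
    then have z: "z \<in> U" "d z \<noteq> 0" by auto
    obtain e where e: "e > 0" "cball z e \<subseteq> U"
      using \<open>open U\<close> \<open>z \<in> U\<close> open_contains_cball by blast
    define a b where "a = z - e" and "b = z + e"
    have sub: "{a..b} \<subseteq> U"
      using e by (auto simp: cball_eq_atLeastAtMost a_def b_def)
    have dab: "d absolutely_integrable_on {a..b}"
      using has_ac_derivD(1)[OF assms(2) _ sub] e by (simp add: a_def b_def)
    \<comment> \<open>The differentiation theorem is applied to a function integrable over every
      interval, hence the extension by zero.\<close>
    define D where "D = (\<lambda>x. if x \<in> {a..b} then d x else 0)"
    have "D absolutely_integrable_on UNIV"
      unfolding D_def using dab by (simp only: absolutely_integrable_restrict_UNIV)
    then have "D absolutely_integrable_on cbox x y" for x y
      by (rule set_integrable_subset) auto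
    then have "D integrable_on cbox x y" for x y
      by (simp add: absolutely_integrable_on_def)
    from integrable_ccontinuous_explicit[OF this] obtain N where N: "negligible N"
      "\<And>x e. x \<notin> N \<Longrightarrow> 0 < e \<Longrightarrow> \<exists>d>0. \<forall>h. 0 < h \<and> h < d \<longrightarrow>
         norm (integral {x..x + h} D /\<^sub>R h - D x) < e"
      by simp metis
    have "d x = 0" if x: "x \<in> {a<..<b}" "x \<notin> N" for x
    proof (rule ccontr)
      assume "d x \<noteq> 0"
      then obtain r where r: "r > 0" "\<And>h. 0 < h \<Longrightarrow> h < r \<Longrightarrow>
          norm (integral {x..x + h} D /\<^sub>R h - D x) < norm (d x)"
        using N(2)[OF x(2), of "norm (d x)"] by auto
      define h where "h = min (r / 2) (b - x)"
      have h: "0 < h" "h < r" "{x..x + h} \<subseteq> {a..b}"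
        using x r(1) by (auto simp: h_def min_def)
      have "integral {x..x + h} D = integral {x..x + h} d"
        using h by (intro integral_cong) (auto simp: D_def)
      also have "\<dots> = 0"
        using has_ac_derivD(3)[OF assms(2), of x "x + h"] h subset_trans[OF h(3) sub] by simp
      finally show False
        using r(2)[OF h(1,2)] x by (simp add: D_def)
    qed
    then have "{x \<in> U. d x \<noteq> 0} \<inter> {a<..<b} \<subseteq> N" by blast
    then have "negligible ({x \<in> U. d x \<noteq> 0} \<inter> {a<..<b})"
      using N(1) negligible_subset by blast
    moreover have "openin (top_of_set {x \<in> U. d x \<noteq> 0}) ({x \<in> U. d x \<noteq> 0} \<inter> {a<..<b})"
      by (simp add: openin_open_Int)
    moreover have "z \<in> {x \<in> U. d x \<noteq> 0} \<inter> {a<..<b}"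
      using z e by (simp add: a_def b_def)
    ultimately show "\<exists>V. openin (top_of_set {x \<in> U. d x \<noteq> 0}) V \<and> z \<in> V \<and> negligible V"
      by blast
  qed
qed (use \<open>open U\<close> in auto)

text \<open>The difference of the two derivatives is a derivative of the constant zero.\<close>

lemma has_ac_deriv_unique:
  assumes "open U" "has_ac_deriv U f g" "has_ac_deriv U f h"
  shows "AE x in lebesgue_on U. g x = h x"
proof -
  have "has_ac_deriv U (\<lambda>x. f x - f x) (\<lambda>x. g x - h x)"
    by (rule has_ac_deriv_diff[OF assms(2,3)])
  then have "AE x in lebesgue_on U. g x - h x = 0"
    by (intro has_ac_deriv_0_AE[OF assms(1), where c = 0]) simp
  then show ?thesis by simp
qed

text \<open>The set where \<open>f\<close> vanishes carries no part of the integral of \<open>norm g\<close>, so the error made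
  near that set is controlled by an integral with weight \<open>1 / (1 + k * norm f)\<close>, which tends to zero
  as \<open>k\<close> tends to infinity.\<close>

lemma has_ac_deriv_extend_zero_set:
  fixes f :: "real \<Rightarrow> 'a::euclidean_space"
  assumes f: "continuous_on U f"
    and ac: "has_ac_deriv {x \<in> U. f x \<noteq> 0} f g"
    and g: "\<And>x y. x \<le> y \<Longrightarrow> {x..y} \<subseteq> U \<Longrightarrow> g absolutely_integrable_on {x..y}"
    and g0: "\<And>x. x \<in> U \<Longrightarrow> f x = 0 \<Longrightarrow> g x = 0"
  shows "has_ac_deriv U f g"
  unfolding has_ac_deriv_def
proof (intro allI impI conjI)
  fix a b :: real
  assume ab: "a \<le> b" "{a..b} \<subseteq> U"
  show gi: "g absolutely_integrable_on {a..b}" by (rule g[OF ab])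
  have gi': "g integrable_on {a..b}" "(\<lambda>x. norm (g x)) integrable_on {a..b}"
    using gi by (auto simp: absolutely_integrable_on_def)
  have cf: "continuous_on {a..b} f" using f ab(2) by (rule continuous_on_subset)
  \<comment> \<open>\<open>G\<close> is a monotone control function: increments of \<open>f\<close>
    are bounded by those of \<open>G\<close> on intervals without zeros, then between a point and a
    zero, and finally on all intervals.\<close>
  define G where "G x = integral {a..x} (\<lambda>x. norm (g x))" for x
  have cG: "continuous_on {a..b} G"
    unfolding G_def by (rule indefinite_integral_continuous_1[OF gi'(2)])
  have G_diff: "integral {x..y} (\<lambda>x. norm (g x)) = G y - G x" if "a \<le> x" "x \<le> y" "y \<le> b" for x y
    using Henstock_Kurzweil_Integration.integral_combine[of a x y "\<lambda>x. norm (g x)"] that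
      integrable_on_subinterval[OF gi'(2), of a y] by (simp add: G_def)
  have G_mono: "G x \<le> G y" if "a \<le> x" "x \<le> y" "y \<le> b" for x y
    using G_diff[OF that] integral_nonneg[of "\<lambda>x. norm (g x)" "{x..y}"]
      integrable_on_subinterval[OF gi'(2), of x y] that by simp
  have free: "norm (f y - f x) \<le> \<bar>G y - G x\<bar>"
    if "x \<in> {a..b}" "y \<in> {a..b}" "\<And>w. w \<in> closed_segment x y \<Longrightarrow> f w \<noteq> 0" for x y
    using that
  proof (induction x y rule: linorder_wlog)
    case (le x y)
    then have sub: "{x..y} \<subseteq> {a..b}" by auto
    have *: "{x..y} \<subseteq> {x \<in> U. f x \<noteq> 0}"
      using le sub ab by (auto simp: closed_segment_eq_real_ivl)
    have "norm (f y - f x) = norm (integral {x..y} g)"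
      using has_ac_derivD(3)[OF ac le(1) *] by simp
    also have "\<dots> \<le> integral {x..y} (\<lambda>x. norm (g x))"
      using sub gi' by (intro integral_norm_bound_integral) (auto intro: integrable_on_subinterval)
    also have "\<dots> \<le> \<bar>G y - G x\<bar>" using G_diff[of x y] le by simp
    finally show ?case .
  next
    case (sym x y)
    then show ?case by (simp add: norm_minus_commute abs_minus_commute closed_segment_commute)
  qed
  have zero: "norm (f x) \<le> \<bar>G z - G x\<bar>" if xz: "x \<in> {a..b}" "z \<in> {a..b}" "f z = 0" for x z
  proof (cases "f x = 0")
    case False
    \<comment> \<open>Between \<open>x\<close> and its nearest zero \<open>t\<close> there is no
      other zero, so \<open>free\<close> applies up to points before \<open>t\<close>. Continuity of
      \<open>f\<close> and \<open>G\<close> carries the estimate to \<open>t\<close>, and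
      monotonicity of \<open>G\<close> extends it to \<open>z\<close>.\<close>
    define K where "K = {t \<in> closed_segment x z. f t = 0}"
    have segab: "closed_segment x z \<subseteq> {a..b}"
      using xz by (auto simp: closed_segment_eq_real_ivl split: if_splits)
    have "closed K"
      unfolding K_def using cf segab
      by (intro continuous_closed_preimage_constant) (auto intro: continuous_on_subset)
    moreover have "K \<noteq> {}" using xz by (auto simp: K_def)
    ultimately obtain t where t: "t \<in> K" "\<And>y. y \<in> K \<Longrightarrow> dist x t \<le> dist x y"
      using distance_attains_inf by blast
    have tseg: "t \<in> closed_segment x z" "f t = 0" using t by (auto simp: K_def)
    then have xt: "x \<noteq> t" using False by auto
    have tab: "t \<in> {a..b}" using tseg segab by blast
    have sub: "closed_segment x t \<subseteq> {a..b}"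
      using xz tab by (auto simp: closed_segment_eq_real_ivl split: if_splits)
    have "norm (f w - f x) - \<bar>G w - G x\<bar> \<le> 0" if "w \<in> open_segment x t" for w
    proof -
      have "f v \<noteq> 0" if v: "v \<in> closed_segment x w" for v
      proof
        assume "f v = 0"
        have "v \<in> closed_segment x z"
          using v \<open>w \<in> open_segment x t\<close> tseg(1)
          by (auto simp: closed_segment_eq_real_ivl open_segment_eq_real_ivl split: if_splits)
        then have "dist x t \<le> dist x v" using t(2) \<open>f v = 0\<close> by (simp add: K_def)
        then show False
          using v \<open>w \<in> open_segment x t\<close>
          by (auto simp: closed_segment_eq_real_ivl open_segment_eq_real_ivl dist_real_def split: if_splits)
      qed
      then show ?thesis
        using free[of x w] xz sub that by (auto simp: open_segment_def)
    qed
    moreover have cl: "closure (open_segment x t) = closed_segment x t" using xt by simp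
    moreover have "continuous_on (closed_segment x t) (\<lambda>w. norm (f w - f x) - \<bar>G w - G x\<bar>)"
      by (intro continuous_intros continuous_on_subset[OF cf sub] continuous_on_subset[OF cG sub])
    ultimately have "norm (f t - f x) - \<bar>G t - G x\<bar> \<le> 0"
      using continuous_le_on_closure[of "open_segment x t" "\<lambda>w. norm (f w - f x) - \<bar>G w - G x\<bar>" t 0]
      by simp
    then have "norm (f t - f x) \<le> \<bar>G t - G x\<bar>" by simp
    also have "\<bar>G t - G x\<bar> \<le> \<bar>G z - G x\<bar>"
    proof -
      consider "x \<le> t" "t \<le> z" | "z \<le> t" "t \<le> x"
        using tseg(1) by (auto simp: closed_segment_eq_real_ivl split: if_splits)
      then show ?thesis
      proof cases
        case 1
        then show ?thesis using G_mono[of x t] G_mono[of t z] xz by simp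
      next
        case 2
        then show ?thesis using G_mono[of z t] G_mono[of t x] xz by simp
      qed
    qed
    finally show ?thesis using tseg(2) by simp
  qed simp
  have incr: "norm (f y - f x) \<le> G y - G x" if xy: "a \<le> x" "x \<le> y" "y \<le> b" for x y
  proof (cases "\<exists>z\<in>{x..y}. f z = 0")
    case True
    then obtain z where z: "z \<in> {x..y}" "f z = 0" by blast
    have "norm (f y - f x) \<le> norm (f y) + norm (f x)" by (rule norm_triangle_ineq4)
    also have "\<dots> \<le> (G y - G z) + (G z - G x)"
      using zero[of y z] zero[of x z] z xy G_mono[of z y] G_mono[of x z] by auto
    finally show ?thesis by simp
  next
    case False
    then show ?thesis
      using free[of x y] xy G_mono[of x y] by (auto simp: closed_segment_eq_real_ivl)
  qed
  \<comment> \<open>The factor 4 makes the weight at least 2 wherever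
    \<open>k * norm (f x) \<le> 1\<close>. That pays for both parts of the defect near a zero, the
    increment of \<open>f\<close> and the integral of \<open>g\<close>. On short intervals around a
    nonzero value the defect vanishes and any nonnegative weight will do.\<close>
  define m where "m k x = (4 / (1 + real k * norm (f x))) * norm (g x)" for k x
  have pos: "1 + real k * norm (f x) > 0" for k x
    by (simp add: add_pos_nonneg)
  have m_abs: "m k absolutely_integrable_on {a..b}" for k
    unfolding m_def
  proof (rule absolutely_integrable_continuous_bilinear[OF bilinear_times])
    show "continuous_on {a..b} (\<lambda>x. 4 / (1 + real k * norm (f x)))"
      using pos[of k] by (intro continuous_intros cf) (metis less_irrefl)
    show "(\<lambda>x. norm (g x)) absolutely_integrable_on {a..b}"
      using gi by (rule set_integrable_norm)
  qed
  then have m_int: "m k integrable_on {a..b}" for k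
    by (simp add: absolutely_integrable_on_def)
  have bound: "norm (f b - f a - integral {a..b} g) \<le> integral {a..b} (m k)" for k
  proof (rule increment_integral_error_le[OF ab(1) gi'(1) m_int])
    fix z assume z: "z \<in> {a..b}"
    show "\<exists>d>0. \<forall>x y. a \<le> x \<and> x \<le> z \<and> z \<le> y \<and> y \<le> b \<and> y - x < d \<longrightarrow>
        norm (f y - f x - integral {x..y} g) \<le> integral {x..y} (m k)"
    proof (cases "f z = 0")
      case True
      \<comment> \<open>The radius \<open>1 / (1 + k)\<close> guarantees
        \<open>k * norm (f w) < 1\<close> on the whole short interval.\<close>
      obtain d where d: "d > 0" "\<And>w. w \<in> {a..b} \<Longrightarrow> dist w z < d \<Longrightarrow> dist (f w) (f z) < 1 / (1 + real k)"
      proof -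
        have "0 < 1 / (1 + real k)" by (simp add: add_pos_nonneg)
        with cf z show ?thesis
          using that unfolding continuous_on_iff by blast
      qed
      show ?thesis
      proof (intro exI[of _ d] conjI allI impI)
        fix x y assume xy: "a \<le> x \<and> x \<le> z \<and> z \<le> y \<and> y \<le> b \<and> y - x < d"
        have sub: "{x..y} \<subseteq> {a..b}" using xy by auto
        have *: "(\<lambda>x. norm (g x)) integrable_on {x..y}" "m k integrable_on {x..y}" "g integrable_on {x..y}"
          by (rule integrable_on_subinterval[OF _ sub], rule gi' m_int)+
        have "norm (f y - f x - integral {x..y} g) \<le> norm (f y - f x) + norm (integral {x..y} g)"
          by (rule norm_triangle_ineq4)
        also have "\<dots> \<le> 2 * integral {x..y} (\<lambda>x. norm (g x))"
        proof -
          have "norm (integral {x..y} g) \<le> integral {x..y} (\<lambda>x. norm (g x))"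
            using *(3,1) by (rule integral_norm_bound_integral) simp
          then show ?thesis
            using incr[of x y] G_diff[of x y] xy by linarith
        qed
        also have "\<dots> = integral {x..y} (\<lambda>x. 2 * norm (g x))" by simp
        also have "\<dots> \<le> integral {x..y} (m k)"
        proof (rule integral_le)
          fix w assume w: "w \<in> {x..y}"
          then have "norm (f w) < 1 / (1 + real k)"
            using d(2)[of w] sub xy True by (auto simp: dist_real_def)
          then have "norm (f w) + real k * norm (f w) < 1"
            by (simp add: field_simps)
          then have "real k * norm (f w) \<le> 1"
            using norm_ge_zero[of "f w"] by linarith
          then have "2 \<le> 4 / (1 + real k * norm (f w))"
            using pos[of k w] by (simp add: field_simps)
          then show "2 * norm (g w) \<le> m k w"
            unfolding m_def by (intro mult_right_mono) auto
        qed (use * in \<open>auto intro: integrable_on_mult_right\<close>)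
        finally show "norm (f y - f x - integral {x..y} g) \<le> integral {x..y} (m k)" .
      qed (rule d(1))
    next
      case False
      obtain d where d: "d > 0" "\<And>w. w \<in> {a..b} \<Longrightarrow> dist w z < d \<Longrightarrow> dist (f w) (f z) < norm (f z)"
        using cf z zero_less_norm_iff[THEN iffD2, OF False] unfolding continuous_on_iff by blast
      show ?thesis
      proof (intro exI[of _ d] conjI allI impI)
        fix x y assume xy: "a \<le> x \<and> x \<le> z \<and> z \<le> y \<and> y \<le> b \<and> y - x < d"
        have sub: "{x..y} \<subseteq> {a..b}" using xy by auto
        have "f w \<noteq> 0" if w: "w \<in> {x..y}" for w
        proof -
          have "w \<in> {a..b}" "dist w z < d" using w xy by (auto simp: dist_real_def)
          from d(2)[OF this] show ?thesis by auto
        qed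
        then have "{x..y} \<subseteq> {x \<in> U. f x \<noteq> 0}" using sub ab by auto
        then have "f y - f x - integral {x..y} g = 0"
          using has_ac_derivD(3)[OF ac, of x y] xy by simp
        moreover have "0 \<le> integral {x..y} (m k)"
          using pos[of k]
          by (intro integral_nonneg integrable_on_subinterval[OF m_int sub]) (simp add: m_def less_imp_le)
        ultimately show "norm (f y - f x - integral {x..y} g) \<le> integral {x..y} (m k)" by simp
      qed (rule d(1))
    qed
  qed
  \<comment> \<open>The limit is zero at every point for one of two reasons: the weight decays where
    \<open>f\<close> is nonzero, and \<open>g\<close> itself vanishes where \<open>f\<close>
    does.\<close>
  have "(\<lambda>k. integral {a..b} (m k)) \<longlonglongrightarrow> integral {a..b} (\<lambda>x. 0::real)"
  proof (rule dominated_convergence(2)[OF m_int])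
    show "(\<lambda>x. 4 * norm (g x)) integrable_on {a..b}"
      using gi'(2) by (rule integrable_on_mult_right)
    fix k x assume x: "x \<in> {a..b}"
    have "4 / (1 + real k * norm (f x)) \<le> 4"
      using pos[of k x] by (simp add: field_simps)
    then show "norm (m k x) \<le> 4 * norm (g x)"
      using pos[of k x] by (simp add: m_def mult_right_mono abs_mult del: times_divide_eq_left)
  next
    fix x assume x: "x \<in> {a..b}"
    show "(\<lambda>k. m k x) \<longlonglongrightarrow> 0"
    proof (cases "f x = 0")
      case True
      then show ?thesis using g0[of x] x ab by (auto simp: m_def)
    next
      case False
      then have "filterlim (\<lambda>k. 1 + real k * norm (f x)) at_top sequentially"
        by (intro filterlim_tendsto_add_at_top[OF tendsto_const]
            filterlim_at_top_mult_tendsto_pos[OF tendsto_const] filterlim_real_sequentially) auto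
      then have "(\<lambda>k. 4 / (1 + real k * norm (f x))) \<longlonglongrightarrow> 0"
        by (intro tendsto_divide_0[OF tendsto_const] filterlim_at_top_imp_at_infinity)
      then show ?thesis
        unfolding m_def by (rule tendsto_mult_left_zero)
    qed
  qed
  then have "(\<lambda>k. integral {a..b} (m k)) \<longlonglongrightarrow> 0" by simp
  then have "norm (f b - f a - integral {a..b} g) \<le> 0"
    by (rule LIMSEQ_le_const) (use bound in auto)
  then show "f b - f a = integral {a..b} g" by simp
qed

lemma has_ac_deriv_imp_integrable_compact:
  assumes "has_ac_deriv U f g" "open U" "compact K" "K \<subseteq> U"
  shows "g absolutely_integrable_on K"
proof -
  have "\<forall>z\<in>K. \<exists>e>0. cball z e \<subseteq> U"
    using assms open_contains_cball by blast
  then obtain e where e: "\<And>z. z \<in> K \<Longrightarrow> e z > 0 \<and> cball z (e z) \<subseteq> U"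
    by metis
  have "K \<subseteq> (\<Union>z\<in>K. ball z (e z))"
    using e by force
  then obtain F where F: "F \<subseteq> K" "finite F" "K \<subseteq> (\<Union>z\<in>F. ball z (e z))"
    by (rule compactE_image[OF assms(3) open_ball])
  have "g absolutely_integrable_on (\<Union>z\<in>F. cball z (e z))"
  proof (rule set_integrable_UN[OF F(2)])
    fix z assume "z \<in> F"
    then have "z - e z \<le> z + e z" "{z - e z..z + e z} \<subseteq> U"
      using e[of z] F(1) by (auto simp: cball_eq_atLeastAtMost subset_iff)
    then show "g absolutely_integrable_on cball z (e z)"
      using has_ac_derivD(1)[OF assms(1)] by (simp add: cball_eq_atLeastAtMost)
  qed auto
  moreover have "K \<subseteq> (\<Union>z\<in>F. cball z (e z))"
    using F(3) by (rule order_trans) (intro UN_mono ball_subset_cball order_refl)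
  moreover have "K \<in> sets lebesgue" using assms(3) by (simp add: compact_imp_closed)
  ultimately show ?thesis using set_integrable_subset by blast
qed

lemma absolutely_integrable_on_iff_lebesgue_on:
  assumes "S \<in> sets lebesgue"
  shows "f absolutely_integrable_on S \<longleftrightarrow> integrable (lebesgue_on S) f"
  using assms by (simp add: set_integrable_def integrable_restrict_space)

lemma has_ac_deriv_imp_locally_integrable:
  assumes "has_ac_deriv U f g" "open U"
  shows "locally_integrable U g"
  unfolding locally_integrable_def
proof (intro allI impI)
  fix K assume "compact K \<and> K \<subseteq> U"
  then show "integrable (lebesgue_on K) g"
    using has_ac_deriv_imp_integrable_compact[OF assms, of K] absolutely_integrable_on_iff_lebesgue_on[of K g]
    by (simp add: compact_imp_closed)
qed

lemma continuous_on_imp_locally_integrable: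
  fixes f :: "real \<Rightarrow> 'a::euclidean_space"
  assumes "continuous_on U f"
  shows "locally_integrable U f"
  unfolding locally_integrable_def
proof (intro allI impI)
  fix K assume K: "compact K \<and> K \<subseteq> U"
  then have c: "continuous_on K f" using assms continuous_on_subset by blast
  have KL: "K \<in> lmeasurable" using K by (simp add: lmeasurable_compact)
  obtain B where B: "\<And>x. x \<in> K \<Longrightarrow> norm (f x) \<le> B"
    using compact_imp_bounded[OF compact_continuous_image[OF c]] K unfolding bounded_iff by auto
  have "f absolutely_integrable_on K"
  proof (rule measurable_bounded_by_integrable_imp_absolutely_integrable)
    show "f \<in> borel_measurable (lebesgue_on K)"
      using c KL by (intro continuous_imp_measurable_on_sets_lebesgue) auto
    show "(\<lambda>x. B) integrable_on K"
      using KL by (rule integrable_on_const)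
  qed (use B KL in auto)
  then show "integrable (lebesgue_on K) f"
    using KL by (simp add: absolutely_integrable_on_iff_lebesgue_on fmeasurableD)
qed

section \<open>Weak derivatives\<close>

lemma has_real_derivative_0_if_locally_0:
  fixes h :: "real \<Rightarrow> real"
  assumes "\<forall>\<^sub>F y in nhds x. h y = 0"
  shows "(h has_real_derivative 0) (at x)"
  using assms by (subst DERIV_cong_ev[OF refl _ refl]) auto

text \<open>For \<open>k = 0\<close> this is the classical smooth function exp(-1/x), extended by
  zero, whose derivatives all vanish at 0. The powers of \<open>1 / x\<close> are the factors that
  differentiation produces.\<close>

definition flat :: "nat \<Rightarrow> real \<Rightarrow> real" where
  "flat k x = (if x > 0 then (1 / x) ^ k * exp (- (1 / x)) else 0)"

lemma flat_tendsto_0: "(flat k \<longlongrightarrow> 0) (at 0)"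
proof (rule filterlim_split_at)
  have "\<forall>\<^sub>F x in at_left 0. flat k x = 0"
    by (auto simp: flat_def eventually_at_filter)
  then show "(flat k \<longlongrightarrow> 0) (at_left 0)"
    by (rule tendsto_eventually)
  have "((\<lambda>x. (inverse x) ^ k / exp (inverse x)) \<longlongrightarrow> 0) (at_right (0::real))"
    by (rule filterlim_compose[OF tendsto_power_div_exp_0 filterlim_inverse_at_top_right])
  moreover have "\<forall>\<^sub>F x in at_right 0. (inverse x) ^ k / exp (inverse x) = flat k x"
    by (auto simp: flat_def eventually_at_filter exp_minus field_simps)
  ultimately show "(flat k \<longlongrightarrow> 0) (at_right 0)"
    by (rule Lim_transform_eventually)
qed

text \<open>For positive \<open>x\<close> this is the product rule. At 0 the difference quotient of
  \<open>flat k\<close> is \<open>flat (k + 1)\<close>, which tends to 0.\<close>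

lemma flat_has_derivative:
  "(flat k has_real_derivative (flat (k + 2) x - real k * flat (k + 1) x)) (at x)"
proof -
  consider "x > 0" | "x < 0" | "x = 0" by linarith
  then show ?thesis
  proof cases
    case 1
    have u: "((\<lambda>x. 1 / x) has_real_derivative - ((1 / x)\<^sup>2)) (at x)"
      using 1 by (auto intro!: derivative_eq_intros simp: power2_eq_square)
    have D: "((\<lambda>x. (1 / x) ^ k * exp (- (1 / x))) has_real_derivative
        (flat (k + 2) x - real k * flat (k + 1) x)) (at x)"
      by (rule DERIV_cong[OF DERIV_mult[OF DERIV_power[OF u, of k] DERIV_chain2[OF DERIV_exp DERIV_minus[OF u]]]])
        (use 1 in \<open>cases k; simp add: flat_def power2_eq_square algebra_simps\<close>)
    have ev: "\<forall>\<^sub>F y in nhds x. (1 / y) ^ k * exp (- (1 / y)) = flat k y"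
      using eventually_nhds_in_open[of "{0<..}" x] 1
      by (auto simp: flat_def elim: eventually_mono)
    show ?thesis
      using D DERIV_cong_ev[OF refl ev refl] by blast
  next
    case 2
    have "\<forall>\<^sub>F y in nhds x. flat k y = 0"
      using eventually_nhds_in_open[of "{..<0}" x] 2
      by (auto simp: flat_def elim: eventually_mono)
    then have "(flat k has_real_derivative 0) (at x)"
      by (rule has_real_derivative_0_if_locally_0)
    then show ?thesis using 2 by (simp add: flat_def)
  next
    case 3
    have "\<forall>\<^sub>F y in at 0. flat (k + 1) y = (flat k y - flat k 0) / (y - 0)"
      by (auto simp: flat_def eventually_at_filter)
    then have "((\<lambda>y. (flat k y - flat k 0) / (y - 0)) \<longlongrightarrow> 0) (at 0)"
      by (rule Lim_transform_eventually[OF flat_tendsto_0])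
    then show ?thesis
      using 3 by (simp add: has_field_derivative_iff flat_def)
  qed
qed

text \<open>A space of functions that contains the smooth bumps and is closed under differentiation.\<close>

inductive_set bumps :: "(real \<Rightarrow> real) set" where
  base: "(\<lambda>x. c * (flat k (x - u) * flat l (v - x))) \<in> bumps"
| add: "f \<in> bumps \<Longrightarrow> g \<in> bumps \<Longrightarrow> (\<lambda>x. f x + g x) \<in> bumps"

lemma bumps_has_derivative:
  "f \<in> bumps \<Longrightarrow> \<exists>f'\<in>bumps. \<forall>x. (f has_real_derivative f' x) (at x)"
proof (induction rule: bumps.induct)
  case (base c k u l v)
  define f' where "f' x =
      (c * (flat (k + 2) (x - u) * flat l (v - x)) +
       (- c * real k) * (flat (k + 1) (x - u) * flat l (v - x))) +
      ((- c) * (flat k (x - u) * flat (l + 2) (v - x)) +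
       (c * real l) * (flat k (x - u) * flat (l + 1) (v - x)))" for x
  have "f' \<in> bumps"
    unfolding f'_def[abs_def] by (intro bumps.intros)
  moreover have "((\<lambda>x. c * (flat k (x - u) * flat l (v - x))) has_real_derivative f' x) (at x)" for x
  proof -
    have "((\<lambda>x. x - u) has_real_derivative 1) (at x)" "((\<lambda>x. v - x) has_real_derivative - 1) (at x)"
      by (auto intro!: derivative_eq_intros)
    from DERIV_chain2[OF flat_has_derivative[of k] this(1)] DERIV_chain2[OF flat_has_derivative[of l] this(2)]
    show ?thesis
      by (rule DERIV_cong[OF DERIV_cmult[OF DERIV_mult]]) (simp add: f'_def algebra_simps)
  qed
  ultimately show ?case by blast
next
  case (add f g)
  then obtain f' g' where "f' \<in> bumps" "\<And>x. (f has_real_derivative f' x) (at x)"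
    "g' \<in> bumps" "\<And>x. (g has_real_derivative g' x) (at x)" by blast
  then show ?case
    by (intro bexI[of _ "\<lambda>x. f' x + g' x"]) (auto intro: bumps.add DERIV_add)
qed

lemma bumps_funpow_deriv: "f \<in> bumps \<Longrightarrow> (deriv ^^ m) f \<in> bumps"
proof (induction m)
  case (Suc m)
  then obtain h where h: "h \<in> bumps" "\<And>x. ((deriv ^^ m) f has_real_derivative h x) (at x)"
    using bumps_has_derivative by blast
  then have "deriv ((deriv ^^ m) f) = h"
    using DERIV_imp_deriv by blast
  with h show ?case by simp
qed simp

text \<open>The test functions below are differences of smooth steps, known through their first
  derivative. From that derivative on, all further ones stay in \<open>bumps\<close>, so smoothness
  follows without a formula for \<open>F\<close>.\<close>

lemma test_function_bumps_antiderivative: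
  assumes F: "\<And>x. (F has_real_derivative f x) (at x)" and f: "f \<in> bumps"
    and K: "compact K" "K \<subseteq> U" "\<And>x. x \<notin> K \<Longrightarrow> F x = 0"
  shows "test_function U F"
proof -
  have dF: "deriv F = f" using F DERIV_imp_deriv by blast
  have "(deriv ^^ m) F field_differentiable at x" for m x
  proof (cases m)
    case 0
    then show ?thesis using F by (auto simp: field_differentiable_def)
  next
    case (Suc j)
    then have "(deriv ^^ m) F = (deriv ^^ j) f"
      by (simp add: funpow_Suc_right dF del: funpow.simps)
    then show ?thesis
      using bumps_has_derivative[OF bumps_funpow_deriv[OF f, of j]]
      by (auto simp: field_differentiable_def)
  qed
  moreover have "closure {x. F x \<noteq> 0} \<subseteq> K"
    using K by (intro closure_minimal compact_imp_closed) auto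
  moreover then have "compact (closure {x. F x \<noteq> 0})"
    using K(1) closed_closure compact_Int_closed[of K "closure {x. F x \<noteq> 0}"] by (simp add: Int_absorb1)
  ultimately show ?thesis
    using K(2) by (auto simp: test_function_def)
qed

text \<open>\<open>S\<close> is the indefinite integral of a bump that lives on the interval from
  \<open>- r\<close> to \<open>r\<close>, and \<open>C\<close> is the mass of the bump, positive
  because \<open>S\<close> increases strictly there.\<close>

lemma smooth_step_exists:
  fixes r :: real
  assumes "r > 0"
  obtains S C where "C > 0"
    "\<And>x. (S has_real_derivative (flat 0 (x + r) * flat 0 (r - x))) (at x)"
    "\<And>x. x \<le> - r \<Longrightarrow> S x = 0" "\<And>x. x \<ge> r \<Longrightarrow> S x = C"
proof -
  define b where "b = (\<lambda>x. flat 0 (x + r) * flat 0 (r - x))"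
  have b0: "b x = 0" if "x \<notin> {- r<..<r}" for x
    using that by (auto simp: b_def flat_def)
  have bpos: "b x > 0" if "x \<in> {- r<..<r}" for x
    using that by (auto simp: b_def flat_def)
  have cont: "continuous_on A b" for A
  proof -
    have "continuous_on UNIV (flat 0)"
      using flat_has_derivative by (meson DERIV_isCont continuous_at_imp_continuous_on)
    then show ?thesis unfolding b_def
      by (intro continuous_intros continuous_on_compose2[where f = "\<lambda>x. x + r"]
          continuous_on_compose2[where f = "\<lambda>x. r - x"]) auto
  qed
  \<comment> \<open>Starting one unit to the left of \<open>- r\<close> makes every
    \<open>x \<ge> - r\<close> an interior point for the fundamental theorem; to the left of
    \<open>- r\<close> the function is locally zero.\<close>
  define S where "S = (\<lambda>x. integral {- r - 1..x} b)"
  have Sneg: "S x = 0" if "x \<le> - r" for x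
  proof -
    have "S x = integral {- r - 1..x} (\<lambda>x. 0)"
      unfolding S_def using that by (intro integral_cong b0) auto
    then show ?thesis by simp
  qed
  have der: "(S has_real_derivative b x) (at x)" for x
  proof (cases "x < - r")
    case True
    have "\<forall>\<^sub>F y in nhds x. S y = 0"
      using eventually_nhds_in_open[of "{..<- r}" x] True Sneg by (auto elim: eventually_mono)
    then have "(S has_real_derivative 0) (at x)"
      by (rule has_real_derivative_0_if_locally_0)
    then show ?thesis using b0[of x] True by simp
  next
    case False
    then have "(S has_real_derivative b x) (at x within {- r - 1..x + 1})"
      unfolding S_def by (intro integral_has_real_derivative cont) auto
    then show ?thesis
      using False by (simp add: at_within_Icc_at)
  qed
  have "S (- r) < S r"
  proof (rule DERIV_pos_imp_increasing_open[where f = S])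
    show "continuous_on {- r..r} S"
      using der by (meson DERIV_isCont continuous_at_imp_continuous_on)
  qed (use assms der bpos in auto)
  then have Sr: "S r > 0" using Sneg[of "- r"] by simp
  have Sconst: "S x = S r" if "x \<ge> r" for x
  proof (cases "x = r")
    case False
    then have "r < x" using that by simp
    then show ?thesis
    proof (rule DERIV_isconst_end[where f = S])
      show "continuous_on {r..x} S"
        using der by (meson DERIV_isCont continuous_at_imp_continuous_on)
      show "(S has_real_derivative 0) (at y)" if "r < y" "y < x" for y
        using der[of y] b0[of y] that by auto
    qed
  qed simp
  show thesis
    by (rule that[OF Sr _ Sneg Sconst]) (use der in \<open>simp_all add: b_def\<close>)
qed

section \<open>Weak derivatives are derivatives of indefinite integrals\<close>

lemma lebesgue_on_integral_supported:
  fixes h :: "'a::euclidean_space \<Rightarrow> 'b::euclidean_space"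
  assumes K: "K \<in> sets lebesgue" "K \<subseteq> S" and S: "S \<in> sets lebesgue"
    and h: "h absolutely_integrable_on K" and h0: "\<And>x. x \<in> S - K \<Longrightarrow> h x = 0"
  shows "integrable (lebesgue_on S) h" "integral\<^sup>L (lebesgue_on S) h = integral K h"
proof -
  have eq: "(\<lambda>x. indicat_real S x *\<^sub>R h x) = (\<lambda>x. indicat_real K x *\<^sub>R h x)"
    using K(2) h0 by (auto simp: indicator_def fun_eq_iff)
  show "integrable (lebesgue_on S) h"
    using h S by (simp add: integrable_restrict_space set_integrable_def eq)
  have "integral\<^sup>L (lebesgue_on S) h = integral\<^sup>L (lebesgue_on K) h"
    using S K(1) by (simp add: integral_restrict_space eq)
  also have "\<dots> = integral K h"
    by (rule lebesgue_integral_eq_integral[OF absolutely_integrable_imp_integrable[OF h K(1)] K(1)])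
  finally show "integral\<^sup>L (lebesgue_on S) h = integral K h" .
qed

lemma test_function_has_ac_deriv:
  assumes "test_function U \<phi>"
  shows "continuous_on A \<phi>" "continuous_on A (deriv \<phi>)" "has_ac_deriv UNIV \<phi> (deriv \<phi>)"
proof -
  have *: "(deriv ^^ m) \<phi> field_differentiable at x" for m x
    using assms by (simp add: test_function_def)
  show c: "continuous_on A \<phi>" "continuous_on A (deriv \<phi>)" for A
    using *[of 0] *[of 1] by (auto intro!: continuous_at_imp_continuous_on field_differentiable_imp_continuous_at)
  have d: "(\<phi> has_real_derivative deriv \<phi> x) (at x within A)" for x A
    using *[of 0] by (simp add: field_differentiable_derivI has_field_derivative_at_within)
  show "has_ac_deriv UNIV \<phi> (deriv \<phi>)"
    unfolding has_ac_deriv_def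
  proof (intro allI impI conjI)
    fix x y :: real assume "x \<le> y"
    show "deriv \<phi> absolutely_integrable_on {x..y}"
      using c(2) by (rule absolutely_integrable_continuous_real)
    have "(deriv \<phi> has_integral \<phi> y - \<phi> x) {x..y}"
      using \<open>x \<le> y\<close> d by (intro fundamental_theorem_of_calculus) (auto simp: has_real_derivative_iff_has_vector_derivative)
    then show "\<phi> y - \<phi> x = integral {x..y} (deriv \<phi>)"
      by (simp add: integral_unique)
  qed
qed

text \<open>Integration by parts: the product with a test function, extended by zero, has a
  derivative on the whole line, and its increment over an interval reaching beyond the support is
  zero.\<close>

lemma has_ac_deriv_imp_has_weak_deriv:
  fixes f g :: "real \<Rightarrow> 'a::euclidean_space"
  assumes ac: "has_ac_deriv U f g" and "open U"
  shows "has_weak_deriv U f g"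
  unfolding has_weak_deriv_def
proof (intro conjI allI impI)
  have cf: "continuous_on U f" by (rule has_ac_deriv_continuous_on[OF assms])
  then show "locally_integrable U f" by (rule continuous_on_imp_locally_integrable)
  show "locally_integrable U g" by (rule has_ac_deriv_imp_locally_integrable[OF assms])
  fix \<phi> assume \<phi>: "test_function U \<phi>"
  note T = test_function_has_ac_deriv[OF \<phi>]
  define K where "K = closure {x. \<phi> x \<noteq> 0}"
  have K: "compact K" "K \<subseteq> U" using \<phi> by (auto simp: test_function_def K_def)
  have \<phi>0: "\<phi> x = 0" if "x \<notin> K" for x
    using that closure_subset[of "{x. \<phi> x \<noteq> 0}"] by (auto simp: K_def)
  have d\<phi>0: "deriv \<phi> x = 0" if "x \<notin> K" for x
  proof -
    have "\<forall>\<^sub>F y in nhds x. y \<in> - K"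
      using that K(1) by (intro eventually_nhds_in_open) (auto simp: compact_imp_closed)
    then have "\<forall>\<^sub>F y in nhds x. \<phi> y = 0"
      by eventually_elim (simp add: \<phi>0)
    then have "(\<phi> has_real_derivative 0) (at x)"
      by (rule has_real_derivative_0_if_locally_0)
    then show ?thesis by (rule DERIV_imp_deriv)
  qed
  \<comment> \<open>Outside \<open>U\<close> the values of \<open>f\<close> and \<open>g\<close> are
    arbitrary, so the extension by zero is explicit. The open sets \<open>U\<close> and
    \<open>- K\<close> cover the line, and the derivative is glued from them.\<close>
  define F G where "F x = (if x \<in> U then \<phi> x *\<^sub>R f x else 0)"
    and "G x = (if x \<in> U then \<phi> x *\<^sub>R g x + deriv \<phi> x *\<^sub>R f x else 0)" for x
  have bil: "bilinear (\<lambda>c v. c *\<^sub>R (v::'a))"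
    by (simp add: bilinear_conv_bounded_bilinear bounded_bilinear_scaleR)
  have "has_ac_deriv U (\<lambda>x. \<phi> x *\<^sub>R f x) (\<lambda>x. \<phi> x *\<^sub>R g x + deriv \<phi> x *\<^sub>R f x)"
    by (rule has_ac_deriv_bilinear[OF bil has_ac_deriv_subset[OF T(3) subset_UNIV] ac \<open>open U\<close>])
  then have acU: "has_ac_deriv U F G"
    by (subst has_ac_deriv_cong) (auto simp: F_def G_def)
  have acK: "has_ac_deriv (- K) F G"
    using has_ac_deriv_const[of "- K" "0::'a"]
    by (subst has_ac_deriv_cong) (auto simp: F_def G_def \<phi>0 d\<phi>0)
  have FG: "has_ac_deriv UNIV F G"
  proof (rule has_ac_deriv_locally)
    fix z :: real
    show "\<exists>V. open V \<and> z \<in> V \<and> has_ac_deriv V F G"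
    proof (cases "z \<in> U")
      case False
      then show ?thesis
        using acK K by (intro exI[of _ "- K"]) (auto simp: compact_imp_closed)
    qed (use acU \<open>open U\<close> in blast)
  qed
  obtain M where M: "\<And>x. x \<in> K \<Longrightarrow> \<bar>x\<bar> \<le> M"
    using compact_imp_bounded[OF K(1)] unfolding bounded_iff by auto
  \<comment> \<open>The \<open>+ 1\<close> puts both endpoints outside the support, where
    \<open>F\<close> vanishes.\<close>
  define N where "N = \<bar>M\<bar> + 1"
  have KN: "K \<subseteq> {- N..N}" "N \<notin> K" "- N \<notin> K" "- N \<le> N"
    using M by (force simp: N_def)+
  have Ks: "K \<in> sets lebesgue" and Us: "U \<in> sets lebesgue"
    using K \<open>open U\<close> by (auto simp: compact_imp_closed)
  have gK: "g absolutely_integrable_on K"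
    by (rule has_ac_deriv_imp_integrable_compact[OF assms K])
  have fK: "f absolutely_integrable_on K"
    using continuous_on_imp_locally_integrable[OF cf] K Ks
    by (simp add: locally_integrable_def absolutely_integrable_on_iff_lebesgue_on)
  have prod: "(\<lambda>x. \<psi> x *\<^sub>R h x) absolutely_integrable_on K"
    if "continuous_on K \<psi>" "h absolutely_integrable_on K" for \<psi> :: "real \<Rightarrow> real" and h :: "real \<Rightarrow> 'a"
    using that K(1) Ks
    by (intro absolutely_integrable_bounded_measurable_product[OF bil]
        continuous_imp_measurable_on_sets_lebesgue compact_imp_bounded compact_continuous_image) auto
  note p1 = prod[OF T(2) fK] and p2 = prod[OF T(1) gK]
  have "integral K (\<lambda>x. \<phi> x *\<^sub>R g x) + integral K (\<lambda>x. deriv \<phi> x *\<^sub>R f x) =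
      integral K (\<lambda>x. \<phi> x *\<^sub>R g x + deriv \<phi> x *\<^sub>R f x)"
    using p1 p2 by (intro integral_add[symmetric]) (auto simp: absolutely_integrable_on_def)
  also have "\<dots> = integral K G"
    using K(2) by (intro integral_cong) (auto simp: G_def)
  also have "\<dots> = integral {- N..N} G"
  proof -
    have "integral {- N..N} (\<lambda>x. if x \<in> K then G x else 0) = integral K G"
      using KN(1) by (simp add: Henstock_Kurzweil_Integration.integral_restrict_Int Int_absorb2)
    moreover have "(\<lambda>x. if x \<in> K then G x else 0) = G"
      by (auto simp: G_def \<phi>0 d\<phi>0)
    ultimately show ?thesis by simp
  qed
  also have "\<dots> = F N - F (- N)"
    using has_ac_derivD(3)[OF FG KN(4)] by simp
  also have "\<dots> = 0"
    using KN by (simp add: F_def \<phi>0)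
  finally have "integral K (\<lambda>x. \<phi> x *\<^sub>R g x) + integral K (\<lambda>x. deriv \<phi> x *\<^sub>R f x) = 0" .
  moreover have "(\<integral>x. deriv \<phi> x *\<^sub>R f x \<partial>lebesgue_on U) = integral K (\<lambda>x. deriv \<phi> x *\<^sub>R f x)"
    by (rule lebesgue_on_integral_supported(2)[OF Ks K(2) Us p1]) (simp add: d\<phi>0)
  moreover have "(\<integral>x. \<phi> x *\<^sub>R g x \<partial>lebesgue_on U) = integral K (\<lambda>x. \<phi> x *\<^sub>R g x)"
    by (rule lebesgue_on_integral_supported(2)[OF Ks K(2) Us p2]) (simp add: \<phi>0)
  ultimately show "(\<integral>x. deriv \<phi> x *\<^sub>R f x \<partial>lebesgue_on U) = - (\<integral>x. \<phi> x *\<^sub>R g x \<partial>lebesgue_on U)"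
    by (simp add: eq_neg_iff_add_eq_0 add.commute)
qed

text \<open>The du Bois-Reymond argument: the difference of two bumps around \<open>x\<close> and \<open>y\<close> is the
  derivative of a test function.\<close>

lemma has_weak_deriv_imp_has_ac_deriv:
  fixes f g :: "real \<Rightarrow> 'a::euclidean_space"
  assumes "open U" and cf: "continuous_on U f" and wk: "has_weak_deriv U f g"
  shows "has_ac_deriv U f g"
  unfolding has_ac_deriv_def
proof (intro allI impI)
  fix x y :: real
  assume xy: "x \<le> y" "{x..y} \<subseteq> U"
  \<comment> \<open>This is the room needed for bumps centred at the endpoints \<open>x\<close> and
    \<open>y\<close> to stay inside \<open>U\<close>.\<close>
  obtain r0 where r0: "r0 > 0" "{x - r0..y + r0} \<subseteq> U"
  proof -
    have xyU: "x \<in> U" "y \<in> U" using xy by auto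
    obtain e1 where e1: "e1 > 0" "cball x e1 \<subseteq> U"
      using xyU(1) \<open>open U\<close> open_contains_cball by blast
    obtain e2 where e2: "e2 > 0" "cball y e2 \<subseteq> U"
      using xyU(2) \<open>open U\<close> open_contains_cball by blast
    have "{x - min e1 e2..y + min e1 e2} \<subseteq> cball x e1 \<union> {x..y} \<union> cball y e2"
      by (auto simp: cball_eq_atLeastAtMost)
    then show ?thesis using that[of "min e1 e2"] e1 e2 xy by auto
  qed
  define a b where "a = x - r0" and "b = y + r0"
  have ab: "a < x" "y < b" "{a..b} \<subseteq> U" using r0 by (auto simp: a_def b_def)
  have gab: "g absolutely_integrable_on {a..b}"
    using wk ab(3) by (simp add: has_weak_deriv_def locally_integrable_def absolutely_integrable_on_iff_lebesgue_on)
  have gi: "g integrable_on {a..b}" using gab by (simp add: absolutely_integrable_on_def)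
  define G where "G z = integral {a..z} g" for z
  \<comment> \<open>The aim is \<open>F x = F y\<close>. Since \<open>G\<close> is an indefinite
    integral only between \<open>a\<close> and \<open>b\<close>, its weak derivative is taken on
    \<open>J\<close>, and the test function is supported in both \<open>U\<close> and
    \<open>J\<close>.\<close>
  define F where "F z = f z - G z" for z
  define J where "J = {a<..<b}"
  have "has_ac_deriv J G g"
    unfolding has_ac_deriv_def
  proof (intro allI impI conjI)
    fix u v assume uv: "u \<le> v" "{u..v} \<subseteq> J"
    then have uv': "{u..v} \<subseteq> {a..b}" "a \<le> u" "v \<le> b" by (auto simp: J_def)
    show "g absolutely_integrable_on {u..v}"
      using absolutely_integrable_on_subinterval[OF gab uv'(1)] .
    show "G v - G u = integral {u..v} g"
      using Henstock_Kurzweil_Integration.integral_combine[of a u v g] uv uv'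
        integrable_on_subinterval[OF gi, of a v] by (simp add: G_def algebra_simps)
  qed
  then have wkG: "has_weak_deriv J G g"
    by (rule has_ac_deriv_imp_has_weak_deriv) (simp add: J_def)
  have cG: "continuous_on {a..b} G"
    unfolding G_def by (rule indefinite_integral_continuous_1[OF gi])
  have cfab: "continuous_on {a..b} f" using cf ab(3) by (rule continuous_on_subset)
  have cF: "continuous_on {a..b} F"
    unfolding F_def by (intro continuous_intros cfab cG)
  have "norm (F y - F x) \<le> 0"
  proof (rule field_le_epsilon)
    fix e :: real assume "e > 0"
    have xyab: "x \<in> {a..b}" "y \<in> {a..b}" using xy(1) ab by auto
    have "e / 2 > 0" using \<open>e > 0\<close> by simp
    obtain d1 where d1: "d1 > 0" "\<And>w. w \<in> {a..b} \<Longrightarrow> dist w x < d1 \<Longrightarrow> dist (F w) (F x) < e / 2"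
      using cF \<open>e / 2 > 0\<close> xyab unfolding continuous_on_iff by blast
    obtain d2 where d2: "d2 > 0" "\<And>w. w \<in> {a..b} \<Longrightarrow> dist w y < d2 \<Longrightarrow> dist (F w) (F y) < e / 2"
      using cF \<open>e / 2 > 0\<close> xyab unfolding continuous_on_iff by blast
    define r where "r = min (r0 / 2) (min d1 d2)"
    have r: "r > 0" "r < r0" "r \<le> d1" "r \<le> d2" using r0 d1 d2 by (auto simp: r_def)
    obtain S C where S: "C > 0"
      "\<And>x. (S has_real_derivative (flat 0 (x + r) * flat 0 (r - x))) (at x)"
      "\<And>x. x \<le> - r \<Longrightarrow> S x = 0" "\<And>x. x \<ge> r \<Longrightarrow> S x = C"
      by (rule smooth_step_exists[OF r(1)], rule that)
    define \<beta> where "\<beta> p w = flat 0 (w - p + r) * flat 0 (r - (w - p))" for p w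
    \<comment> \<open>Once both bumps are passed the two steps cancel, so the support is compact;
      the derivative is the bump at \<open>x\<close> minus the bump at \<open>y\<close>.\<close>
    define \<phi> where "\<phi> w = S (w - x) - S (w - y)" for w
    have dS: "((\<lambda>w. S (w - p)) has_real_derivative \<beta> p w) (at w)" for p w
    proof -
      have "((\<lambda>w. w - p) has_real_derivative 1) (at w)" by (auto intro!: derivative_eq_intros)
      from DERIV_chain2[OF S(2) this] show ?thesis by (simp add: \<beta>_def)
    qed
    have d\<phi>: "(\<phi> has_real_derivative (\<beta> x w - \<beta> y w)) (at w)" for w
      unfolding \<phi>_def[abs_def] by (intro DERIV_diff dS)
    have deriv\<phi>: "deriv \<phi> w = \<beta> x w - \<beta> y w" for w
      using d\<phi> by (rule DERIV_imp_deriv)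
    have bump: "(\<lambda>w. \<beta> x w - \<beta> y w) \<in> bumps"
    proof -
      have "(\<lambda>w. 1 * (flat 0 (w - (x - r)) * flat 0 ((x + r) - w)) +
          (- 1) * (flat 0 (w - (y - r)) * flat 0 ((y + r) - w))) \<in> bumps"
        by (intro bumps.intros)
      then show ?thesis by (simp add: \<beta>_def algebra_simps)
    qed
    define K where "K = {x - r..y + r}"
    have K: "K \<subseteq> J" "K \<subseteq> U" "K \<subseteq> {a..b}" "compact K" "K \<in> sets lebesgue"
      using r ab(3) by (auto simp: K_def J_def a_def b_def)
    have \<phi>0: "\<phi> w = 0" if "w \<notin> K" for w
      using that S(3)[of "w - x"] S(3)[of "w - y"] S(4)[of "w - x"] S(4)[of "w - y"] xy(1)
      by (auto simp: K_def \<phi>_def)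
    have \<beta>0: "\<beta> p w = 0" if "\<not> \<bar>w - p\<bar> < r" for p w
      using that by (auto simp: \<beta>_def flat_def)
    have \<beta>_pos: "0 \<le> \<beta> p w" for p w by (simp add: \<beta>_def flat_def)
    have tU: "test_function U \<phi>" and tJ: "test_function J \<phi>"
      using test_function_bumps_antiderivative[OF d\<phi> bump K(4) _ \<phi>0] K by auto
    have c\<beta>: "continuous_on A (\<beta> p)" for A p
    proof -
      have cflat: "continuous_on UNIV (flat 0)"
        using flat_has_derivative by (meson DERIV_isCont continuous_at_imp_continuous_on)
      show ?thesis unfolding \<beta>_def
        by (intro continuous_intros continuous_on_compose2[OF cflat]) auto
    qed
    have int: "(\<lambda>w. \<psi> w *\<^sub>R h w) absolutely_integrable_on K"
      if "continuous_on K \<psi>" "continuous_on K h" for \<psi> :: "real \<Rightarrow> real" and h :: "real \<Rightarrow> 'a"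
      using that unfolding K_def by (intro absolutely_integrable_continuous_real continuous_intros)
    have cK: "continuous_on K F" "continuous_on K f" "continuous_on K G" "continuous_on K (deriv \<phi>)"
      using cF cfab cG K(3) test_function_has_ac_deriv(2)[OF tU] by (auto intro: continuous_on_subset)
    have Us: "U \<in> sets lebesgue" and Js: "J \<in> sets lebesgue"
      using \<open>open U\<close> by (auto simp: J_def)
    have outside: "deriv \<phi> w = 0" if "w \<notin> K" for w
      using that xy(1) r(1) \<beta>0[where p = x and w = w] \<beta>0[where p = y and w = w]
      by (auto simp: deriv\<phi> K_def)
    have "integral K (\<lambda>w. deriv \<phi> w *\<^sub>R f w) = (\<integral>w. deriv \<phi> w *\<^sub>R f w \<partial>lebesgue_on U)"
      by (rule lebesgue_on_integral_supported(2)[OF K(5) K(2) Us int[OF cK(4) cK(2)], symmetric])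
        (simp add: outside)
    also have "\<dots> = - (\<integral>w. \<phi> w *\<^sub>R g w \<partial>lebesgue_on U)"
      using wk tU by (simp add: has_weak_deriv_def)
    also have "(\<integral>w. \<phi> w *\<^sub>R g w \<partial>lebesgue_on U) = (\<integral>w. \<phi> w *\<^sub>R g w \<partial>lebesgue_on J)"
    proof -
      have bil: "bilinear (\<lambda>c v. c *\<^sub>R (v::'a))"
        by (simp add: bilinear_conv_bounded_bilinear bounded_bilinear_scaleR)
      have "g absolutely_integrable_on K"
        using gab K by (auto intro: set_integrable_subset)
      then have pg: "(\<lambda>w. \<phi> w *\<^sub>R g w) absolutely_integrable_on K"
        using test_function_has_ac_deriv(1)[OF tU] unfolding K_def
        by (intro absolutely_integrable_continuous_bilinear[OF bil])
      show ?thesis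
        using lebesgue_on_integral_supported(2)[OF K(5) K(2) Us pg]
          lebesgue_on_integral_supported(2)[OF K(5) K(1) Js pg] \<phi>0
        by simp
    qed
    also have "- \<dots> = (\<integral>w. deriv \<phi> w *\<^sub>R G w \<partial>lebesgue_on J)"
      using wkG tJ by (simp add: has_weak_deriv_def)
    also have "\<dots> = integral K (\<lambda>w. deriv \<phi> w *\<^sub>R G w)"
      by (rule lebesgue_on_integral_supported(2)[OF K(5) K(1) Js int[OF cK(4) cK(3)]])
        (simp add: outside)
    finally have eq: "integral K (\<lambda>w. deriv \<phi> w *\<^sub>R f w) = integral K (\<lambda>w. deriv \<phi> w *\<^sub>R G w)" .
    have I: "(\<lambda>w. \<psi> w *\<^sub>R h w) integrable_on K"
      if "continuous_on K \<psi>" "continuous_on K h" for \<psi> :: "real \<Rightarrow> real" and h :: "real \<Rightarrow> 'a"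
      using int[OF that] by (simp add: absolutely_integrable_on_def)
    have zero: "integral K (\<lambda>w. (\<beta> x w - \<beta> y w) *\<^sub>R F w) = 0"
    proof -
      have "integral K (\<lambda>w. deriv \<phi> w *\<^sub>R F w) =
          integral K (\<lambda>w. deriv \<phi> w *\<^sub>R f w) - integral K (\<lambda>w. deriv \<phi> w *\<^sub>R G w)"
        unfolding F_def scaleR_diff_right
        by (rule integral_diff[OF I[OF cK(4) cK(2)] I[OF cK(4) cK(3)]])
      then have "integral K (\<lambda>w. deriv \<phi> w *\<^sub>R F w) = 0" using eq by simp
      then show ?thesis by (simp only: deriv\<phi>)
    qed
    have mass: "(\<beta> p has_integral C) K" if "p = x \<or> p = y" for p
    proof -
      have "(\<beta> p has_integral (S (y + r - p) - S (x - r - p))) K"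
        unfolding K_def using xy(1) r(1)
        by (intro fundamental_theorem_of_calculus[where f = "\<lambda>w. S (w - p)"])
          (auto simp: has_real_derivative_iff_has_vector_derivative[symmetric]
            intro: has_field_derivative_at_within[OF dS])
      then show ?thesis using that xy(1) S(3,4) by auto
    qed
    have \<beta>F: "(\<lambda>w. \<beta> p w *\<^sub>R F w) integrable_on K" for p
      by (rule I[OF c\<beta> cK(1)])
    have near: "norm (integral K (\<lambda>w. \<beta> p w *\<^sub>R (F p - F w))) \<le> e / 2 * C"
      if p: "p = x \<or> p = y" for p
    proof -
      have "norm (integral K (\<lambda>w. \<beta> p w *\<^sub>R (F p - F w))) \<le> integral K (\<lambda>w. e / 2 * \<beta> p w)"
      proof (rule integral_norm_bound_integral)
        show "(\<lambda>w. \<beta> p w *\<^sub>R (F p - F w)) integrable_on K"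
          by (rule I[OF c\<beta> continuous_on_diff[OF continuous_on_const cK(1)]])
        show "(\<lambda>w. e / 2 * \<beta> p w) integrable_on K"
          using mass[OF p] by (intro integrable_on_mult_right) (rule has_integral_integrable)
        fix w assume w: "w \<in> K"
        show "norm (\<beta> p w *\<^sub>R (F p - F w)) \<le> e / 2 * \<beta> p w"
        proof (cases "\<bar>w - p\<bar> < r")
          case True
          then have "norm (F p - F w) \<le> e / 2"
            using p w K(3) d1(2)[of w] d2(2)[of w] r
            by (auto simp: dist_real_def dist_norm norm_minus_commute less_imp_le)
          then have "\<beta> p w * norm (F p - F w) \<le> \<beta> p w * (e / 2)"
            by (rule mult_left_mono) (rule \<beta>_pos)
          then show ?thesis
            using \<beta>_pos[of p w] by (simp only: norm_scaleR abs_of_nonneg mult.commute)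
        qed (simp add: \<beta>0)
      qed
      also have "\<dots> = e / 2 * C"
        using mass[OF p] by (simp add: integral_unique)
      finally show ?thesis .
    qed
    have shift: "integral K (\<lambda>w. \<beta> p w *\<^sub>R (F p - F w)) = C *\<^sub>R F p - integral K (\<lambda>w. \<beta> p w *\<^sub>R F w)"
      if p: "p = x \<or> p = y" for p
    proof -
      have "((\<lambda>w. \<beta> p w *\<^sub>R F p) has_integral C *\<^sub>R F p) K"
        using mass[OF p] by (rule has_integral_scaleR_left)
      then have "((\<lambda>w. \<beta> p w *\<^sub>R F p - \<beta> p w *\<^sub>R F w) has_integral C *\<^sub>R F p - integral K (\<lambda>w. \<beta> p w *\<^sub>R F w)) K"
        by (intro has_integral_diff integrable_integral[OF \<beta>F])
      then show ?thesis by (simp add: integral_unique scaleR_diff_right)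
    qed
    have "integral K (\<lambda>w. \<beta> x w *\<^sub>R F w) - integral K (\<lambda>w. \<beta> y w *\<^sub>R F w) = 0"
      using zero by (simp add: scaleR_diff_left integral_diff \<beta>F)
    \<comment> \<open>Both bumps have mass \<open>C\<close> and give \<open>F\<close> the same
      weighted integral, so \<open>F x\<close> and \<open>F y\<close> differ only by the two
      localisation errors.\<close>
    then have "C *\<^sub>R (F y - F x) =
        integral K (\<lambda>w. \<beta> y w *\<^sub>R (F y - F w)) - integral K (\<lambda>w. \<beta> x w *\<^sub>R (F x - F w))"
      by (simp only: shift[OF disjI1[OF refl]] shift[OF disjI2[OF refl]] scaleR_diff_right[of C])
        (simp add: algebra_simps)
    moreover have "C * norm (F y - F x) = norm (C *\<^sub>R (F y - F x))"
      using S(1) by simp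
    ultimately have "C * norm (F y - F x) = norm
        (integral K (\<lambda>w. \<beta> y w *\<^sub>R (F y - F w)) - integral K (\<lambda>w. \<beta> x w *\<^sub>R (F x - F w)))"
      by (simp only:)
    also have "\<dots> \<le> e / 2 * C + e / 2 * C"
      by (rule norm_triangle_le_diff[OF add_mono[OF near near]]) simp_all
    finally have "C * norm (F y - F x) \<le> C * e" by (simp add: mult.commute)
    then show "norm (F y - F x) \<le> 0 + e"
      using S(1) by (simp add: mult_le_cancel_left_pos)
  qed
  then have "f y - f x = G y - G x" by (simp add: F_def algebra_simps)
  also have "\<dots> = integral {x..y} g"
    using Henstock_Kurzweil_Integration.integral_combine[of a x y g] xy ab
      integrable_on_subinterval[OF gi, of a y] by (simp add: G_def algebra_simps)
  finally show "g absolutely_integrable_on {x..y} \<and> f y - f x = integral {x..y} g"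
    using absolutely_integrable_on_subinterval[OF gab, of x y] ab by auto
qed

section \<open>Matrices with two equal eigenvalues\<close>

lemma matrix_expand_3:
  fixes A B :: "real^3^3"
  shows "A = B \<longleftrightarrow> A$1$1 = B$1$1 \<and> A$1$2 = B$1$2 \<and> A$1$3 = B$1$3 \<and> A$2$1 = B$2$1 \<and>
    A$2$2 = B$2$2 \<and> A$2$3 = B$2$3 \<and> A$3$1 = B$3$1 \<and> A$3$2 = B$3$2 \<and> A$3$3 = B$3$3"
  by (auto simp: vec_eq_iff forall_3)

lemma trace_3: "trace (A :: real^3^3) = A$1$1 + A$2$2 + A$3$3"
  by (simp add: trace_def sum_3)

lemma inner_3: "(u :: real^3) \<bullet> v = u$1 * v$1 + u$2 * v$2 + u$3 * v$3"
  by (simp add: inner_vec_def sum_3)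

lemma inner_matrix_3: "(A :: real^3^3) \<bullet> B =
    A$1$1 * B$1$1 + A$1$2 * B$1$2 + A$1$3 * B$1$3 + A$2$1 * B$2$1 + A$2$2 * B$2$2 + A$2$3 * B$2$3 +
    A$3$1 * B$3$1 + A$3$2 * B$3$2 + A$3$3 * B$3$3"
  by (simp add: inner_vec_def sum_3)

lemma matrix_mult_3: "((A :: real^3^3) ** B)$i$j = A$i$1 * B$1$j + A$i$2 * B$2$j + A$i$3 * B$3$j"
  by (simp add: matrix_matrix_mult_def sum_3)

lemma mat_3: "(mat x :: real^3^3)$1$1 = x" "(mat x :: real^3^3)$1$2 = 0" "(mat x :: real^3^3)$1$3 = 0"
  "(mat x :: real^3^3)$2$1 = 0" "(mat x :: real^3^3)$2$2 = x" "(mat x :: real^3^3)$2$3 = 0"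
  "(mat x :: real^3^3)$3$1 = 0" "(mat x :: real^3^3)$3$2 = 0" "(mat x :: real^3^3)$3$3 = x"
  by (simp_all add: mat_def)

lemma tensor_nth: "tensor u v $ i $ j = u$i * v$j"
  by (simp add: tensor_def)

lemma symmetric_nth:
  assumes "transpose A = A"
  shows "A$i$j = A$j$i"
proof -
  have "A$i$j = transpose A $ j $ i" by (simp add: transpose_def)
  then show ?thesis by (simp only: assms)
qed

lemma prod_UNIV_3: "(\<Prod>i\<in>UNIV. f i) = f 1 * f 2 * (f (3::3) :: real)"
  unfolding UNIV_3 by (simp add: mult.assoc)

lemmas entries_3 = trace_3 inner_3 inner_matrix_3 matrix_mult_3 mat_3 tensor_nth

definition Q_matrix :: "real \<Rightarrow> real^3 \<Rightarrow> real^3^3" where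
  "Q_matrix s n = s *\<^sub>R (tensor n n - (1/3) *\<^sub>R mat 1)"

lemma Q_of_eq: "Q_of s n x = Q_matrix (s x) (n x)"
  by (simp add: Q_of_def Q_matrix_def)

lemma Q_matrix_sym: "transpose (Q_matrix s n) = Q_matrix s n"
  by (simp add: Q_matrix_def vec_eq_iff transpose_def tensor_def mat_def mult.commute)

lemma unit_3: "norm (n :: real^3) = 1 \<longleftrightarrow> n$1 * n$1 + n$2 * n$2 + n$3 * n$3 = 1"
  by (simp add: norm_eq_1 inner_3)

lemma Q_matrix_trace:
  assumes "norm n = 1"
  shows "trace (Q_matrix s n) = 0"
proof -
  have "trace (Q_matrix s n) = s * (n$1 * n$1 + n$2 * n$2 + n$3 * n$3 - 1)"
    by (simp add: Q_matrix_def entries_3 algebra_simps)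
  then show ?thesis using assms by (simp add: unit_3)
qed

lemma Q_matrix_uniaxial:
  assumes "norm n = 1"
  shows "uniaxial (Q_matrix s n)"
  unfolding uniaxial_def
proof (intro exI conjI allI)
  \<comment> \<open>The eigenvalue is \<open>2 * s / 3\<close> along \<open>n\<close>, and
    \<open>- s / 3\<close> twice on the orthogonal plane.\<close>
  define \<mu> :: "3 \<Rightarrow> real" where "\<mu> i = (if i = 3 then 2 * s / 3 else - s / 3)" for i
  show "(1::3) \<noteq> 2" "\<mu> 1 = \<mu> 2" by (simp_all add: \<mu>_def)
  fix x
  \<comment> \<open>With this shift the matrix is y I - s n \<otimes> n, a rank one perturbation of
    a multiple of the identity.\<close>
  define y where "y = x + s / 3"
  have "det (mat x - Q_matrix s n) = y^3 - y^2 * s * (n$1 * n$1 + n$2 * n$2 + n$3 * n$3)"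
    by (simp add: det_3 Q_matrix_def entries_3 y_def power2_eq_square power3_eq_cube field_simps)
  also have "\<dots> = y^2 * (y - s)"
    using assms by (simp add: unit_3 power2_eq_square power3_eq_cube algebra_simps)
  also have "\<dots> = (\<Prod>i\<in>UNIV. x - \<mu> i)"
    unfolding prod_UNIV_3 by (simp add: \<mu>_def y_def power2_eq_square)
  finally show "det (mat x - Q_matrix s n) = (\<Prod>i\<in>UNIV. x - \<mu> i)" .
qed

lemma Q_matrix_invariants:
  assumes "norm n = 1"
  shows "trace (Q_matrix s n ** Q_matrix s n) = 2/3 * s^2"
    and "trace (Q_matrix s n ** Q_matrix s n ** Q_matrix s n) = 2/9 * s^3"
    and "(norm (Q_matrix s n))\<^sup>2 = 2/3 * s^2"
proof -
  \<comment> \<open>The traces are computed as polynomials in \<open>?N\<close> for an arbitrary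
    vector \<open>n\<close>; the constraint \<open>?N = 1\<close> is inserted only afterwards, so
    the expansion is a plain polynomial identity.\<close>
  let ?N = "n$1 * n$1 + n$2 * n$2 + n$3 * n$3"
  have N: "?N = 1" using assms by (simp add: unit_3)
  have "trace (Q_matrix s n ** Q_matrix s n) = s^2 * (?N^2 - 2/3 * ?N + 1/3)"
    by (simp add: Q_matrix_def entries_3 power2_eq_square field_simps)
  then show t: "trace (Q_matrix s n ** Q_matrix s n) = 2/3 * s^2"
    by (simp add: N)
  have "trace (Q_matrix s n ** Q_matrix s n ** Q_matrix s n) = s^3 * (?N^3 - ?N^2 + 1/3 * ?N - 1/9)"
    by (simp add: Q_matrix_def entries_3 power2_eq_square power3_eq_cube field_simps)
  then show "trace (Q_matrix s n ** Q_matrix s n ** Q_matrix s n) = 2/9 * s^3"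
    by (simp add: N)
  have "(norm (Q_matrix s n))\<^sup>2 = trace (Q_matrix s n ** transpose (Q_matrix s n))"
    by (simp only: power2_norm_eq_inner entries_3) (simp add: transpose_def)
  then show "(norm (Q_matrix s n))\<^sup>2 = 2/3 * s^2"
    by (simp add: Q_matrix_sym t)
qed

text \<open>The factors 3/2, 9/2 and 9/4 in \<open>psi_B\<close> are the reciprocals of 2/3, 2/9 and
  (2/3)^2, the values of Tr Q^2, Tr Q^3 and (Tr Q^2)^2 at \<open>s = 1\<close>.\<close>

lemma psi_B_Q_matrix:
  assumes "norm n = 1"
  shows "psi_B a b c (Q_matrix s n) = sigma a b c s"
  by (simp add: psi_B_def sigma_def Q_matrix_invariants[OF assms] Let_def power2_eq_square
      power3_eq_cube power4_eq_xxxx field_simps)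

text \<open>With p = Tr Q^2 and q = Tr Q^3 the characteristic polynomial is x^3 - p/2 x - q/3, whose
  discriminant is p^3/2 - 3 q^2. In this form uniaxiality is an equation between continuous
  functions of \<open>Q\<close>, which passes from almost every point to every point.\<close>

lemma uniaxial_discriminant:
  assumes sym: "transpose Q = Q" and tr: "trace Q = 0" and un: "uniaxial Q"
  shows "(trace (Q ** Q))^3 = 6 * (trace (Q ** Q ** Q))^2"
proof -
  obtain \<mu> :: "3 \<Rightarrow> real" where \<mu>: "\<And>x. det (mat x - Q) = (\<Prod>i\<in>UNIV. x - \<mu> i)"
    "\<exists>i j. i \<noteq> j \<and> \<mu> i = \<mu> j"
    using un unfolding uniaxial_def by blast
  let ?p = "trace (Q ** Q)" and ?q = "trace (Q ** Q ** Q)"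
  have s: "Q$2$1 = Q$1$2" "Q$3$1 = Q$1$3" "Q$3$2 = Q$2$3"
    using symmetric_nth[OF sym] by blast+
  have t: "Q$3$3 = - Q$1$1 - Q$2$2" using tr by (simp add: trace_3)
  have char: "6 * det (mat x - Q) = 6 * x^3 - 3 * ?p * x - 2 * ?q" for x
    unfolding det_3 trace_3 matrix_mult_3 by (simp only: vector_minus_component mat_3 s t) algebra
  have *: "6 * ((x - \<mu> 1) * (x - \<mu> 2) * (x - \<mu> 3)) = 6 * x^3 - 3 * ?p * x - 2 * ?q" for x
    using char[of x] \<mu>(1)[of x] by (simp add: prod_UNIV_3)
  \<comment> \<open>The values at 0, 1 and -1 determine the elementary symmetric functions of the
    eigenvalues.\<close>
  have e1: "\<mu> 1 + \<mu> 2 + \<mu> 3 = 0"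
    using *[of 0] *[of 1] *[of "-1"] by (simp add: algebra_simps)
  then have m3: "\<mu> 3 = - \<mu> 1 - \<mu> 2" by simp
  have q: "?q = 3 * (\<mu> 1 * \<mu> 2 * \<mu> 3)"
    using *[of 0] by simp
  have p: "?p = - 2 * (\<mu> 1 * \<mu> 2 + \<mu> 1 * \<mu> 3 + \<mu> 2 * \<mu> 3)"
    using *[of 0] *[of 1] *[of "-1"] by (simp add: algebra_simps)
  have "\<mu> 1 = \<mu> 2 \<or> \<mu> 1 = \<mu> 3 \<or> \<mu> 2 = \<mu> 3"
    using \<mu>(2) exhaust_3 by metis
  \<comment> \<open>With sum zero, each coincidence makes the spectrum \<open>l, l, - 2 * l\<close>,
    for which p = 6 l^2 and q = - 6 l^3.\<close>
  then have "\<mu> 1 = \<mu> 2 \<or> \<mu> 2 = - 2 * \<mu> 1 \<or> \<mu> 1 = - 2 * \<mu> 2"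
    using m3 by auto
  then show ?thesis
    unfolding p q m3 by (elim disjE) (simp_all add: power2_eq_square power3_eq_cube algebra_simps)
qed

text \<open>As the trace is nonzero, some diagonal entry \<open>P$j$j\<close> is, and it equals the
  squared norm of the \<open>j\<close>-th column of \<open>P\<close>. The normalised column is a
  fixed vector \<open>n\<close> of \<open>P\<close>, and the squared Frobenius distance from
  \<open>P\<close> to \<open>tensor n n\<close> is 1 - 2 + 1 = 0.\<close>

lemma projection_eq_tensor:
  fixes P :: "real^3^3"
  assumes sym: "transpose P = P" and idem: "P ** P = P" and tr: "trace P = 1"
  obtains n where "norm n = 1" "P = tensor n n"
proof -
  have "\<exists>j. P$j$j \<noteq> 0"
    using tr unfolding trace_3 by (metis add_0 zero_neq_one)
  then obtain j where j: "P$j$j \<noteq> 0" by blast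
  define e :: "real^3" where "e = axis j 1"
  define v where "v = P *v e"
  have adj: "x \<bullet> (P *v y) = (P *v x) \<bullet> y" for x y
    using dot_lmul_matrix[of x P y] sym transpose_matrix_vector[of P x] by simp
  have Pv: "P *v v = v"
    by (simp add: v_def matrix_vector_mul_assoc idem)
  have "e \<bullet> (P *v e) = P$j$j"
    by (simp add: e_def inner_axis' matrix_vector_mult_basis column_def)
  then have vv: "v \<bullet> v = P$j$j"
    using adj[of e v] Pv by (simp add: v_def)
  have pos: "v \<bullet> v > 0" using vv j by (metis inner_gt_zero_iff inner_zero_left)
  define n where "n = (1 / norm v) *\<^sub>R v"
  have n1: "norm n = 1" using pos by (auto simp: n_def)
  have Pn: "P *v n = n" by (simp add: n_def matrix_vector_mult_scaleR Pv)
  have "(P - tensor n n) \<bullet> (P - tensor n n) = P \<bullet> P - 2 * (P \<bullet> tensor n n) + tensor n n \<bullet> tensor n n"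
    by (simp add: inner_diff_left inner_diff_right inner_commute)
  also have "P \<bullet> P = trace (P ** transpose P)"
    by (simp only: entries_3) (simp add: transpose_def)
  also have "\<dots> = 1" by (simp add: sym idem tr)
  also have "P \<bullet> tensor n n = n \<bullet> (P *v n)"
    by (simp add: entries_3 matrix_vector_mult_def sum_3 algebra_simps)
  also have "\<dots> = 1" using n1 by (simp add: Pn norm_eq_1)
  also have "tensor n n \<bullet> tensor n n = (n \<bullet> n)^2"
    by (simp add: entries_3 power2_eq_square algebra_simps)
  also have "\<dots> = 1" using n1 by (simp add: norm_eq_1)
  finally have "P = tensor n n" by simp
  with n1 show thesis by (rule that)
qed

text \<open>The affine map from \<open>Q\<close> to
  \<open>(1 / s) *\<^sub>R Q + (1/3) *\<^sub>R mat 1\<close> sends the expected eigenvalues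
  \<open>2 * s / 3\<close>, \<open>- s / 3\<close>, \<open>- s / 3\<close> to 1, 0, 0. That the
  image is a projection is checked by polynomial identities, without diagonalising
  \<open>Q\<close>.\<close>

lemma uniaxial_representation:
  assumes sym: "transpose Q = Q" and tr: "trace Q = 0"
    and disc: "(trace (Q ** Q))^3 = 6 * (trace (Q ** Q ** Q))^2"
    and s: "s = 3 * trace (Q ** Q ** Q) / trace (Q ** Q)"
  shows "s^2 = 3/2 * (norm Q)\<^sup>2"
    and "s \<noteq> 0 \<Longrightarrow> \<exists>n. norm n = 1 \<and> (1 / s) *\<^sub>R Q + (1/3) *\<^sub>R mat 1 = tensor n n"
proof -
  let ?p = "trace (Q ** Q)" and ?q = "trace (Q ** Q ** Q)"
  have e: "Q$2$1 = Q$1$2" "Q$3$1 = Q$1$3" "Q$3$2 = Q$2$3"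
    using symmetric_nth[OF sym] by blast+
  have t: "Q$3$3 = - Q$1$1 - Q$2$2" using tr by (simp add: trace_3)
  have pn: "(norm Q)\<^sup>2 = ?p"
    by (simp add: power2_norm_eq_inner entries_3 e)
  have sp: "s^2 = 3/2 * ?p"
  \<comment> \<open>For \<open>?p = 0\<close> the quotient is 0 by the convention on division, which
    is the desired value.\<close>
  proof (cases "?p = 0")
    case False
    have "s^2 = 9 * ?q^2 / ?p^2" by (simp add: s power_divide power_mult_distrib)
    also have "\<dots> = 3/2 * (?p^3 / ?p^2)" by (simp add: disc)
    also have "?p^3 / ?p^2 = ?p" using False by (simp add: power2_eq_square power3_eq_cube)
    finally show ?thesis .
  qed (simp add: s)
  then show "s^2 = 3/2 * (norm Q)\<^sup>2" by (simp add: pn)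
  assume s0: "s \<noteq> 0"
  then have p0: "?p \<noteq> 0" using sp by auto
  have p: "?p = 2/3 * s^2" using sp by simp
  have q: "?q = 2/9 * s^3"
    using s p0 p by (simp add: field_simps power2_eq_square power3_eq_cube)
  \<comment> \<open>\<open>M\<close> is the expected minimal polynomial (Q - 2s/3 I)(Q + s/3 I). It
    vanishes because its squared norm is a polynomial in \<open>?p\<close>, \<open>?q\<close> and
    \<open>s\<close> that cancels.\<close>
  define M where "M = Q ** Q - (s/3) *\<^sub>R Q - (2/9 * s^2) *\<^sub>R mat 1"
  have "54 * (M \<bullet> M) = 27 * ?p^2 - 36 * s * ?q - 18 * s^2 * ?p + 8 * s^4"
    unfolding M_def by (simp add: entries_3 e t) algebra
  also have "\<dots> = 0"
    by (simp add: p q power2_eq_square power3_eq_cube power4_eq_xxxx)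
  finally have "M = 0" by simp
  then have QQ: "Q ** Q = (s/3) *\<^sub>R Q + (2/9 * s^2) *\<^sub>R mat 1"
    by (simp add: M_def algebra_simps)
  define P where "P = (1 / s) *\<^sub>R Q + (1/3) *\<^sub>R (mat 1 :: real^3^3)"
  have "P ** P = (1 / s^2) *\<^sub>R (Q ** Q) + (2 / (3 * s)) *\<^sub>R Q + (1/9) *\<^sub>R mat 1"
    unfolding P_def matrix_expand_3 using s0
    by (simp add: entries_3 field_simps power2_eq_square)
  also have "\<dots> = P"
    unfolding P_def QQ matrix_expand_3 using s0
    by (simp add: entries_3 field_simps power2_eq_square)
  finally have "P ** P = P" .
  moreover have "transpose P = P"
    unfolding P_def matrix_expand_3 by (simp add: transpose_def mat_3 e)
  moreover have "trace P = 1"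
    unfolding P_def by (simp add: entries_3 t algebra_simps)
  ultimately show "\<exists>n. norm n = 1 \<and> (1 / s) *\<^sub>R Q + (1/3) *\<^sub>R mat 1 = tensor n n"
    using projection_eq_tensor[of P] unfolding P_def by metis
qed

section \<open>The derivative of a uniaxial field and the energy densities\<close>

definition Q_matrix_deriv :: "real \<Rightarrow> real^3 \<Rightarrow> real \<Rightarrow> real^3 \<Rightarrow> real^3^3" where
  "Q_matrix_deriv s n s' n' =
     s' *\<^sub>R (tensor n n - (1/3) *\<^sub>R mat 1) + s *\<^sub>R (tensor n' n + tensor n n')"

text \<open>The scalar part contributes \<open>2/3 * s'\<^sup>2\<close>, the symmetrised product of
  \<open>n\<close> and \<open>n'\<close> contributes twice the squared norm of \<open>n'\<close>
  times \<open>s\<^sup>2\<close>, and each remaining term carries a factor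
  \<open>n \<bullet> n'\<close>.\<close>

lemma norm_Q_matrix_deriv:
  assumes "norm n = 1" "n \<bullet> n' = 0"
  shows "(norm (Q_matrix_deriv s n s' n'))\<^sup>2 = 2 * s\<^sup>2 * (norm n')\<^sup>2 + 2/3 * s'\<^sup>2"
proof -
  let ?N = "n$1 * n$1 + n$2 * n$2 + n$3 * n$3" and ?D = "n$1 * n'$1 + n$2 * n'$2 + n$3 * n'$3"
  let ?M = "n'$1 * n'$1 + n'$2 * n'$2 + n'$3 * n'$3"
  have "3 * (norm (Q_matrix_deriv s n s' n'))\<^sup>2 =
      s'\<^sup>2 * (3 * ?N^2 - 2 * ?N + 1) + s * s' * (12 * ?N * ?D - 4 * ?D) + s\<^sup>2 * (6 * ?N * ?M + 6 * ?D^2)"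
    unfolding power2_norm_eq_inner Q_matrix_deriv_def inner_matrix_3
    by (simp add: entries_3) algebra
  also have "\<dots> = 3 * (2 * s\<^sup>2 * ?M + 2/3 * s'\<^sup>2)"
  proof -
    have N: "?N = 1" and D: "?D = 0" using assms by (simp_all add: unit_3 inner_3)
    show ?thesis unfolding N D by simp
  qed
  also have "?M = (norm n')\<^sup>2" by (simp add: power2_norm_eq_inner inner_3)
  finally show ?thesis by simp
qed

lemma norm_grad: "norm (grad k v) = norm v"
proof -
  have "(norm (grad k v))\<^sup>2 = (norm v)\<^sup>2"
    using exhaust_3[of k] by (auto simp: power2_norm_eq_inner inner_vec_def grad_def sum_3)
  then show ?thesis by simp
qed

text \<open>Only the antisymmetric part of \<open>Q ** Q'\<close> enters, and this is the one of \<open>s\<^sup>2 (n \<otimes> n')\<close>.\<close>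

lemma inner_curl_mat_Q_matrix:
  assumes "norm n = 1"
  shows "Q_matrix s n \<bullet> curl_mat (grad k (Q_matrix_deriv s n s' n')) =
    s\<^sup>2 * (n \<bullet> curl_vec (grad k n'))"
proof -
  have "Q_matrix s n \<bullet> curl_mat (grad k (Q_matrix_deriv s n s' n')) =
      s\<^sup>2 * (n$1 * n$1 + n$2 * n$2 + n$3 * n$3) * (n \<bullet> curl_vec (grad k n'))"
    using exhaust_3[of k]
    by (elim disjE) (simp_all add: curl_mat_def curl_vec_def grad_def levi_civita_def sum_3
        Q_matrix_def Q_matrix_deriv_def entries_3 power2_eq_square algebra_simps)
  also have "\<dots> = s\<^sup>2 * (n \<bullet> curl_vec (grad k n'))"
    using assms by (simp add: unit_3)
  finally show ?thesis .
qed

text \<open>The terms match one by one. The curl terms agree because 4t = 2 * 2t, and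
  \<open>3 * t\<^sup>2\<close> times |Q|^2 = 2/3 s^2 gives 2 s^2 t^2.\<close>

lemma energy_density_eq:
  assumes "norm n = 1" "n \<bullet> n' = 0"
  shows "(let DQ = grad k (Q_matrix_deriv s n s' n')
      in (norm DQ)\<^sup>2 + 4 * t * (Q_matrix s n \<bullet> curl_mat DQ) + 3 * t\<^sup>2 * (norm (Q_matrix s n))\<^sup>2
         + psi_B a b c (Q_matrix s n)) =
    (let Dn = grad k n'; Ds = grad k s'
      in 2 * s\<^sup>2 * ((norm Dn)\<^sup>2 + 2 * t * (n \<bullet> curl_vec Dn) + t\<^sup>2)
         + 2/3 * (norm Ds)\<^sup>2 + sigma a b c s)"
  by (simp add: norm_grad norm_Q_matrix_deriv[OF assms] inner_curl_mat_Q_matrix[OF assms(1)]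
      Q_matrix_invariants(3)[OF assms(1)] psi_B_Q_matrix[OF assms(1)] algebra_simps)

lemma energy_density_0:
  "(let DQ = grad k 0
    in (norm DQ)\<^sup>2 + 4 * t * (0 \<bullet> curl_mat DQ) + 3 * t\<^sup>2 * (norm (0::real^3^3))\<^sup>2 + psi_B a b c 0) = 0"
  by (simp add: norm_grad psi_B_def trace_3 Let_def)

section \<open>Continuous choice of the director\<close>

lemma bilinear_tensor: "bilinear tensor"
  by (simp add: bilinear_def linear_iff vec_eq_iff tensor_def algebra_simps)

lemma bilinear_matrix_vector_mult: "bilinear (\<lambda>(A :: real^'n^'m) x. A *v x)"
  by (simp add: bilinear_def linear_iff matrix_vector_mult_def vec_eq_iff sum.distrib
      sum_distrib_left algebra_simps)

lemma tensor_mult_vector: "tensor u v *v w = (v \<bullet> w) *\<^sub>R u"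
  by (simp add: vec_eq_iff matrix_vector_mult_def tensor_def inner_vec_def sum_distrib_left
      sum_distrib_right algebra_simps)

lemma continuous_on_tensor:
  assumes "continuous_on S f" "continuous_on S g"
  shows "continuous_on S (\<lambda>x. tensor (f x) (g x))"
  by (rule bounded_bilinear.continuous_on[OF bilinear_imp_bounded_bilinear[OF bilinear_tensor] assms])

lemma continuous_on_matrix_vector_mult:
  fixes A :: "'a::topological_space \<Rightarrow> real^'n^'m"
  assumes "continuous_on S A" "continuous_on S f"
  shows "continuous_on S (\<lambda>x. A x *v f x)"
  by (rule bounded_bilinear.continuous_on[OF bilinear_imp_bounded_bilinear[OF bilinear_matrix_vector_mult] assms])

text \<open>Over the projections \<open>P\<close> with \<open>v \<bullet> (P *v v) > 0\<close> the two sheets are the open hemispheres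
  around \<open>v\<close> and \<open>- v\<close>, with the inverse \<open>P \<mapsto> \<plusminus> P *v v / norm (P *v v)\<close>.\<close>

lemma covering_space_tensor:
  "covering_space (sphere 0 1) (\<lambda>n. tensor n n) ((\<lambda>n. tensor n n) ` sphere (0::real^3) 1)"
proof -
  define p where "p = (\<lambda>n::real^3. tensor n n)"
  have cp: "continuous_on S p" for S
    unfolding p_def by (intro continuous_on_tensor continuous_on_id)
  have "\<exists>T. P0 \<in> T \<and> openin (top_of_set (p ` sphere 0 1)) T \<and>
      (\<exists>\<V>. \<Union>\<V> = sphere 0 1 \<inter> p -` T \<and> (\<forall>u\<in>\<V>. openin (top_of_set (sphere 0 1)) u) \<and>
        pairwise disjnt \<V> \<and> (\<forall>u\<in>\<V>. \<exists>q. homeomorphism u T p q))"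
    if P0: "P0 \<in> p ` sphere 0 1" for P0
  proof -
    obtain v where v: "norm v = 1" "P0 = tensor v v"
      using P0 by (auto simp: p_def)
    have pv: "p n *v v = (n \<bullet> v) *\<^sub>R n" for n
      by (simp add: p_def tensor_mult_vector)
    have vpv: "v \<bullet> (p n *v v) = (n \<bullet> v)\<^sup>2" for n
      by (simp add: pv inner_commute power2_eq_square)
    define T where "T = {P \<in> p ` sphere 0 1. v \<bullet> (P *v v) > 0}"
    define H where "H e = {n \<in> sphere 0 1. e * (n \<bullet> v) > 0}" for e :: real
    have cv: "continuous_on S (\<lambda>P :: real^3^3. v \<bullet> (P *v v))" for S
      by (intro continuous_intros continuous_on_matrix_vector_mult)
    have "openin (top_of_set (p ` sphere 0 1)) (p ` sphere 0 1 \<inter> (\<lambda>P. v \<bullet> (P *v v)) -` {0<..})"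
      by (rule continuous_openin_preimage_gen[OF cv]) simp
    then have oT: "openin (top_of_set (p ` sphere 0 1)) T"
      by (simp add: T_def vimage_def Int_def)
    have oH: "openin (top_of_set (sphere 0 1)) (H e)" for e
    proof -
      have "openin (top_of_set (sphere 0 1)) (sphere 0 1 \<inter> (\<lambda>n. e * (n \<bullet> v)) -` {0<..})"
        by (rule continuous_openin_preimage_gen) (auto intro!: continuous_intros)
      then show ?thesis by (simp add: H_def vimage_def Int_def)
    qed
    have homeo: "\<exists>q. homeomorphism (H e) T p q" if e: "e = 1 \<or> e = - 1" for e
    proof
      define q where "q = (\<lambda>P. (e / sqrt (v \<bullet> (P *v v))) *\<^sub>R (P *v v))"
      have qp: "q (p n) = n" if "n \<in> H e" for n
      proof -
        have "sqrt ((n \<bullet> v)\<^sup>2) = e * (n \<bullet> v)" "n \<bullet> v \<noteq> 0"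
          using that e by (auto simp: H_def)
        moreover have "q (p n) = (e / sqrt ((n \<bullet> v)\<^sup>2)) *\<^sub>R ((n \<bullet> v) *\<^sub>R n)"
          unfolding q_def vpv by (simp add: pv)
        ultimately show ?thesis using e by auto
      qed
      have TH: "\<exists>n\<in>H e. P = p n" if P: "P \<in> T" for P
      proof -
        obtain n where n': "n \<in> sphere 0 1" "P = p n" "v \<bullet> (P *v v) > 0"
          using P unfolding T_def by blast
        then have n: "norm n = 1" "P = p n" "n \<bullet> v \<noteq> 0"
          using vpv[of n] by auto
        show ?thesis
        proof (cases "e * (n \<bullet> v) > 0")
          case True
          then show ?thesis using n by (auto simp: H_def)
        next
          case False
          then have "- n \<in> H e" using n e by (auto simp: H_def)
          moreover have "p (- n) = p n" by (simp add: p_def vec_eq_iff tensor_def)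
          ultimately show ?thesis using n by metis
        qed
      qed
      have HT: "p n \<in> T" if "n \<in> H e" for n
        using that by (auto simp: T_def H_def vpv)
      have cq: "continuous_on T q"
        unfolding q_def
        by (intro continuous_intros continuous_on_matrix_vector_mult) (auto simp: T_def)
      show "homeomorphism (H e) T p q"
      proof (rule homeomorphismI[OF cp cq])
        show "p ` H e \<subseteq> T" using HT by auto
        show "q ` T \<subseteq> H e" using TH qp by fastforce
        show "q (p x) = x" if "x \<in> H e" for x using qp that .
        show "p (q y) = y" if "y \<in> T" for y using TH[OF that] qp by metis
      qed
    qed
    show ?thesis
    proof (intro exI[of _ T] conjI exI[of _ "{H 1, H (- 1)}"])
      show "P0 \<in> T" using v P0 vpv[of v] by (simp add: T_def p_def norm_eq_1)
      show "\<Union>{H 1, H (- 1)} = sphere 0 1 \<inter> p -` T"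
        by (auto simp: H_def T_def vpv)
      show "pairwise disjnt {H 1, H (- 1)}"
        by (auto simp: pairwise_def disjnt_def H_def)
    qed (use oT oH homeo in auto)
  qed
  then show ?thesis
    unfolding covering_space_def p_def[symmetric] by (intro conjI cp refl ballI)
qed

text \<open>Components of an open set on the line are intervals, hence simply connected, so
  \<open>P\<close> lifts on each. They are also open and disjoint, so the sign may be chosen
  independently on each of them and the combined field remains continuous.\<close>

lemma continuous_director_exists:
  fixes P :: "real \<Rightarrow> real^3^3"
  assumes "open W" and P: "continuous_on W P"
    and ex: "\<And>x. x \<in> W \<Longrightarrow> \<exists>n. norm n = 1 \<and> P x = tensor n n"
  obtains n where "continuous_on W n" "\<And>x. x \<in> W \<Longrightarrow> norm (n x) = 1" "\<And>x. x \<in> W \<Longrightarrow> P x = tensor (n x) (n x)"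
proof -
  have "\<exists>n. continuous_on C n \<and> (\<forall>x\<in>C. norm (n x) = 1 \<and> P x = tensor (n x) (n x))"
    if C: "C \<in> components W" for C
  proof -
    have "convex C"
      using in_components_connected[OF C] is_interval_connected_1 is_interval_convex_1 by blast
    moreover have sub: "C \<subseteq> W" using C by (rule in_components_subset)
    moreover have "P \<in> C \<rightarrow> (\<lambda>n. tensor n n) ` sphere 0 1"
      using ex sub by fastforce
    ultimately obtain n where "continuous_on C n" "n \<in> C \<rightarrow> sphere 0 1" "\<And>x. x \<in> C \<Longrightarrow> tensor (n x) (n x) = P x"
      using covering_space_lift[OF covering_space_tensor convex_imp_simply_connected
          convex_imp_locally_path_connected continuous_on_subset[OF P], of C] by blast
    then show ?thesis by (intro exI[of _ n]) auto
  qed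
  then obtain N where N: "\<And>C. C \<in> components W \<Longrightarrow> continuous_on C (N C)"
    "\<And>C x. C \<in> components W \<Longrightarrow> x \<in> C \<Longrightarrow> norm (N C x) = 1 \<and> P x = tensor (N C x) (N C x)"
    by metis
  define n where "n x = N (connected_component_set W x) x" for x
  have nN: "n x = N C x" if "C \<in> components W" "x \<in> C" for C x
    using that connected_component_eq[of x W] unfolding n_def components_iff by metis
  show thesis
  proof
    show "continuous_on W n"
    proof (rule continuous_on_components_open[OF \<open>open W\<close>])
      fix C assume C: "C \<in> components W"
      then show "continuous_on C n"
        using N(1)[OF C] nN[OF C] by (simp cong: continuous_on_cong)
    qed
    fix x assume "x \<in> W"
    then have C: "connected_component_set W x \<in> components W" "x \<in> connected_component_set W x"
      by (auto simp: componentsI)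
    show "norm (n x) = 1" "P x = tensor (n x) (n x)"
      using N(2)[OF C] by (auto simp: n_def)
  qed
qed

section \<open>One-dimensional Sobolev functions\<close>

text \<open>Having one derivative certifies the choice made by \<open>weak_deriv\<close>; uniqueness
  then compares the chosen version with any explicit one.\<close>

lemma has_ac_deriv_weak_deriv:
  assumes "open U" "has_ac_deriv U f g"
  shows "has_ac_deriv U f (weak_deriv U f)" "AE x in lebesgue_on U. weak_deriv U f x = g x"
proof -
  have "has_weak_deriv U f (weak_deriv U f)"
    unfolding weak_deriv_def
    by (rule someI[of "has_weak_deriv U f"], rule has_ac_deriv_imp_has_weak_deriv[OF assms(2,1)])
  then show "has_ac_deriv U f (weak_deriv U f)"
    using has_weak_deriv_imp_has_ac_deriv assms has_ac_deriv_continuous_on by blast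
  then show "AE x in lebesgue_on U. weak_deriv U f x = g x"
    using has_ac_deriv_unique assms by blast
qed

lemma has_ac_deriv_imp_borel_measurable:
  assumes ac: "has_ac_deriv U f g" and "open U"
  shows "g \<in> borel_measurable (lebesgue_on U)"
proof -
  obtain C where C: "\<And>n::nat. compact (C n)" "\<And>n. C n \<subseteq> U" "\<Union>(range C) = U"
    by (rule open_Union_compact_subsets[OF \<open>open U\<close>]) blast
  show ?thesis
  proof (rule measurable_piecewise_restrict[where C = "range C"])
    fix K assume "K \<in> range C"
    then have K: "compact K" "K \<subseteq> U" using C by auto
    then have KL: "K \<in> sets lebesgue" by (simp add: compact_imp_closed)
    then show "K \<inter> space (lebesgue_on U) \<in> sets (lebesgue_on U)"
      using K \<open>open U\<close> by (auto simp: sets_restrict_space_iff Int_absorb2)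
    have "g \<in> borel_measurable (lebesgue_on K)"
      using has_ac_deriv_imp_integrable_compact[OF assms K] KL by (rule absolutely_integrable_imp_borel_measurable)
    then show "g \<in> borel_measurable (restrict_space (lebesgue_on U) K)"
      using K KL \<open>open U\<close> by (simp add: restrict_restrict_space Int_absorb1)
  qed (use C in auto)
qed

section \<open>Almost everywhere equality and integrability\<close>

lemma AE_lebesgue_on_implies:
  assumes "AE x in lebesgue_on W. P x" "W \<subseteq> U" "W \<in> sets lebesgue" "U \<in> sets lebesgue"
  shows "AE x in lebesgue_on U. x \<in> W \<longrightarrow> P x"
  using assms by (auto simp: AE_restrict_space_iff elim: AE_mp)

text \<open>Lebesgue measure is complete, so measurability passes along almost everywhere equality,
  and with it integrability. If neither side is integrable both integrals have the default value 0.
  This permits comparing the two energies through their densities alone.\<close>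

lemma integral_lebesgue_on_cong_AE:
  fixes f g :: "'a::euclidean_space \<Rightarrow> 'b::euclidean_space"
  assumes "AE x in lebesgue_on S. f x = g x" "S \<in> sets lebesgue"
  shows "integral\<^sup>L (lebesgue_on S) f = integral\<^sup>L (lebesgue_on S) g"
proof -
  have meas: "v \<in> borel_measurable (lebesgue_on S)"
    if "AE x in lebesgue_on S. u x = v x" "u \<in> borel_measurable (lebesgue_on S)" for u v :: "'a \<Rightarrow> 'b"
  proof -
    have "(\<lambda>x. if x \<in> S then v x else 0) \<in> borel_measurable lebesgue"
      using borel_measurable_if_I[OF that(2) assms(2)]
    proof (rule borel_measurable_AE)
      show "AE x in lebesgue. (if x \<in> S then u x else 0) = (if x \<in> S then v x else 0)"
        using that(1) assms(2) by (auto simp: AE_restrict_space_iff elim: AE_mp)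
    qed
    then show ?thesis by (rule borel_measurable_if_D)
  qed
  have int: "integrable (lebesgue_on S) v"
    if "AE x in lebesgue_on S. u x = v x" "integrable (lebesgue_on S) u" for u v :: "'a \<Rightarrow> 'b"
    by (rule integrable_cong_AE_imp[OF that(2) meas[OF that(1) borel_measurable_integrable[OF that(2)]] that(1)])
  have sym: "AE x in lebesgue_on S. g x = f x" using assms(1) by eventually_elim simp
  show ?thesis
  proof (cases "integrable (lebesgue_on S) f")
    case True
    then show ?thesis
      by (intro integral_cong_AE borel_measurable_integrable int[OF assms(1)] assms(1))
  next
    case False
    then have "\<not> integrable (lebesgue_on S) g" using int[OF sym] by blast
    with False show ?thesis by (simp add: not_integrable_integral_eq)
  qed
qed

lemma continuous_AE_0_imp_0:
  fixes f :: "real \<Rightarrow> 'b::real_normed_vector"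
  assumes "open U" "continuous_on U f" "AE x in lebesgue_on U. f x = 0" "x \<in> U"
  shows "f x = 0"
proof (rule ccontr)
  assume "f x \<noteq> 0"
  have "open {x \<in> U. f x \<noteq> 0}"
    using continuous_open_preimage[OF assms(2,1) open_Compl[OF closed_singleton[of 0]]] by (simp add: vimage_def Int_def)
  then obtain e where e: "e > 0" "ball x e \<subseteq> {x \<in> U. f x \<noteq> 0}"
    using \<open>f x \<noteq> 0\<close> \<open>x \<in> U\<close> open_contains_ball by blast
  have "AE y in lebesgue. y \<in> U \<longrightarrow> f y = 0"
    using assms by (simp add: AE_restrict_space_iff)
  then have "AE y in lebesgue. y \<notin> {x - e<..<x + e}"
  proof eventually_elim
    case (elim y)
    have "y \<in> ball x e" if "y \<in> {x - e<..<x + e}"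
      using that by (auto simp: dist_real_def)
    with elim e(2) show ?case by blast
  qed
  then have "negligible {x - e<..<x + e}"
    unfolding negligible_iff_null_sets by (subst AE_iff_null_sets) auto
  then show False
    using negligible_interval(2)[of "x - e" "x + e"] e(1) by simp
qed

lemma continuous_AE_eq_imp_eq:
  fixes f g :: "real \<Rightarrow> 'b::real_normed_vector"
  assumes "open U" "continuous_on U f" "continuous_on U g" "AE x in lebesgue_on U. f x = g x" "x \<in> U"
  shows "f x = g x"
  using continuous_AE_0_imp_0[of U "\<lambda>x. f x - g x" x] assms by (simp add: continuous_on_diff)

lemma L2_onI:
  assumes "f \<in> borel_measurable (lebesgue_on U)" "integrable (lebesgue_on U) h"
    and "AE x in lebesgue_on U. (norm (f x))\<^sup>2 \<le> h x"
  shows "L2_on U f"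
  unfolding L2_on_def
proof
  show "integrable (lebesgue_on U) (\<lambda>x. (norm (f x))\<^sup>2)"
    using assms(2)
  proof (rule Bochner_Integration.integrable_bound)
    show "(\<lambda>x. (norm (f x))\<^sup>2) \<in> borel_measurable (lebesgue_on U)"
      using assms(1) by measurable
    show "AE x in lebesgue_on U. norm ((norm (f x))\<^sup>2) \<le> norm (h x)"
      using assms(3) by eventually_elim auto
  qed
qed (rule assms(1))

lemma integrable_lebesgue_on_subset:
  fixes f :: "'a::euclidean_space \<Rightarrow> 'b::{banach, second_countable_topology}"
  assumes "integrable (lebesgue_on T) f" "S \<subseteq> T" "S \<in> sets lebesgue" "T \<in> sets lebesgue"
  shows "integrable (lebesgue_on S) f"
  using set_integrable_subset[of lebesgue T f S] assms
  by (simp add: set_integrable_def integrable_restrict_space)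

lemma L2_on_subset:
  assumes "L2_on T f" "S \<subseteq> T" "S \<in> sets lebesgue" "T \<in> sets lebesgue"
  shows "L2_on S f"
  using assms integrable_lebesgue_on_subset[OF _ assms(2-4)] measurable_restrict_mono
  unfolding L2_on_def by blast

text \<open>On a set of finite measure \<open>1 + (norm (f x))\<^sup>2\<close> is an integrable
  bound for \<open>norm (f x)\<close>.\<close>

lemma L2_on_imp_absolutely_integrable:
  assumes f: "L2_on U f" and S: "S \<subseteq> U" "S \<in> lmeasurable" and U: "U \<in> sets lebesgue"
  shows "f absolutely_integrable_on S"
proof -
  have SL: "S \<in> sets lebesgue" using S(2) by (rule fmeasurableD)
  have fS: "L2_on S f" by (rule L2_on_subset[OF f S(1) SL U])
  have "integrable (lebesgue_on S) (\<lambda>x. 1 + (norm (f x))\<^sup>2)"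
    using fS S(2) SL
    by (auto simp: L2_on_def fmeasurable_def emeasure_restrict_space intro!: Bochner_Integration.integrable_add finite_measure.integrable_const finite_measureI)
  then have "integrable (lebesgue_on S) f"
  proof (rule Bochner_Integration.integrable_bound)
    show "f \<in> borel_measurable (lebesgue_on S)" using fS by (simp add: L2_on_def)
    have "norm (f x) \<le> 1 + (norm (f x))\<^sup>2" for x
    proof -
      have "0 \<le> (norm (f x) - 1)\<^sup>2" by simp
      then have "2 * norm (f x) \<le> 1 + (norm (f x))\<^sup>2" by (simp add: power2_diff)
      then show ?thesis using norm_ge_zero[of "f x"] by linarith
    qed
    then show "AE x in lebesgue_on S. norm (f x) \<le> norm (1 + (norm (f x))\<^sup>2)"
      by (intro AE_I2) (simp add: abs_of_nonneg)
  qed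
  then show ?thesis
    using SL by (simp add: absolutely_integrable_on_iff_lebesgue_on)
qed

lemma W12_iff:
  assumes "open U"
  shows "f \<in> W12 U \<longleftrightarrow> L2_on U f \<and> (\<exists>g. has_ac_deriv U f g \<and> L2_on U g)"
  using has_weak_deriv_imp_has_ac_deriv[OF assms, of f] has_ac_deriv_imp_has_weak_deriv[OF _ assms, of f]
    has_ac_deriv_continuous_on[OF _ assms, of f] unfolding W12_def by blast

lemma L2_on_weak_deriv:
  assumes "open U" "has_ac_deriv U f g" "L2_on U g"
  shows "L2_on U (weak_deriv U f)"
proof (rule L2_onI)
  note w = has_ac_deriv_weak_deriv[OF assms(1,2)]
  show "weak_deriv U f \<in> borel_measurable (lebesgue_on U)"
    using w(1) assms(1) by (rule has_ac_deriv_imp_borel_measurable)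
  show "integrable (lebesgue_on U) (\<lambda>x. (norm (g x))\<^sup>2)" using assms(3) by (simp add: L2_on_def)
  show "AE x in lebesgue_on U. (norm (weak_deriv U f x))\<^sup>2 \<le> (norm (g x))\<^sup>2"
    using w(2) by eventually_elim simp
qed

lemma W12_weak_deriv:
  assumes "open U" "f \<in> W12 U"
  shows "continuous_on U f" "L2_on U f" "has_ac_deriv U f (weak_deriv U f)" "L2_on U (weak_deriv U f)"
proof -
  obtain g where g: "L2_on U f" "has_ac_deriv U f g" "L2_on U g"
    using assms W12_iff by blast
  show "L2_on U f" "has_ac_deriv U f (weak_deriv U f)" "L2_on U (weak_deriv U f)" "continuous_on U f"
    using g has_ac_deriv_weak_deriv(1) L2_on_weak_deriv has_ac_deriv_continuous_on assms(1) by blast+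
qed

lemma has_ac_deriv_Q_matrix:
  assumes s: "has_ac_deriv W s s'" and n: "has_ac_deriv W n n'" and "open W"
  shows "has_ac_deriv W (\<lambda>x. Q_matrix (s x) (n x)) (\<lambda>x. Q_matrix_deriv (s x) (n x) (s' x) (n' x))"
proof -
  have bil: "bilinear (\<lambda>c v. c *\<^sub>R (v::real^3^3))"
    by (simp add: bilinear_conv_bounded_bilinear bounded_bilinear_scaleR)
  have "has_ac_deriv W (\<lambda>x. tensor (n x) (n x)) (\<lambda>x. tensor (n x) (n' x) + tensor (n' x) (n x))"
    by (rule has_ac_deriv_bilinear[OF bilinear_tensor n n \<open>open W\<close>])
  from has_ac_deriv_bilinear[OF bil s has_ac_deriv_diff[OF this has_ac_deriv_const[of W "(1/3) *\<^sub>R mat 1"]] \<open>open W\<close>]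
  show ?thesis
    by (rule has_ac_deriv_cong[THEN iffD1, rotated -1]) (auto simp: Q_matrix_def Q_matrix_deriv_def algebra_simps)
qed

text \<open>Differentiate the constant \<open>n x \<bullet> n x\<close>.\<close>

lemma unit_has_ac_deriv_orthogonal:
  fixes n :: "real \<Rightarrow> 'a::euclidean_space"
  assumes n: "has_ac_deriv W n n'" and "open W" and unit: "\<And>x. x \<in> W \<Longrightarrow> norm (n x) = 1"
  shows "AE x in lebesgue_on W. n x \<bullet> n' x = 0"
proof -
  have bil: "bilinear (\<lambda>u v :: 'a. u \<bullet> v)"
    by (simp add: bilinear_conv_bounded_bilinear bounded_bilinear_inner)
  have "has_ac_deriv W (\<lambda>x. n x \<bullet> n x) (\<lambda>x. n x \<bullet> n' x + n' x \<bullet> n x)"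
    by (rule has_ac_deriv_bilinear[OF bil n n \<open>open W\<close>])
  then have "has_ac_deriv W (\<lambda>x. 1) (\<lambda>x. 2 * (n x \<bullet> n' x))"
    by (rule has_ac_deriv_cong[THEN iffD1, rotated -1]) (auto simp: inner_commute unit norm_eq_1[symmetric])
  then have "AE x in lebesgue_on W. 2 * (n x \<bullet> n' x) = 0"
    by (rule has_ac_deriv_0_AE[OF \<open>open W\<close>])
  then show ?thesis by simp
qed

section \<open>From pairs to tensors\<close>

lemma Q_matrix_0: "Q_matrix 0 n = 0"
  by (simp add: Q_matrix_def)

text \<open>At \<open>s = 0\<close> the vector \<open>n\<close> is arbitrary, but the matrix is zero
  and can be written with any unit vector instead.\<close>

lemma Q_matrix_admissible:
  assumes "s \<noteq> 0 \<Longrightarrow> norm n = 1"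
  shows "transpose (Q_matrix s n) = Q_matrix s n" "trace (Q_matrix s n) = 0" "uniaxial (Q_matrix s n)"
    "(norm (Q_matrix s n))\<^sup>2 = 2/3 * s\<^sup>2"
proof -
  have "\<exists>m. norm m = 1 \<and> Q_matrix s n = Q_matrix s m"
  proof (cases "s = 0")
    case True
    then show ?thesis
      by (intro exI[of _ "axis 1 1"]) (simp add: Q_matrix_0)
  qed (use assms in auto)
  then obtain m where m: "norm m = 1" "Q_matrix s n = Q_matrix s m" by blast
  show "transpose (Q_matrix s n) = Q_matrix s n" by (rule Q_matrix_sym)
  show "trace (Q_matrix s n) = 0" "uniaxial (Q_matrix s n)" "(norm (Q_matrix s n))\<^sup>2 = 2/3 * s\<^sup>2"
    unfolding m(2) by (rule Q_matrix_trace Q_matrix_uniaxial Q_matrix_invariants(3), rule m(1))+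
qed

lemma open_nonzero_set:
  fixes s :: "real \<Rightarrow> 'a::real_normed_vector"
  assumes "open \<Omega>" "continuous_on \<Omega> s"
  shows "open (\<Omega> - {x. s x = 0})"
  using continuous_open_preimage[OF assms(2,1) open_Compl[OF closed_singleton[of 0]]]
  by (simp add: vimage_def Int_def set_diff_eq)

lemma nonzero_set_eq: "{x \<in> \<Omega>. s x \<noteq> 0} = \<Omega> - {x. s x = 0}"
  by blast

text \<open>The weak derivative, set to zero where \<open>s\<close> vanishes, is again a derivative
  of \<open>s\<close> by the extension across zeros. Uniqueness forces the two versions to agree
  almost everywhere.\<close>

lemma W12_weak_deriv_0_on_zero_set:
  fixes s :: "real \<Rightarrow> 'a::euclidean_space"
  assumes "open \<Omega>" "s \<in> W12 \<Omega>"
  shows "AE x in lebesgue_on \<Omega>. s x = 0 \<longrightarrow> weak_deriv \<Omega> s x = 0"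
proof -
  note S = W12_weak_deriv[OF assms]
  define W where "W = \<Omega> - {x. s x = 0}"
  have W: "open W" "W \<subseteq> \<Omega>" unfolding W_def using open_nonzero_set[OF assms(1) S(1)] by auto
  define g where "g x = (if x \<in> W then weak_deriv \<Omega> s x else 0)" for x
  have "has_ac_deriv \<Omega> s g"
  proof (rule has_ac_deriv_extend_zero_set[OF S(1)])
    have "has_ac_deriv W s (weak_deriv \<Omega> s)" using S(3) W(2) by (rule has_ac_deriv_subset)
    then have "has_ac_deriv W s g" by (rule has_ac_deriv_cong[THEN iffD1, rotated -1]) (auto simp: g_def)
    then show "has_ac_deriv {x \<in> \<Omega>. s x \<noteq> 0} s g" by (simp add: nonzero_set_eq W_def)
    show "g absolutely_integrable_on {x..y}" if "x \<le> y" "{x..y} \<subseteq> \<Omega>" for x y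
    proof -
      have "weak_deriv \<Omega> s absolutely_integrable_on {x..y} \<inter> W"
        using has_ac_derivD(1)[OF S(3) that] W(1) by (auto intro: set_integrable_subset)
      moreover have "(\<lambda>z. indicat_real ({x..y} \<inter> W) z *\<^sub>R weak_deriv \<Omega> s z) =
          (\<lambda>z. indicat_real {x..y} z *\<^sub>R g z)"
        by (auto simp: g_def indicator_def fun_eq_iff)
      ultimately show ?thesis by (simp only: set_integrable_def)
    qed
  qed (auto simp: g_def W_def)
  then have "AE x in lebesgue_on \<Omega>. weak_deriv \<Omega> s x = g x"
    using has_ac_deriv_weak_deriv(2)[OF assms(1)] by blast
  then show ?thesis by eventually_elim (auto simp: g_def W_def)
qed

text \<open>On \<open>W\<close> the derivative \<open>g\<close> comes from the product rule. The
  norm identity bounds its square by the integrable quantities in the definition of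
  \<open>class_B\<close>, so \<open>g\<close> extended by zero is a derivative on all of the domain.
  The explicit \<open>g\<close> and the facts about \<open>n\<close> are kept for the comparison of
  energies.\<close>

lemma class_B_Q_of:
  assumes "open \<Omega>" and B: "(s, n) \<in> class_B \<Omega>"
  defines "W \<equiv> \<Omega> - {x. s x = 0}"
  defines "g \<equiv> (\<lambda>x. if x \<in> W then Q_matrix_deriv (s x) (n x) (weak_deriv \<Omega> s x) (weak_deriv W n x) else 0)"
  shows "has_ac_deriv \<Omega> (Q_of s n) g" "L2_on \<Omega> g" "Q_of s n \<in> class_A \<Omega>"
    "\<And>x. x \<in> W \<Longrightarrow> norm (n x) = 1" "AE x in lebesgue_on \<Omega>. x \<in> W \<longrightarrow> n x \<bullet> weak_deriv W n x = 0"
proof -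
  have sW: "s \<in> W12 \<Omega>" and nW: "n \<in> W12_loc W" and nS: "n ` W \<subseteq> sphere 0 1"
    and nI: "integrable (lebesgue_on \<Omega>) (\<lambda>x. (s x)\<^sup>2 * (norm (weak_deriv W n x))\<^sup>2)"
    using B by (auto simp: class_B_def W_def)
  note S = W12_weak_deriv[OF assms(1) sW]
  have W: "open W" "W \<subseteq> \<Omega>" unfolding W_def using open_nonzero_set[OF assms(1) S(1)] by auto
  have WL: "W \<in> sets lebesgue" and \<Omega>L: "\<Omega> \<in> sets lebesgue" using W assms(1) by auto
  have nc: "continuous_on W n" and "\<exists>g. has_weak_deriv W n g"
    using nW by (auto simp: W12_loc_def)
  then have nac: "has_ac_deriv W n (weak_deriv W n)"
    using has_weak_deriv_imp_has_ac_deriv[OF W(1)] has_ac_deriv_weak_deriv(1)[OF W(1)] by blast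
  show unit: "norm (n x) = 1" if "x \<in> W" for x
    using nS that by auto
  have "AE x in lebesgue_on W. n x \<bullet> weak_deriv W n x = 0"
    by (rule unit_has_ac_deriv_orthogonal[OF nac W(1) unit])
  then show orth: "AE x in lebesgue_on \<Omega>. x \<in> W \<longrightarrow> n x \<bullet> weak_deriv W n x = 0"
    using W(2) WL \<Omega>L by (rule AE_lebesgue_on_implies)
  have adm: "s x \<noteq> 0 \<Longrightarrow> norm (n x) = 1" if "x \<in> \<Omega>" for x
    using unit that by (simp add: W_def)
  have QW: "has_ac_deriv W (Q_of s n) g"
    by (rule has_ac_deriv_cong[THEN iffD1, rotated -1,
          OF has_ac_deriv_Q_matrix[OF has_ac_deriv_subset[OF S(3) W(2)] nac W(1)]])
       (simp_all add: Q_of_eq g_def)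
  have normQ: "(norm (Q_of s n x))\<^sup>2 = 2/3 * (s x)\<^sup>2" if "x \<in> \<Omega>" for x
    unfolding Q_of_eq by (rule Q_matrix_admissible(4)) (rule adm[OF that])
  have normQ_le: "norm (Q_of s n x) \<le> \<bar>s x\<bar>" if "x \<in> \<Omega>" for x
  proof (rule power2_le_imp_le)
    show "(norm (Q_of s n x))\<^sup>2 \<le> \<bar>s x\<bar>\<^sup>2"
      unfolding normQ[OF that] by simp
  qed simp
  have Qc: "continuous_on \<Omega> (Q_of s n)"
    unfolding continuous_on_eq_continuous_at[OF assms(1)]
  proof
    fix z assume z: "z \<in> \<Omega>"
    show "isCont (Q_of s n) z"
    proof (cases "s z = 0")
      case False
      then have "z \<in> W" using z by (simp add: W_def)
      then show ?thesis
        using has_ac_deriv_continuous_on[OF QW W(1)]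
        unfolding continuous_on_eq_continuous_at[OF W(1)] by blast
    next
      \<comment> \<open>Here \<open>n\<close> need not converge; continuity comes from the bound of
        the matrix norm by \<open>\<bar>s x\<bar>\<close>.\<close>
      case True
      have "(\<lambda>x. \<bar>s x\<bar>) \<midarrow>z\<rightarrow> 0"
        using S(1) z True unfolding continuous_on_eq_continuous_at[OF assms(1)] isCont_def
        by (metis tendsto_rabs_zero)
      moreover have "\<forall>\<^sub>F x in at z. norm (Q_of s n x) \<le> \<bar>s x\<bar>"
        using eventually_at_in_open'[OF assms(1) z] by eventually_elim (rule normQ_le)
      ultimately have "Q_of s n \<midarrow>z\<rightarrow> 0"
        by (rule Lim_null_comparison[rotated])
      then show ?thesis using True by (simp add: isCont_def Q_of_def)
    qed
  qed
  have g_meas: "g \<in> borel_measurable (lebesgue_on \<Omega>)"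
  proof -
    have "g \<in> borel_measurable (lebesgue_on W)"
      by (rule has_ac_deriv_imp_borel_measurable[OF QW W(1)])
    moreover have "(\<lambda>x. if x \<in> W then g x else 0) = g" by (auto simp: g_def)
    ultimately show ?thesis
      using borel_measurable_if_lebesgue_on[OF WL \<Omega>L W(2), of g] by simp
  qed
  show gL2: "L2_on \<Omega> g"
  proof (rule L2_onI[OF g_meas])
    show "integrable (lebesgue_on \<Omega>) (\<lambda>x. 2 * ((s x)\<^sup>2 * (norm (weak_deriv W n x))\<^sup>2) +
        2/3 * (norm (weak_deriv \<Omega> s x))\<^sup>2)"
      using nI S(4) unfolding L2_on_def
      by (intro Bochner_Integration.integrable_add integrable_mult_right) auto
    show "AE x in lebesgue_on \<Omega>. (norm (g x))\<^sup>2 \<le> 2 * ((s x)\<^sup>2 * (norm (weak_deriv W n x))\<^sup>2) +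
        2/3 * (norm (weak_deriv \<Omega> s x))\<^sup>2"
      using orth
    proof eventually_elim
      case (elim x)
      then show ?case
        by (cases "x \<in> W") (simp_all add: g_def norm_Q_matrix_deriv unit)
    qed
  qed
  \<comment> \<open>The extension across zeros refers to the zeros of the function itself, so those
    of \<open>Q_of s n\<close> have to be identified with those of \<open>s\<close>.\<close>
  have QW': "{x \<in> \<Omega>. Q_of s n x \<noteq> 0} = W"
  proof -
    have "Q_of s n x = 0 \<longleftrightarrow> s x = 0" if "x \<in> \<Omega>" for x
      using normQ[OF that] by auto
    then show ?thesis by (auto simp: W_def)
  qed
  show Qac: "has_ac_deriv \<Omega> (Q_of s n) g"
  proof (rule has_ac_deriv_extend_zero_set[OF Qc])
    show "has_ac_deriv {x \<in> \<Omega>. Q_of s n x \<noteq> 0} (Q_of s n) g" unfolding QW' by (rule QW)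
    show "g absolutely_integrable_on {x..y}" if "{x..y} \<subseteq> \<Omega>" for x y
      using L2_on_imp_absolutely_integrable[OF gL2 that _ \<Omega>L] by simp
    show "g x = 0" if "x \<in> \<Omega>" "Q_of s n x = 0" for x
      using QW' that by (auto simp: g_def)
  qed
  have "L2_on \<Omega> (Q_of s n)"
  proof (rule L2_onI)
    show "Q_of s n \<in> borel_measurable (lebesgue_on \<Omega>)"
      using Qc \<Omega>L by (rule continuous_imp_measurable_on_sets_lebesgue)
    show "integrable (lebesgue_on \<Omega>) (\<lambda>x. (norm (s x))\<^sup>2)" using S(2) by (simp add: L2_on_def)
    show "AE x in lebesgue_on \<Omega>. (norm (Q_of s n x))\<^sup>2 \<le> (norm (s x))\<^sup>2"
      using normQ_le by (intro AE_I2) (simp add: abs_le_square_iff[symmetric])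
  qed
  then have "Q_of s n \<in> W12 \<Omega>" using Qac gL2 W12_iff[OF assms(1)] by blast
  moreover have "transpose (Q_of s n x) = Q_of s n x \<and> trace (Q_of s n x) = 0 \<and> uniaxial (Q_of s n x)"
    if "x \<in> \<Omega>" for x
    using Q_matrix_admissible(1-3)[of "s x" "n x", OF adm[OF that]] by (simp add: Q_of_eq)
  ultimately show "Q_of s n \<in> class_A \<Omega>"
    by (auto simp: class_A_def intro!: AE_I2)
qed

text \<open>Being related is an almost everywhere condition, but both fields are continuous and
  therefore equal throughout the domain. On \<open>W\<close> the densities agree by the pointwise
  identities; off \<open>W\<close> both are zero almost everywhere, the derivative of
  \<open>s\<close> vanishing there.\<close>

lemma related_energy_eq:
  assumes "open \<Omega>" and A: "Q \<in> class_A \<Omega>" and B: "(s, n) \<in> class_B \<Omega>" and rel: "related \<Omega> Q s n"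
  shows "I_L k t a b c \<Omega> Q = I_E k t a b c \<Omega> n s"
  unfolding I_L_def I_E_def
proof (rule integral_lebesgue_on_cong_AE)
  define W where "W = \<Omega> - {x. s x = 0}"
  note C = class_B_Q_of[OF assms(1) B, folded W_def]
  have QW: "Q \<in> W12 \<Omega>" and sW: "s \<in> W12 \<Omega>"
    using A B by (auto simp: class_A_def class_B_def)
  have eq: "Q x = Q_of s n x" if "x \<in> \<Omega>" for x
    using W12_weak_deriv(1)[OF assms(1) QW] has_ac_deriv_continuous_on[OF C(1) assms(1)] rel that
    unfolding related_def by (rule continuous_AE_eq_imp_eq[OF assms(1)])
  have "has_ac_deriv \<Omega> Q (\<lambda>x. if x \<in> W then Q_matrix_deriv (s x) (n x) (weak_deriv \<Omega> s x) (weak_deriv W n x) else 0)"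
    using C(1) by (rule has_ac_deriv_cong[THEN iffD1, rotated -1]) (simp_all add: eq)
  from has_ac_deriv_weak_deriv(2)[OF assms(1) this] C(5) W12_weak_deriv_0_on_zero_set[OF assms(1) sW] AE_space
  show "AE x in lebesgue_on \<Omega>.
     (let DQ = grad k (weak_deriv \<Omega> Q x)
          in (norm DQ)\<^sup>2 + 4 * t * (Q x \<bullet> curl_mat DQ) + 3 * t\<^sup>2 * (norm (Q x))\<^sup>2
             + psi_B a b c (Q x)) =
     (let Dn = grad k (weak_deriv (\<Omega> - {x. s x = 0}) n x);
              Ds = grad k (weak_deriv \<Omega> s x)
          in 2 * (s x)\<^sup>2 * ((norm Dn)\<^sup>2 + 2 * t * (n x \<bullet> curl_vec Dn) + t\<^sup>2)
             + 2/3 * (norm Ds)\<^sup>2 + sigma a b c (s x))"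
    unfolding W_def[symmetric]
  proof eventually_elim
    case (elim x)
    then have x: "x \<in> \<Omega>" by simp
    show ?case
    proof (cases "x \<in> W")
      case True
      then have 1: "Q x = Q_matrix (s x) (n x)" "norm (n x) = 1" "n x \<bullet> weak_deriv W n x = 0"
        "weak_deriv \<Omega> Q x = Q_matrix_deriv (s x) (n x) (weak_deriv \<Omega> s x) (weak_deriv W n x)"
        using elim x C(4) by (simp_all add: eq Q_of_eq)
      show ?thesis
        unfolding 1(1,4) by (rule energy_density_eq[OF 1(2,3)])
    next
      case False
      then have 0: "s x = 0" "weak_deriv \<Omega> s x = 0" "weak_deriv \<Omega> Q x = 0" "Q x = 0"
        using elim x by (auto simp: W_def eq Q_of_def)
      show ?thesis
        unfolding 0 energy_density_0 by (simp add: norm_grad sigma_def Let_def)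
    qed
  qed
qed (use assms in auto)

section \<open>From tensors to pairs\<close>

text \<open>\<open>V\<close> is a neighbourhood of the diagonal on which the factor \<open>A\<close>
  of the increments is continuous; away from the diagonal its denominator may vanish.\<close>

lemma has_ac_deriv_increments_on:
  fixes p :: "'a::euclidean_space \<Rightarrow> 'b::euclidean_space \<Rightarrow> 'c::euclidean_space"
  assumes p: "bilinear p" and h: "has_ac_deriv U h h'" and "open U"
    and V: "open V" "\<And>z. z \<in> U \<Longrightarrow> (z, z) \<in> V"
    and A: "continuous_on V (\<lambda>w. A (fst w) (snd w))"
    and inc: "\<And>x y. (x, y) \<in> V \<Longrightarrow> f y - f x = p (A x y) (h y - h x)"
  shows "has_ac_deriv U f (\<lambda>x. p (A x x) (h' x))"
proof (rule has_ac_deriv_increments[where A = A, OF p h \<open>open U\<close>])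
  fix z assume z: "z \<in> U"
  show "isCont (\<lambda>w. A (fst w) (snd w)) (z, z)"
    using A V(2)[OF z] unfolding continuous_on_eq_continuous_at[OF V(1)] by blast
  show "\<forall>\<^sub>F w in nhds (z, z). f (snd w) - f (fst w) = p (A (fst w) (snd w)) (h (snd w) - h (fst w))"
    using eventually_nhds_in_open[OF V(1) V(2)[OF z]] by eventually_elim (simp add: inc)
qed

lemma continuous_on_fst_snd:
  assumes "continuous_on W f"
  shows "continuous_on (W \<times> W) (\<lambda>w. f (fst w))" "continuous_on (W \<times> W) (\<lambda>w. f (snd w))"
  by (rule continuous_on_compose2[OF assms]; auto intro!: continuous_intros)+

lemma open_Times_nonzero:
  fixes d :: "real \<times> real \<Rightarrow> real"
  assumes "open W" "continuous_on (W \<times> W) d"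
  shows "open {w \<in> W \<times> W. d w \<noteq> 0}"
  using continuous_open_preimage[OF assms(2) open_Times[OF assms(1,1)] open_Compl[OF closed_singleton[of 0]]]
  by (simp add: vimage_def Int_def)

lemma has_ac_deriv_inverse:
  fixes s :: "real \<Rightarrow> real"
  assumes s: "has_ac_deriv W s s'" and "open W" and nz: "\<And>x. x \<in> W \<Longrightarrow> s x \<noteq> 0"
  shows "\<exists>g. has_ac_deriv W (\<lambda>x. 1 / s x) g"
proof
  have c: "continuous_on W s" by (rule has_ac_deriv_continuous_on[OF s \<open>open W\<close>])
  show "has_ac_deriv W (\<lambda>x. 1 / s x) (\<lambda>x. - 1 / (s x * s x) * s' x)"
    by (rule has_ac_deriv_increments_on[where V = "W \<times> W" and A = "\<lambda>x y. - 1 / (s x * s y)",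
          OF bilinear_times s \<open>open W\<close>])
       (auto intro!: continuous_intros continuous_on_fst_snd[OF c] open_Times \<open>open W\<close>
          simp: nz field_simps)
qed

text \<open>The difference \<open>s y - s x\<close> is \<open>h y - h x\<close> divided by
  \<open>s x + s y\<close>. The sum can vanish for distant points of opposite sign, which
  \<open>V\<close> excludes, but equals \<open>2 * s x\<close> on the diagonal.\<close>

lemma has_ac_deriv_square_root:
  fixes s :: "real \<Rightarrow> real"
  assumes s: "continuous_on W s" and "open W" and nz: "\<And>x. x \<in> W \<Longrightarrow> s x \<noteq> 0"
    and h: "has_ac_deriv W h h'" and sq: "\<And>x. x \<in> W \<Longrightarrow> (s x)\<^sup>2 = h x"
  shows "\<exists>g. has_ac_deriv W s g"
proof
  define V where "V = {w \<in> W \<times> W. s (fst w) + s (snd w) \<noteq> 0}"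
  have cV: "continuous_on (W \<times> W) (\<lambda>w. s (fst w) + s (snd w))"
    by (intro continuous_intros continuous_on_fst_snd[OF s])
  show "has_ac_deriv W s (\<lambda>x. 1 / (s x + s x) * h' x)"
  proof (rule has_ac_deriv_increments_on[where V = V and A = "\<lambda>x y. 1 / (s x + s y)", OF bilinear_times h \<open>open W\<close>])
    show "open V" unfolding V_def by (rule open_Times_nonzero[OF \<open>open W\<close> cV])
    show "(z, z) \<in> V" if "z \<in> W" for z using that nz by (simp add: V_def)
    show "continuous_on V (\<lambda>w. 1 / (s (fst w) + s (snd w)))"
      by (intro continuous_intros continuous_on_subset[OF cV]) (auto simp: V_def)
    show "s y - s x = 1 / (s x + s y) * (h y - h x)" if "(x, y) \<in> V" for x y
      using that by (auto simp: V_def sq[symmetric] power2_eq_square field_simps)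
  qed
qed

text \<open>For unit vectors, \<open>P y - P x\<close> applied to \<open>n x + n y\<close> is
  \<open>n y - n x\<close> times \<open>1 + n x \<bullet> n y\<close>, and that factor is 2 on the
  diagonal. So a continuous lift is as regular as its projection.\<close>

lemma has_ac_deriv_director:
  fixes n :: "real \<Rightarrow> real^3"
  assumes n: "continuous_on W n" and "open W" and unit: "\<And>x. x \<in> W \<Longrightarrow> norm (n x) = 1"
    and P: "has_ac_deriv W P P'" and PT: "\<And>x. x \<in> W \<Longrightarrow> P x = tensor (n x) (n x)"
  shows "\<exists>g. has_ac_deriv W n g"
proof
  define V where "V = {w \<in> W \<times> W. 1 + n (fst w) \<bullet> n (snd w) \<noteq> 0}"
  define A where "A x y = (1 / (1 + n x \<bullet> n y)) *\<^sub>R (n x + n y)" for x y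
  have bil: "bilinear (\<lambda>v (M::real^3^3). M *v v)"
    using bilinear_matrix_vector_mult by (simp add: bilinear_def)
  have cV: "continuous_on (W \<times> W) (\<lambda>w. 1 + n (fst w) \<bullet> n (snd w))"
    by (intro continuous_intros continuous_on_fst_snd[OF n])
  show "has_ac_deriv W n (\<lambda>x. P' x *v A x x)"
  proof (rule has_ac_deriv_increments_on[where V = V and A = A, OF bil P \<open>open W\<close>])
    show "open V" unfolding V_def by (rule open_Times_nonzero[OF \<open>open W\<close> cV])
    show "(z, z) \<in> V" if "z \<in> W" for z
      using that unit[OF that] by (simp add: V_def norm_eq_1)
    show "continuous_on V (\<lambda>w. A (fst w) (snd w))"
      unfolding A_def
      by (intro continuous_intros continuous_on_subset[OF cV]
          continuous_on_subset[OF continuous_on_fst_snd(1)[OF n]]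
          continuous_on_subset[OF continuous_on_fst_snd(2)[OF n]]) (auto simp: V_def)
    fix x y assume xy: "(x, y) \<in> V"
    then have W: "x \<in> W" "y \<in> W" and nz: "1 + n x \<bullet> n y \<noteq> 0" by (auto simp: V_def)
    have "(P y - P x) *v (n x + n y) = (1 + n x \<bullet> n y) *\<^sub>R (n y - n x)"
      using unit[OF W(1)] unit[OF W(2)]
      by (simp add: PT W matrix_vector_mult_diff_rdistrib tensor_mult_vector inner_add_right norm_eq_1
          inner_commute algebra_simps)
    then show "n y - n x = (P y - P x) *v A x y"
      using nz by (simp add: A_def matrix_vector_mult_scaleR)
  qed
qed

lemma linear_transpose: "linear (transpose :: real^'n^'m \<Rightarrow> real^'m^'n)"
  by (simp add: linear_iff transpose_def vec_eq_iff)

lemma linear_trace: "linear (trace :: real^'n^'n \<Rightarrow> real)"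
  by (simp add: linear_iff trace_def sum.distrib sum_distrib_left)

lemma bilinear_matrix_mult: "bilinear ((**) :: real^'n^'m \<Rightarrow> real^'k^'n \<Rightarrow> real^'k^'m)"
  by (simp add: bilinear_def linear_iff vec_eq_iff matrix_matrix_mult_def sum.distrib
      sum_distrib_left algebra_simps)

text \<open>All three conditions are equations between continuous expressions in \<open>Q\<close>,
  so they hold at every point once they hold almost everywhere.\<close>

lemma class_A_pointwise:
  assumes "open \<Omega>" "Q \<in> class_A \<Omega>" "x \<in> \<Omega>"
  shows "transpose (Q x) = Q x" "trace (Q x) = 0"
    "(trace (Q x ** Q x))^3 = 6 * (trace (Q x ** Q x ** Q x))^2"
proof -
  have c: "continuous_on \<Omega> Q" and ae: "AE x in lebesgue_on \<Omega>. transpose (Q x) = Q x \<and> trace (Q x) = 0 \<and> uniaxial (Q x)"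
    using assms by (auto simp: class_A_def W12_def)
  note cl = linear_continuous_on_compose[OF c]
  note cm = bounded_bilinear.continuous_on[OF bilinear_imp_bounded_bilinear[OF bilinear_matrix_mult]]
  note ct = linear_continuous_on_compose[OF _ linear_trace]
  show "transpose (Q x) = Q x"
    by (rule continuous_AE_eq_imp_eq[OF assms(1) cl[OF linear_transpose] c _ assms(3)])
      (use ae in \<open>eventually_elim, simp\<close>)
  show "trace (Q x) = 0"
    by (rule continuous_AE_0_imp_0[OF assms(1) cl[OF linear_trace] _ assms(3)])
      (use ae in \<open>eventually_elim, simp\<close>)
  show "(trace (Q x ** Q x))^3 = 6 * (trace (Q x ** Q x ** Q x))^2"
  proof (rule continuous_AE_eq_imp_eq[OF assms(1) _ _ _ assms(3)])
    show "AE x in lebesgue_on \<Omega>. (trace (Q x ** Q x))^3 = 6 * (trace (Q x ** Q x ** Q x))^2"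
      using ae by eventually_elim (simp add: uniaxial_discriminant)
  qed (intro continuous_intros ct cm c)+
qed

text \<open>Derivatives of \<open>s\<close> and \<open>n\<close> on \<open>W\<close> are first
  obtained without any bounds, from algebraic relations with \<open>Q\<close>. The bounds follow by
  comparing the resulting derivative of \<open>Q\<close> with the square-integrable one.\<close>

lemma class_A_imp_class_B:
  assumes "open \<Omega>" and A: "Q \<in> class_A \<Omega>"
  shows "\<exists>s n. (s, n) \<in> class_B \<Omega> \<and> related \<Omega> Q s n"
proof -
  define s where "s x = 3 * trace (Q x ** Q x ** Q x) / trace (Q x ** Q x)" for x
  note pw = class_A_pointwise[OF assms]
  have sQ: "(s x)\<^sup>2 = 3/2 * (norm (Q x))\<^sup>2" if "x \<in> \<Omega>" for x
    by (rule uniaxial_representation(1)[OF pw[OF that] s_def])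
  have s0: "s x = 0 \<longleftrightarrow> Q x = 0" if "x \<in> \<Omega>" for x
    using sQ[OF that] by auto
  have "Q \<in> W12 \<Omega>" using A by (simp add: class_A_def)
  note Q = W12_weak_deriv[OF assms(1) this]
  define g where "g = weak_deriv \<Omega> Q"
  have g: "has_ac_deriv \<Omega> Q g" "L2_on \<Omega> g" using Q by (auto simp: g_def)
  have sc: "continuous_on \<Omega> s"
    unfolding continuous_on_eq_continuous_at[OF assms(1)]
  proof
    fix z assume z: "z \<in> \<Omega>"
    note cm = bounded_bilinear.continuous_on[OF bilinear_imp_bounded_bilinear[OF bilinear_matrix_mult]]
    note ct = linear_continuous_on_compose[OF _ linear_trace]
    show "isCont s z"
    proof (cases "s z = 0")
      case True
      have Qz: "2 * norm (Q z) = 0" using s0[OF z] True by simp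
      have "(\<lambda>x. 2 * norm (Q x)) \<midarrow>z\<rightarrow> 2 * norm (Q z)"
        using Q(1) z unfolding continuous_on_eq_continuous_at[OF assms(1)] isCont_def
        by (intro tendsto_intros) blast
      then have "(\<lambda>x. 2 * norm (Q x)) \<midarrow>z\<rightarrow> 0" unfolding Qz .
      \<comment> \<open>The 2 is a convenient constant above the square root of 3/2.\<close>
      moreover have "\<forall>\<^sub>F x in at z. norm (s x) \<le> 2 * norm (Q x)"
        using eventually_at_in_open'[OF assms(1) z]
      proof eventually_elim
        case (elim x)
        have "(s x)\<^sup>2 \<le> (2 * norm (Q x))\<^sup>2"
          unfolding sQ[OF elim] by (simp add: power_mult_distrib)
        then show ?case unfolding abs_le_square_iff[symmetric] by simp
      qed
      ultimately have "s \<midarrow>z\<rightarrow> 0" by (rule Lim_null_comparison[rotated])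
      then show ?thesis using True by (simp add: isCont_def)
    next
      case False
      then have nz: "trace (Q z ** Q z) \<noteq> 0" by (auto simp: s_def)
      have "continuous_on \<Omega> (\<lambda>x. 3 * trace (Q x ** Q x ** Q x))" "continuous_on \<Omega> (\<lambda>x. trace (Q x ** Q x))"
        by (intro continuous_intros ct cm Q(1))+
      then have "isCont (\<lambda>x. 3 * trace (Q x ** Q x ** Q x)) z" "isCont (\<lambda>x. trace (Q x ** Q x)) z"
        using z unfolding continuous_on_eq_continuous_at[OF assms(1)] by blast+
      then show ?thesis unfolding s_def[abs_def] using nz by (rule isCont_divide)
    qed
  qed
  define W where "W = \<Omega> - {x. s x = 0}"
  have W: "open W" "W \<subseteq> \<Omega>" unfolding W_def using open_nonzero_set[OF assms(1) sc] by auto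
  have WL: "W \<in> sets lebesgue" and \<Omega>L: "\<Omega> \<in> sets lebesgue" using W assms(1) by auto
  have snz: "s x \<noteq> 0" if "x \<in> W" for x using that by (simp add: W_def)
  have sW: "continuous_on W s" using sc W(2) by (rule continuous_on_subset)
  have gW: "has_ac_deriv W Q g" using g(1) W(2) by (rule has_ac_deriv_subset)
  have bili: "bilinear (\<lambda>(u :: real^3^3) v. 3/2 * (u \<bullet> v))"
    by (simp add: bilinear_def linear_iff inner_add_left inner_add_right algebra_simps)
  \<comment> \<open>Rather than from the quotient, the derivative is taken from \<open>s\<close> as
    a continuous square root of \<open>3/2 * (Q x \<bullet> Q x)\<close>.\<close>
  have "\<exists>s'. has_ac_deriv W s s'"
    using W(2) by (intro has_ac_deriv_square_root[OF sW W(1) snz has_ac_deriv_bilinear[OF bili gW gW W(1)]])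
      (auto simp: sQ power2_norm_eq_inner)
  then obtain s' where s': "has_ac_deriv W s s'" by blast
  obtain r where r: "has_ac_deriv W (\<lambda>x. 1 / s x) r"
    using has_ac_deriv_inverse[OF s' W(1) snz] by blast
  define P where "P x = (1 / s x) *\<^sub>R Q x + (1/3) *\<^sub>R (mat 1 :: real^3^3)" for x
  have bils: "bilinear (\<lambda>c v. c *\<^sub>R (v::real^3^3))"
    by (simp add: bilinear_conv_bounded_bilinear bounded_bilinear_scaleR)
  have "\<exists>P'. has_ac_deriv W P P'"
    using has_ac_deriv_diff[OF has_ac_deriv_bilinear[OF bils r gW W(1)] has_ac_deriv_const[of W "- (1/3) *\<^sub>R mat 1"]]
    by (auto simp: P_def[abs_def])
  then obtain P' where P': "has_ac_deriv W P P'" by blast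
  have "\<exists>m. norm m = 1 \<and> P x = tensor m m" if "x \<in> W" for x
    unfolding P_def using that W(2) by (intro uniaxial_representation(2)[OF pw s_def snz]) auto
  then obtain n where n: "continuous_on W n" "\<And>x. x \<in> W \<Longrightarrow> norm (n x) = 1"
    "\<And>x. x \<in> W \<Longrightarrow> P x = tensor (n x) (n x)"
    by (rule continuous_director_exists[OF W(1) has_ac_deriv_continuous_on[OF P' W(1)]]) auto
  obtain n' where n': "has_ac_deriv W n n'"
    using has_ac_deriv_director[OF n(1) W(1) n(2) P' n(3)] by blast
  have QW: "Q x = Q_matrix (s x) (n x)" if "x \<in> W" for x
  proof -
    have "Q_matrix (s x) (n x) = s x *\<^sub>R (P x - (1/3) *\<^sub>R mat 1)"
      by (simp add: Q_matrix_def n(3)[OF that])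
    also have "\<dots> = Q x" using snz[OF that] by (simp add: P_def)
    finally show ?thesis by simp
  qed
  have "has_ac_deriv W Q (\<lambda>x. Q_matrix_deriv (s x) (n x) (s' x) (n' x))"
    using has_ac_deriv_Q_matrix[OF s' n' W(1)] by (rule has_ac_deriv_cong[THEN iffD1, rotated -1]) (auto simp: QW)
  then have "AE x in lebesgue_on W. Q_matrix_deriv (s x) (n x) (s' x) (n' x) = g x"
    by (rule has_ac_deriv_unique[OF W(1) _ gW])
  moreover have "AE x in lebesgue_on W. n x \<bullet> n' x = 0"
    by (rule unit_has_ac_deriv_orthogonal[OF n' W(1)]) (rule n(2))
  \<comment> \<open>Both summands on the left are nonnegative, so this one identity gives every
    bound below: for \<open>s'\<close>, for \<open>n'\<close> on compact sets, and for the weighted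
    square of the derivative of \<open>n\<close>.\<close>
  ultimately have key: "AE x in lebesgue_on W. 2 * (s x)\<^sup>2 * (norm (n' x))\<^sup>2 + 2/3 * (s' x)\<^sup>2 = (norm (g x))\<^sup>2"
    using AE_space
  proof eventually_elim
    case (elim x)
    then show ?case using norm_Q_matrix_deriv[of "n x" "n' x" "s x" "s' x"] n(2)[of x] by simp
  qed
  note key\<Omega> = AE_lebesgue_on_implies[OF key W(2) WL \<Omega>L]
  have g2: "integrable (lebesgue_on \<Omega>) (\<lambda>x. (norm (g x))\<^sup>2)" using g(2) by (simp add: L2_on_def)
  define \<sigma> where "\<sigma> x = (if x \<in> W then s' x else 0)" for x
  have \<sigma>L2: "L2_on \<Omega> \<sigma>"
  proof (rule L2_onI)
    show "\<sigma> \<in> borel_measurable (lebesgue_on \<Omega>)"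
      unfolding \<sigma>_def[abs_def] borel_measurable_if_lebesgue_on[OF WL \<Omega>L W(2)]
      by (rule has_ac_deriv_imp_borel_measurable[OF s' W(1)])
    show "integrable (lebesgue_on \<Omega>) (\<lambda>x. 3/2 * (norm (g x))\<^sup>2)"
      using g2 by (rule integrable_mult_right)
    show "AE x in lebesgue_on \<Omega>. (norm (\<sigma> x))\<^sup>2 \<le> 3/2 * (norm (g x))\<^sup>2"
      using key\<Omega>
    proof eventually_elim
      case (elim x)
      have "0 \<le> 2 * (s x)\<^sup>2 * (norm (n' x))\<^sup>2" by simp
      then have "(s' x)\<^sup>2 \<le> 3/2 * (norm (g x))\<^sup>2" if "x \<in> W"
        using elim that by linarith
      then show ?case by (auto simp: \<sigma>_def)
    qed
  qed
  have "has_ac_deriv \<Omega> s \<sigma>"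
  proof (rule has_ac_deriv_extend_zero_set[OF sc])
    have "has_ac_deriv W s \<sigma>"
      using s' by (rule has_ac_deriv_cong[THEN iffD1, rotated -1]) (auto simp: \<sigma>_def)
    then show "has_ac_deriv {x \<in> \<Omega>. s x \<noteq> 0} s \<sigma>" by (simp add: nonzero_set_eq W_def)
    show "\<sigma> absolutely_integrable_on {x..y}" if "{x..y} \<subseteq> \<Omega>" for x y
      using L2_on_imp_absolutely_integrable[OF \<sigma>L2 that _ \<Omega>L] by simp
  qed (auto simp: \<sigma>_def W_def)
  moreover have "L2_on \<Omega> s"
  proof (rule L2_onI)
    show "s \<in> borel_measurable (lebesgue_on \<Omega>)"
      using sc \<Omega>L by (rule continuous_imp_measurable_on_sets_lebesgue)
    show "integrable (lebesgue_on \<Omega>) (\<lambda>x. 3/2 * (norm (Q x))\<^sup>2)"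
      using Q(2) unfolding L2_on_def by (intro integrable_mult_right) simp
    show "AE x in lebesgue_on \<Omega>. (norm (s x))\<^sup>2 \<le> 3/2 * (norm (Q x))\<^sup>2"
      by (intro AE_I2) (simp add: sQ)
  qed
  ultimately have sW12: "s \<in> W12 \<Omega>" using \<sigma>L2 W12_iff[OF assms(1)] by blast
  have nW12: "n \<in> W12_loc W"
  proof -
    have "L2_on K n \<and> L2_on K n'" if K: "compact K" "K \<subseteq> W" for K
    proof
      have KL: "K \<in> sets lebesgue" using K by (simp add: compact_imp_closed)
      have Kfin: "integrable (lebesgue_on K) (\<lambda>x. 1::real)"
        using continuous_on_imp_locally_integrable[of W "\<lambda>x. 1::real"] K
        by (simp add: locally_integrable_def)
      show "L2_on K n"
      proof (rule L2_onI[OF _ Kfin])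
        show "n \<in> borel_measurable (lebesgue_on K)"
          using continuous_on_subset[OF n(1) K(2)] KL by (rule continuous_imp_measurable_on_sets_lebesgue)
        show "AE x in lebesgue_on K. (norm (n x))\<^sup>2 \<le> 1"
          using n(2) K(2) by (intro AE_I2) auto
      qed
      \<comment> \<open>On a nonempty compact subset of \<open>W\<close> the continuous function
        \<open>(s x)\<^sup>2\<close> has a positive minimum, so the weight in \<open>key\<close> can
        be divided out.\<close>
      obtain m where m: "m > 0" "\<And>x. x \<in> K \<Longrightarrow> m \<le> (s x)\<^sup>2"
      proof (cases "K = {}")
        case False
        then obtain z where z: "z \<in> K" "\<And>x. x \<in> K \<Longrightarrow> (s z)\<^sup>2 \<le> (s x)\<^sup>2"
          using continuous_attains_inf[OF K(1), of "\<lambda>x. (s x)\<^sup>2"] continuous_on_subset[OF sW K(2)]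
          by (auto intro!: continuous_intros)
        moreover have "(s z)\<^sup>2 > 0" using snz z(1) K(2) by auto
        ultimately show ?thesis using that by blast
      qed (use that[of 1] in auto)
      show "L2_on K n'"
      proof (rule L2_onI)
        show "n' \<in> borel_measurable (lebesgue_on K)"
          using has_ac_deriv_imp_borel_measurable[OF n' W(1)] K(2) by (rule measurable_restrict_mono)
        show "integrable (lebesgue_on K) (\<lambda>x. (1 / m) * (norm (g x))\<^sup>2)"
          using integrable_lebesgue_on_subset[OF g2 _ KL \<Omega>L] K(2) W(2)
          by (intro integrable_mult_right) blast
        show "AE x in lebesgue_on K. (norm (n' x))\<^sup>2 \<le> (1 / m) * (norm (g x))\<^sup>2"
          using AE_lebesgue_on_subset[OF key K(2) KL WL] AE_space
        proof eventually_elim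
          case (elim x)
          then have "m * (norm (n' x))\<^sup>2 \<le> (s x)\<^sup>2 * (norm (n' x))\<^sup>2"
            using m(2)[of x] by (intro mult_right_mono) auto
          moreover have "0 \<le> (s x)\<^sup>2 * (norm (n' x))\<^sup>2" "0 \<le> (s' x)\<^sup>2" by simp_all
          ultimately have "m * (norm (n' x))\<^sup>2 \<le> (norm (g x))\<^sup>2"
            using elim(1) by linarith
          then show ?case using m(1) by (simp add: field_simps)
        qed
      qed
    qed
    then show ?thesis
      using n(1) has_ac_deriv_imp_has_weak_deriv[OF n' W(1)] unfolding W12_loc_def by blast
  qed
  note wn = has_ac_deriv_weak_deriv[OF W(1) n']
  have "integrable (lebesgue_on \<Omega>) (\<lambda>x. (s x)\<^sup>2 * (norm (weak_deriv W n x))\<^sup>2)"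
    using g2
  proof (rule Bochner_Integration.integrable_bound)
    have "(\<lambda>x. (s x)\<^sup>2 * (norm (weak_deriv W n x))\<^sup>2) \<in> borel_measurable (lebesgue_on W)"
      using has_ac_deriv_imp_borel_measurable[OF wn(1) W(1)]
        continuous_imp_measurable_on_sets_lebesgue[OF sW WL] by measurable
    then have "(\<lambda>x. if x \<in> W then (s x)\<^sup>2 * (norm (weak_deriv W n x))\<^sup>2 else 0) \<in> borel_measurable (lebesgue_on \<Omega>)"
      unfolding borel_measurable_if_lebesgue_on[OF WL \<Omega>L W(2)] .
    \<comment> \<open>Off \<open>W\<close> the weak derivative of \<open>n\<close> is meaningless,
      but \<open>s\<close> vanishes there, so the product agrees with its cut-off version.\<close>
    then show "(\<lambda>x. (s x)\<^sup>2 * (norm (weak_deriv W n x))\<^sup>2) \<in> borel_measurable (lebesgue_on \<Omega>)"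
      by (subst measurable_lebesgue_cong[where g = "\<lambda>x. if x \<in> W then (s x)\<^sup>2 * (norm (weak_deriv W n x))\<^sup>2 else 0"])
        (auto simp: W_def)
    show "AE x in lebesgue_on \<Omega>. norm ((s x)\<^sup>2 * (norm (weak_deriv W n x))\<^sup>2) \<le> norm ((norm (g x))\<^sup>2)"
      using key\<Omega> AE_lebesgue_on_implies[OF wn(2) W(2) WL \<Omega>L] AE_space
    proof eventually_elim
      case (elim x)
      show ?case
      proof (cases "x \<in> W")
        case True
        have "0 \<le> (s x)\<^sup>2 * (norm (n' x))\<^sup>2" "0 \<le> (s' x)\<^sup>2" by simp_all
        then have "(s x)\<^sup>2 * (norm (n' x))\<^sup>2 \<le> (norm (g x))\<^sup>2"
          using elim(1) True by linarith
        then show ?thesis using elim(2) True by simp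
      next
        case False
        then show ?thesis using elim by (simp add: W_def)
      qed
    qed
  qed
  moreover have "n ` W \<subseteq> sphere 0 1" using n(2) by auto
  ultimately have "(s, n) \<in> class_B \<Omega>"
    using sW12 nW12 unfolding class_B_def W_def by blast
  moreover have "related \<Omega> Q s n"
    unfolding related_def
  proof (rule AE_I2)
    fix x assume "x \<in> space (lebesgue_on \<Omega>)"
    then have x: "x \<in> \<Omega>" by simp
    show "Q x = Q_of s n x"
      using QW[of x] s0[OF x] x by (cases "x \<in> W") (auto simp: W_def Q_of_eq Q_matrix_0)
  qed
  ultimately show ?thesis by blast
qed

theorem theorem4p3:
  fixes \<Omega> :: "real set" and k :: 3 and t a b c :: real
  assumes "open \<Omega>" and "connected \<Omega>" and "\<Omega> \<noteq> {}" and "bounded \<Omega>"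
    and "a < 0" and "c > 0"
  shows "(\<forall>Q \<in> class_A \<Omega>. \<exists>(s, n) \<in> class_B \<Omega>. related \<Omega> Q s n)
    \<and> (\<forall>(s, n) \<in> class_B \<Omega>. Q_of s n \<in> class_A \<Omega>)
    \<and> (\<forall>Q \<in> class_A \<Omega>. \<forall>(s, n) \<in> class_B \<Omega>. related \<Omega> Q s n \<longrightarrow>
         I_L k t a b c \<Omega> Q = I_E k t a b c \<Omega> n s)
    \<and> (\<forall>Q \<in> class_A \<Omega>. \<forall>(s, n) \<in> class_B \<Omega>. related \<Omega> Q s n \<longrightarrow>
         (is_arg_min (I_L k t a b c \<Omega>) (\<lambda>Q'. Q' \<in> class_A \<Omega>) Q \<longleftrightarrow>
          is_arg_min (\<lambda>(s', n'). I_E k t a b c \<Omega> n' s') (\<lambda>p. p \<in> class_B \<Omega>) (s, n)))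
    \<and> (\<forall>Q. is_arg_min (I_L k t a b c \<Omega>) (\<lambda>Q'. Q' \<in> class_A \<Omega>) Q \<longrightarrow>
         (\<exists>s n. related \<Omega> Q s n \<and>
            is_arg_min (\<lambda>(s', n'). I_E k t a b c \<Omega> n' s') (\<lambda>p. p \<in> class_B \<Omega>) (s, n)))
    \<and> (\<forall>s n. is_arg_min (\<lambda>(s', n'). I_E k t a b c \<Omega> n' s') (\<lambda>p. p \<in> class_B \<Omega>) (s, n) \<longrightarrow>
         is_arg_min (I_L k t a b c \<Omega>) (\<lambda>Q'. Q' \<in> class_A \<Omega>) (Q_of s n))"
proof -
  note ex = class_A_imp_class_B[OF assms(1)] and Q_of = class_B_Q_of(3)[OF assms(1)]
  note energy = related_energy_eq[OF assms(1), of _ _ _ k t a b c]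
  have rel: "related \<Omega> (Q_of s n) s n" for s n by (simp add: related_def)
  have equiv: "is_arg_min (I_L k t a b c \<Omega>) (\<lambda>Q'. Q' \<in> class_A \<Omega>) Q \<longleftrightarrow>
      is_arg_min (\<lambda>(s', n'). I_E k t a b c \<Omega> n' s') (\<lambda>p. p \<in> class_B \<Omega>) (s, n)"
    if A: "Q \<in> class_A \<Omega>" and B: "(s, n) \<in> class_B \<Omega>" and R: "related \<Omega> Q s n" for Q s n
  proof -
    \<comment> \<open>Minimality in \<open>is_arg_min\<close> means that no admissible competitor is
      strictly better. Such a competitor on either side has a related partner of equal energy on the
      other.\<close>
    have "(\<exists>Q'\<in>class_A \<Omega>. I_L k t a b c \<Omega> Q' < I_L k t a b c \<Omega> Q) \<longleftrightarrow>
        (\<exists>s' n'. (s', n') \<in> class_B \<Omega> \<and> I_E k t a b c \<Omega> n' s' < I_E k t a b c \<Omega> n s)"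
      unfolding energy[OF A B R] using ex Q_of energy rel by metis
    then show ?thesis
      using A B by (auto simp: is_arg_min_def)
  qed
  show ?thesis
    apply (intro conjI)
    subgoal using ex by blast
    subgoal using Q_of by blast
    subgoal using energy by blast
    subgoal using equiv by blast
    subgoal using ex equiv unfolding is_arg_min_def by metis
    subgoal using equiv[OF Q_of _ rel] unfolding is_arg_min_def by blast
    done
qed

end
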